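(* Let $(\Gamma, \Delta(S, E, \lambda))$ be an Artin system and let $G = \Gamma/\Gamma''$ be the metabelian top of the group $\Gamma$. Then $G$ admits a finite presentation if, and only if, it is polycyclic.
   Context: $\Delta(S,E,\lambda)$ is a finite labelled combinatorial graph: $S$ is a finite non-empty set of vertices, $E$ is a set of two-element subsets of $S$ (not necessarily all of them), and $\lambda \colon E \to \{2,3,4,\ldots\}$ is a labelling function. The Artin group $\Gamma$ of the Artin system $(\Gamma,\Delta(S,E,\lambda))$ is the group with generating set $S$ and, for each edge $e=\{s,t\}\in E$, one defining relation $u(s,t)=u(t,s)$, where $u(s,t)=sts\cdots$ is the positive alternating word in $s,t$ of length $\lambda(e)$ starting with $s$; there is no relation for pairs not in $E$. $\Gamma'$ is the derived group of $\Gamma$ and $\Gamma''=(\Gamma')'$. *)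

theory Defs
  imports "HOL-Algebra.Solvable_Groups" "HOL-Algebra.Elementary_Groups"
begin

section \<open>Groups given by generators and relations\<close>

text \<open>The letter \<open>(x, True)\<close> stands for the generator \<open>x\<close>, and \<open>(x, False)\<close> for its
  formal inverse.\<close>

type_synonym 'a word = "('a \<times> bool) list"

definition words :: "'a set \<Rightarrow> 'a word set" where
  "words X = lists (X \<times> UNIV)"

text \<open>The congruence on words over \<open>X\<close> generated by free cancellation and by the relations
  \<open>l = r\<close> for \<open>(l, r) \<in> R\<close>.\<close>

inductive pres_equiv :: "'a set \<Rightarrow> ('a word \<times> 'a word) set \<Rightarrow> 'a word \<Rightarrow> 'a word \<Rightarrow> bool"
  for X R where
    refl: "w \<in> words X \<Longrightarrow> pres_equiv X R w w"
  | sym: "pres_equiv X R v w \<Longrightarrow> pres_equiv X R w v"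
  | trans: "pres_equiv X R u v \<Longrightarrow> pres_equiv X R v w \<Longrightarrow> pres_equiv X R u w"
  | cancel: "\<lbrakk> u \<in> words X; v \<in> words X; x \<in> X \<rbrakk>
      \<Longrightarrow> pres_equiv X R (u @ [(x, b), (x, \<not> b)] @ v) (u @ v)"
  | rel: "\<lbrakk> u \<in> words X; v \<in> words X; (l, r) \<in> R; l \<in> words X; r \<in> words X \<rbrakk>
      \<Longrightarrow> pres_equiv X R (u @ l @ v) (u @ r @ v)"

definition pres_rel :: "'a set \<Rightarrow> ('a word \<times> 'a word) set \<Rightarrow> ('a word \<times> 'a word) set" where
  "pres_rel X R = {(v, w). pres_equiv X R v w}"

definition presented_group :: "'a set \<Rightarrow> ('a word \<times> 'a word) set \<Rightarrow> 'a word set monoid" where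
  "presented_group X R =
     \<lparr> carrier = words X // pres_rel X R,
       mult = (\<lambda>A B. \<Union>v\<in>A. \<Union>w\<in>B. pres_rel X R `` {v @ w}),
       one = pres_rel X R `` {[]} \<rparr>"

text \<open>Up to isomorphism, a finite set of generators may be taken to consist of natural numbers.\<close>

definition finitely_presented :: "('a, 'b) monoid_scheme \<Rightarrow> bool" where
  "finitely_presented G \<longleftrightarrow>
     (\<exists>(X :: nat set) R. finite X \<and> finite R \<and> R \<subseteq> words X \<times> words X \<and>
        G \<cong> presented_group X R)"


section \<open>Polycyclic groups\<close>

text \<open>\<open>polycyclic_seq G H\<close> says that \<open>H\<close> is the top of a finite series of subgroups of \<open>G\<close>
  starting with the trivial one, each normal in the next with cyclic factor group
  (compare \<^const>\<open>solvable_seq\<close>).\<close>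

inductive polycyclic_seq :: "('a, 'b) monoid_scheme \<Rightarrow> 'a set \<Rightarrow> bool"
  for G where
    unity: "polycyclic_seq G {\<one>\<^bsub>G\<^esub>}"
  | extension: "\<lbrakk> polycyclic_seq G K; K \<lhd> (G \<lparr> carrier := H \<rparr>); subgroup H G;
                  cyclic_group ((G \<lparr> carrier := H \<rparr>) Mod K) \<rbrakk> \<Longrightarrow> polycyclic_seq G H"

definition polycyclic :: "('a, 'b) monoid_scheme \<Rightarrow> bool" where
  "polycyclic G \<longleftrightarrow> polycyclic_seq G (carrier G)"


section \<open>Artin groups\<close>

text \<open>The values of \<open>lam\<close> outside \<open>E\<close> are irrelevant.\<close>

locale labelled_graph =
  fixes S :: "'s set" and E :: "'s set set" and lam :: "'s set \<Rightarrow> nat"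
  assumes finite_vertices: "finite S"
    and vertices_nonempty: "S \<noteq> {}"
    and edges: "E \<subseteq> {e. e \<subseteq> S \<and> card e = 2}"
    and labels: "e \<in> E \<Longrightarrow> 2 \<le> lam e"

text \<open>\<open>alt_word n s t\<close> is the positive word \<open>s t s \<dots>\<close> of length \<open>n\<close>.\<close>

primrec alt_word :: "nat \<Rightarrow> 's \<Rightarrow> 's \<Rightarrow> 's word" where
  "alt_word 0 s t = []"
| "alt_word (Suc n) s t = (s, True) # alt_word n t s"

text \<open>Each edge \<open>{s, t}\<close> contributes both \<open>u(s,t) = u(t,s)\<close> and its mirror image
  \<open>u(t,s) = u(s,t)\<close>, which is the same relation.\<close>

definition artin_relations :: "'s set set \<Rightarrow> ('s set \<Rightarrow> nat) \<Rightarrow> ('s word \<times> 's word) set" where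
  "artin_relations E lam =
     {(alt_word (lam {s, t}) s t, alt_word (lam {s, t}) t s) | s t. {s, t} \<in> E}"

definition artin_group :: "'s set \<Rightarrow> 's set set \<Rightarrow> ('s set \<Rightarrow> nat) \<Rightarrow> 's word set monoid" where
  "artin_group S E lam = presented_group S (artin_relations E lam)"

definition metabelian_top :: "('a, 'b) monoid_scheme \<Rightarrow> 'a set monoid" where
  "metabelian_top G = G Mod (derived G (derived G (carrier G)))"


section \<open>Well-definedness\<close>

lemma words_simps [simp]:
  "[] \<in> words X"
  "v @ w \<in> words X \<longleftrightarrow> v \<in> words X \<and> w \<in> words X"
  "(x, b) # w \<in> words X \<longleftrightarrow> x \<in> X \<and> w \<in> words X"
  by (auto simp: words_def)

lemma pres_equiv_words:
  "pres_equiv X R v w \<Longrightarrow> v \<in> words X \<and> w \<in> words X"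
  by (induction rule: pres_equiv.induct) auto

lemma equiv_pres_rel: "equiv (words X) (pres_rel X R)"
  by (rule equivI)
    (auto simp: pres_rel_def refl_on_def sym_def trans_def
      intro: pres_equiv.intros dest: pres_equiv_words)

lemma pres_equiv_append_context:
  assumes "pres_equiv X R v w" "p \<in> words X" "q \<in> words X"
  shows "pres_equiv X R (p @ v @ q) (p @ w @ q)"
  using assms
proof (induction rule: pres_equiv.induct)
  case (cancel u v x b)
  then show ?case using pres_equiv.cancel[of "p @ u" X "v @ q" x R b] by simp
next
  case (rel u v l r)
  then show ?case using pres_equiv.rel[of "p @ u" X "v @ q" l r R] by simp
qed (auto intro: pres_equiv.intros)

lemma pres_equiv_append:
  assumes "pres_equiv X R v v'" "pres_equiv X R w w'"
  shows "pres_equiv X R (v @ w) (v' @ w')"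
  using pres_equiv_append_context[OF assms(1), of "[]" w]
    pres_equiv_append_context[OF assms(2), of v' "[]"]
    pres_equiv_words[OF assms(1)] pres_equiv_words[OF assms(2)]
  by (auto intro: pres_equiv.trans)

lemma presented_group_mult:
  assumes "v \<in> words X" "w \<in> words X"
  shows "pres_rel X R `` {v} \<otimes>\<^bsub>presented_group X R\<^esub> pres_rel X R `` {w} = pres_rel X R `` {v @ w}"
proof -
  have "congruent2 (pres_rel X R) (pres_rel X R) (\<lambda>v w. pres_rel X R `` {v @ w})"
    by (intro congruent2I' equiv_class_eq[OF equiv_pres_rel])
      (simp add: pres_rel_def pres_equiv_append)
  from UN_equiv_class2[OF equiv_pres_rel equiv_pres_rel this assms]
  show ?thesis by (simp add: presented_group_def)
qed

lemma pres_equiv_inverse: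
  "w \<in> words X \<Longrightarrow> pres_equiv X R (map (\<lambda>(x, b). (x, \<not> b)) (rev w) @ w) []"
proof (induction w)
  case Nil
  then show ?case by (simp add: pres_equiv.refl)
next
  case (Cons a w)
  obtain x b where a: "a = (x, b)" by fastforce
  let ?i = "map (\<lambda>(x, b). (x, \<not> b)) (rev w)"
  have w: "w \<in> words X" "x \<in> X" using Cons.prems a by auto
  have "?i \<in> words X" using w by (auto simp: words_def in_lists_conv_set)
  then have "pres_equiv X R (?i @ [(x, \<not> b), (x, \<not> \<not> b)] @ w) (?i @ w)"
    using w by (intro pres_equiv.cancel)
  then show ?case using Cons.IH[OF w(1)] a by (auto intro: pres_equiv.trans)
qed

lemma group_presented_group: "group (presented_group X R)"
proof (rule groupI)
  let ?G = "presented_group X R" and ?c = "\<lambda>w. pres_rel X R `` {w}"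
  have car: "A \<in> carrier ?G \<longleftrightarrow> (\<exists>w\<in>words X. A = ?c w)" for A
    by (auto simp: presented_group_def quotient_def)
  have one: "\<one>\<^bsub>?G\<^esub> = ?c []" by (simp add: presented_group_def)
  show "A \<otimes>\<^bsub>?G\<^esub> B \<in> carrier ?G" if "A \<in> carrier ?G" "B \<in> carrier ?G" for A B
    using that by (fastforce simp: car presented_group_mult)
  show "\<one>\<^bsub>?G\<^esub> \<in> carrier ?G" by (auto simp: car one intro: bexI[of _ "[]"])
  show "A \<otimes>\<^bsub>?G\<^esub> B \<otimes>\<^bsub>?G\<^esub> C = A \<otimes>\<^bsub>?G\<^esub> (B \<otimes>\<^bsub>?G\<^esub> C)"
    if "A \<in> carrier ?G" "B \<in> carrier ?G" "C \<in> carrier ?G" for A B C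
    using that by (auto simp: car presented_group_mult)
  show "\<one>\<^bsub>?G\<^esub> \<otimes>\<^bsub>?G\<^esub> A = A" if "A \<in> carrier ?G" for A
    using that by (auto simp: car one presented_group_mult)
  show "\<exists>B\<in>carrier ?G. B \<otimes>\<^bsub>?G\<^esub> A = \<one>\<^bsub>?G\<^esub>" if A: "A \<in> carrier ?G" for A
  proof -
    obtain w where w: "w \<in> words X" "A = ?c w" using A car by auto
    let ?i = "map (\<lambda>(x, b). (x, \<not> b)) (rev w)"
    have i: "?i \<in> words X" using w by (auto simp: words_def in_lists_conv_set)
    have "?c (?i @ w) = ?c []"
      using pres_equiv_inverse[OF w(1), of R]
      by (intro equiv_class_eq[OF equiv_pres_rel]) (simp add: pres_rel_def)
    then have "?c ?i \<otimes>\<^bsub>?G\<^esub> A = \<one>\<^bsub>?G\<^esub>"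
      using w i by (simp add: presented_group_mult one)
    then show ?thesis using i car by blast
  qed
qed

lemma (in group) second_derived_normal: "derived G (derived G (carrier G)) \<lhd> G"
  using derived_is_normal derived_is_normal[OF derived_self_is_normal] by blast

lemma (in group) group_metabelian_top: "group (metabelian_top G)"
  unfolding metabelian_top_def
  by (rule normal.factorgroup_is_group[OF second_derived_normal])

lemma group_artin_group: "group (artin_group S E lam)"
  unfolding artin_group_def by (rule group_presented_group)

end

theory Submission
  imports Defs "HOL-Combinatorics.Transposition"
begin

text \<open>
  Let \<open>A = G'\<close> be the derived group of the metabelian top \<open>G\<close>, and call the classes of vertices
  joined by odd edges components. By the theorem of Bieri and Strebel, a finitely presented metabelian
  group is, along each epimorphism \<open>\<chi>\<close> onto \<open>\<int>\<close>, an ascending or a descending HNN extension with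
  finitely generated base. Inverting all generators is an automorphism of \<open>G\<close>, so both cases
  occur together and \<open>ker \<chi>\<close> is finitely generated as soon as \<open>\<chi> s = 1\<close> for some vertex \<open>s\<close>.

  Comparison with lamplighter groups then shows that \<open>A\<close> is the normal closure of the finitely many
  quotients \<open>u = t s\<inverse>\<close> of vertices of odd edges. A power of each vertex of the component of \<open>u\<close>
  centralizes \<open>u\<close>, and for a vertex \<open>v\<close> of another component \<open>u\<close> lies in a finitely generated
  subgroup of \<open>A\<close> normalized by \<open>v\<close>, by an argument that only involves the retract of \<open>G\<close> generated by
  the two components. Therefore \<open>A\<close> is finitely generated, which makes \<open>G\<close> polycyclic.
\<close>

section \<open>Conjugation and generated subgroups\<close>

text \<open>Conjugation makes \<open>A\<close> a module over the group ring of the abelian group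
  \<open>G / A\<close>. Finite generation of \<open>ker \<chi>\<close> is weaker than what is
  wanted: with several components that kernel is much larger than \<open>A\<close>. Moreover, no
  power of a vertex outside the component of \<open>u\<close> is known to centralize
  \<open>u\<close>. On the retract to two components, however, the image in \<open>G / A\<close> is
  generated by two elements \<open>x\<close> and \<open>y\<close>, so each of the two kernels
  becomes cyclic modulo \<open>A\<close>, and the retracted part of \<open>A\<close> is finitely
  generated over \<open>x\<close> and over \<open>y\<close> separately. This alone does not suffice:
  in the ring of Laurent polynomials \<open>x\<close> and \<open>y\<close> may both act as the
  variable. The extra input is that the module generators form two families, one fixed by a power of
  \<open>x\<close> and one by a power of \<open>y\<close>. Normal forms in HNN extensions are
  avoided. If neither associated subgroup were the whole base, an explicit action on
  \<open>G \<times> \<int>\<close> would make two elements of \<open>A\<close> act without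
  commuting.\<close>

definition cj :: "('a, 'b) monoid_scheme \<Rightarrow> 'a \<Rightarrow> 'a \<Rightarrow> 'a" where
  "cj G g a = g \<otimes>\<^bsub>G\<^esub> a \<otimes>\<^bsub>G\<^esub> inv\<^bsub>G\<^esub> g"

context group
begin

lemma inv_cancel_left [simp]:
  "x \<in> carrier G \<Longrightarrow> y \<in> carrier G \<Longrightarrow> inv x \<otimes> (x \<otimes> y) = y"
  "x \<in> carrier G \<Longrightarrow> y \<in> carrier G \<Longrightarrow> x \<otimes> (inv x \<otimes> y) = y"
  by (simp_all flip: m_assoc)

lemmas group_simps = m_assoc inv_mult_group

lemma cj_closed [simp, intro]: "g \<in> carrier G \<Longrightarrow> a \<in> carrier G \<Longrightarrow> cj G g a \<in> carrier G"
  by (simp add: cj_def)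

lemma cj_mult:
  "g \<in> carrier G \<Longrightarrow> a \<in> carrier G \<Longrightarrow> b \<in> carrier G \<Longrightarrow> cj G g (a \<otimes> b) = cj G g a \<otimes> cj G g b"
  by (simp add: cj_def group_simps)

lemma cj_inv: "g \<in> carrier G \<Longrightarrow> a \<in> carrier G \<Longrightarrow> cj G g (inv a) = inv (cj G g a)"
  by (simp add: cj_def group_simps)

lemma cj_one [simp]: "g \<in> carrier G \<Longrightarrow> cj G g \<one> = \<one>"
  by (simp add: cj_def)

lemma cj_by_one [simp]: "a \<in> carrier G \<Longrightarrow> cj G \<one> a = a"
  by (simp add: cj_def)

lemma cj_cj:
  "g \<in> carrier G \<Longrightarrow> h \<in> carrier G \<Longrightarrow> a \<in> carrier G \<Longrightarrow> cj G g (cj G h a) = cj G (g \<otimes> h) a"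
  by (simp add: cj_def group_simps)

lemma cj_cancel [simp]:
  "g \<in> carrier G \<Longrightarrow> a \<in> carrier G \<Longrightarrow> cj G g (cj G (inv g) a) = a"
  "g \<in> carrier G \<Longrightarrow> a \<in> carrier G \<Longrightarrow> cj G (inv g) (cj G g a) = a"
  by (simp_all add: cj_cj)

lemma cj_eq_self_iff:
  "g \<in> carrier G \<Longrightarrow> a \<in> carrier G \<Longrightarrow> cj G g a = a \<longleftrightarrow> g \<otimes> a = a \<otimes> g"
  unfolding cj_def by (metis inv_closed inv_solve_right' m_closed)

lemma cj_hom: "g \<in> carrier G \<Longrightarrow> cj G g \<in> hom G G"
  by (auto simp: hom_def cj_mult)

lemma group_hom_cj: "g \<in> carrier G \<Longrightarrow> group_hom G G (cj G g)"
  by (simp add: group_hom_def group_hom_axioms_def cj_hom)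

lemma generate_cj_image:
  "g \<in> carrier G \<Longrightarrow> F \<subseteq> carrier G \<Longrightarrow> cj G g ` generate G F = generate G (cj G g ` F)"
  using group_hom.generate_img[OF group_hom_cj] by metis

lemma generate_cj_closed:
  assumes "g \<in> carrier G" "F \<subseteq> carrier G" "\<And>f. f \<in> F \<Longrightarrow> cj G g f \<in> generate G F"
    "b \<in> generate G F"
  shows "cj G g b \<in> generate G F"
proof -
  have "cj G g ` generate G F \<subseteq> generate G F"
    unfolding generate_cj_image[OF assms(1,2)]
    using assms by (intro generate_subgroup_incl generate_is_subgroup) auto
  then show ?thesis using assms(4) by blast
qed

lemma cj_int_pow_closed:
  assumes g: "g \<in> carrier G" and K: "K \<subseteq> carrier G"
    and closed: "\<And>b. b \<in> K \<Longrightarrow> cj G g b \<in> K" "\<And>b. b \<in> K \<Longrightarrow> cj G (inv g) b \<in> K"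
    and b: "b \<in> K"
  shows "cj G (g [^] (n::int)) b \<in> K"
proof -
  have bc: "b \<in> carrier G" using b K by blast
  have "cj G (g [^] int j) b \<in> K \<and> cj G (g [^] (- int j)) b \<in> K" for j
  proof (induction j)
    case (Suc j)
    have 1: "cj G (g [^] int (Suc j)) b = cj G g (cj G (g [^] int j) b)"
      using bc g int_pow_mult[OF g, of 1 "int j"] by (simp add: cj_cj)
    have "g [^] (- 1 + - int j) = g [^] (-1::int) \<otimes> g [^] (- int j)"
      by (rule int_pow_mult[OF g])
    then have 2: "cj G (g [^] (- int (Suc j))) b = cj G (inv g) (cj G (g [^] (- int j)) b)"
      using bc g int_pow_neg[OF g, of 1] by (simp add: cj_cj)
    show ?case unfolding 1 2 using Suc closed by blast
  qed (use b bc in simp)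
  from this[of "nat n"] this[of "nat (- n)"] show ?thesis by (cases "0 \<le> n") simp_all
qed

lemma generate_absorb:
  "F \<subseteq> carrier G \<Longrightarrow> H \<subseteq> generate G F \<Longrightarrow> generate G H \<subseteq> generate G F"
  by (rule generate_subgroup_incl[OF _ generate_is_subgroup])

lemma subgroup_derived: "subgroup (derived G (carrier G)) G"
  by (rule derived_is_subgroup) simp

lemma commutator_in_derived:
  "a \<in> carrier G \<Longrightarrow> b \<in> carrier G \<Longrightarrow> a \<otimes> b \<otimes> inv a \<otimes> inv b \<in> derived G (carrier G)"
  unfolding derived_def by (rule generate.incl) blast

lemma derived_cj:
  "g \<in> carrier G \<Longrightarrow> a \<in> derived G (carrier G) \<Longrightarrow> cj G g a \<in> derived G (carrier G)"
  unfolding cj_def using normal.inv_op_closed2[OF derived_self_is_normal] by blast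

lemma cj_in_supergroup_of_derived:
  assumes "subgroup H G" "derived G (carrier G) \<subseteq> H" "g \<in> carrier G" "h \<in> H"
  shows "cj G g h \<in> H"
proof -
  have h: "h \<in> carrier G" by (rule subgroup.mem_carrier[OF assms(1,4)])
  have "cj G g h = (g \<otimes> h \<otimes> inv g \<otimes> inv h) \<otimes> h"
    using h assms(3) by (simp add: cj_def group_simps)
  moreover have "g \<otimes> h \<otimes> inv g \<otimes> inv h \<in> H"
    using commutator_in_derived[OF assms(3) h] assms(2) by blast
  ultimately show ?thesis using subgroup.m_closed[OF assms(1) _ assms(4)] by simp
qed

lemma hom_eq_on_generate:
  assumes "h \<in> hom G K" "h' \<in> hom G K" "group K" "F \<subseteq> carrier G"
    and "\<And>f. f \<in> F \<Longrightarrow> h f = h' f" and "g \<in> generate G F"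
  shows "h g = h' g"
proof -
  interpret h: group_hom G K h using assms by (simp add: group_hom_def group_hom_axioms_def)
  interpret h': group_hom G K h' using assms by (simp add: group_hom_def group_hom_axioms_def)
  show ?thesis using assms(6)
  proof (induction)
    case (eng h1 h2)
    then show ?case using generate_in_carrier[OF assms(4)] by simp
  qed (use assms in auto)
qed

end


section \<open>Evaluation of words\<close>

definition word_eval :: "('g, 'm) monoid_scheme \<Rightarrow> ('x \<Rightarrow> 'g) \<Rightarrow> 'x word \<Rightarrow> 'g" where
  "word_eval G k w = foldr (\<lambda>(x, b) a. (if b then k x else inv\<^bsub>G\<^esub> k x) \<otimes>\<^bsub>G\<^esub> a) w \<one>\<^bsub>G\<^esub>"

lemma word_eval_simps [simp]:
  "word_eval G k [] = \<one>\<^bsub>G\<^esub>"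
  "word_eval G k ((x, b) # w) = (if b then k x else inv\<^bsub>G\<^esub> k x) \<otimes>\<^bsub>G\<^esub> word_eval G k w"
  by (simp_all add: word_eval_def)

lemma word_eval_cong:
  "w \<in> words X \<Longrightarrow> (\<And>x. x \<in> X \<Longrightarrow> k x = k' x) \<Longrightarrow> word_eval G k w = word_eval G k' w"
  by (induction w) auto

context group
begin

lemma word_eval_closed [simp, intro]:
  "w \<in> words X \<Longrightarrow> k \<in> X \<rightarrow> carrier G \<Longrightarrow> word_eval G k w \<in> carrier G"
  by (induction w) (auto simp: Pi_iff)

lemma word_eval_append:
  assumes "v \<in> words X" "w \<in> words X" "k \<in> X \<rightarrow> carrier G"
  shows "word_eval G k (v @ w) = word_eval G k v \<otimes> word_eval G k w"
  using assms(1)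
proof (induction v)
  case Nil
  then show ?case using assms by auto
next
  case (Cons a v)
  obtain x b where "a = (x, b)" by fastforce
  then show ?case using Cons assms by (auto simp: Pi_iff m_assoc intro: word_eval_closed[unfolded Pi_iff])
qed

lemma word_eval_hom:
  assumes "h \<in> hom G K" "group K" "w \<in> words X" "k \<in> X \<rightarrow> carrier G"
  shows "h (word_eval G k w) = word_eval K (\<lambda>x. h (k x)) w"
proof -
  interpret h: group_hom G K h using assms by (simp add: group_hom_def group_hom_axioms_def)
  show ?thesis using assms(3)
  proof (induction w)
    case (Cons a w)
    obtain x b where "a = (x, b)" by fastforce
    then show ?case using Cons assms(4) by (auto simp: Pi_iff)
  qed simp
qed

lemma word_eval_pres_equiv:
  assumes "pres_equiv X R v w" "k \<in> X \<rightarrow> carrier G"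
    and "\<And>l r. (l, r) \<in> R \<Longrightarrow> l \<in> words X \<Longrightarrow> r \<in> words X \<Longrightarrow> word_eval G k l = word_eval G k r"
  shows "word_eval G k v = word_eval G k w"
  using assms(1)
proof (induction)
  case (cancel u v x b)
  then have "k x \<in> carrier G" using assms(2) by auto
  moreover have "word_eval G k v \<in> carrier G" using cancel assms(2) by blast
  ultimately have "word_eval G k ([(x, b), (x, \<not> b)] @ v) = word_eval G k v" by simp
  moreover have "[(x, b), (x, \<not> b)] @ v \<in> words X" using cancel by simp
  ultimately show ?case
    using cancel assms(2) word_eval_append[of u X "[(x, b), (x, \<not> b)] @ v" k] word_eval_append[of u X v k]
    by simp
next
  case (rel u v l r)
  then show ?case using assms(2,3) by (simp add: word_eval_append[where X = X])
qed auto

lemma word_generate: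
  assumes "k \<in> X \<rightarrow> carrier G" "g \<in> generate G (k ` X)"
  shows "\<exists>w\<in>words X. word_eval G k w = g"
  using assms(2)
proof (induction)
  case one
  show ?case by (intro bexI[of _ "[]"]) simp_all
next
  case (incl h)
  then obtain x where "x \<in> X" "h = k x" by auto
  then show ?case using assms(1) by (intro bexI[of _ "[(x, True)]"]) (auto simp: Pi_iff)
next
  case (inv h)
  then obtain x where "x \<in> X" "h = k x" by auto
  then show ?case using assms(1) by (intro bexI[of _ "[(x, False)]"]) (auto simp: Pi_iff)
next
  case (eng h1 h2)
  then show ?case using word_eval_append[OF _ _ assms(1)] words_simps(2) by metis
qed

lemma word_eval_in_generate:
  assumes "w \<in> words X" "k \<in> X \<rightarrow> carrier G"
  shows "word_eval G k w \<in> generate G (k ` X)"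
  using assms(1)
proof (induction w)
  case (Cons a w)
  obtain x b where "a = (x, b)" by fastforce
  then show ?case using Cons assms(2) by (auto intro: generate.intros)
qed (simp add: generate.one)

end


section \<open>Presentations\<close>

text \<open>A presentation inside \<open>G\<close> itself, with the images \<open>k\<close> of the
  generators kept. \<open>finitely_presented\<close> hides them behind an isomorphism, whereas here
  words can be evaluated in \<open>G\<close> and a presentation of a subgroup can be
  extended.\<close>

definition presentation_of ::
    "('g, 'm) monoid_scheme \<Rightarrow> 'x set \<Rightarrow> ('x word \<times> 'x word) set \<Rightarrow> ('x \<Rightarrow> 'g) \<Rightarrow> bool" where
  "presentation_of G X R k \<longleftrightarrow> k \<in> X \<rightarrow> carrier G \<and> generate G (k ` X) = carrier G \<and>
     (\<forall>v\<in>words X. \<forall>w\<in>words X. word_eval G k v = word_eval G k w \<longleftrightarrow> pres_equiv X R v w)"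

definition pclass :: "'x set \<Rightarrow> ('x word \<times> 'x word) set \<Rightarrow> 'x word \<Rightarrow> 'x word set" where
  "pclass X R w = pres_rel X R `` {w}"

lemma pclass_eq_iff:
  "v \<in> words X \<Longrightarrow> w \<in> words X \<Longrightarrow> pclass X R v = pclass X R w \<longleftrightarrow> pres_equiv X R v w"
  unfolding pclass_def using eq_equiv_class_iff[OF equiv_pres_rel, of v X w R]
  by (simp add: pres_rel_def)

lemma pclass_carrier: "carrier (presented_group X R) = pclass X R ` words X"
  by (auto simp: presented_group_def quotient_def pclass_def)

lemma pclass_append:
  "v \<in> words X \<Longrightarrow> w \<in> words X \<Longrightarrow>
     pclass X R (v @ w) = pclass X R v \<otimes>\<^bsub>presented_group X R\<^esub> pclass X R w"
  by (simp add: pclass_def presented_group_mult)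

lemma pclass_Nil: "pclass X R [] = \<one>\<^bsub>presented_group X R\<^esub>"
  by (simp add: pclass_def presented_group_def)

lemma pclass_letter:
  assumes "x \<in> X"
  shows "pclass X R [(x, b)] = (if b then pclass X R [(x, True)]
           else inv\<^bsub>presented_group X R\<^esub> pclass X R [(x, True)])"
proof -
  interpret P: group "presented_group X R" by (rule group_presented_group)
  have "pres_equiv X R ([] @ [(x, False), (x, \<not> False)] @ []) ([] @ [])"
    using assms by (intro pres_equiv.cancel) auto
  then have "pclass X R ([(x, False)] @ [(x, True)]) = pclass X R []"
    using assms by (subst pclass_eq_iff) auto
  then have "pclass X R [(x, False)] \<otimes>\<^bsub>presented_group X R\<^esub> pclass X R [(x, True)] =
      \<one>\<^bsub>presented_group X R\<^esub>"
    using assms by (subst (asm) pclass_append) (auto simp: pclass_Nil)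
  then have "inv\<^bsub>presented_group X R\<^esub> pclass X R [(x, True)] = pclass X R [(x, False)]"
    using assms by (intro P.inv_equality) (auto simp: pclass_carrier)
  then show ?thesis by (cases b) simp_all
qed

lemma word_eval_pclass:
  "w \<in> words X \<Longrightarrow> word_eval (presented_group X R) (\<lambda>x. pclass X R [(x, True)]) w = pclass X R w"
proof (induction w)
  case Nil
  then show ?case by (simp add: pclass_Nil)
next
  case (Cons a w)
  obtain x b where a: "a = (x, b)" by fastforce
  then have "pclass X R (a # w) = pclass X R [(x, b)] \<otimes>\<^bsub>presented_group X R\<^esub> pclass X R w"
    using Cons.prems pclass_append[of "[(x, b)]" X w] by simp
  then show ?case using Cons a pclass_letter[of x X R b] by simp
qed

lemma presentation_of_presented_group:
  "presentation_of (presented_group X R) X R (\<lambda>x. pclass X R [(x, True)])"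
proof -
  interpret P: group "presented_group X R" by (rule group_presented_group)
  let ?k = "\<lambda>x. pclass X R [(x, True)]"
  have k: "?k \<in> X \<rightarrow> carrier (presented_group X R)" by (auto simp: pclass_carrier)
  have "pclass X R w \<in> generate (presented_group X R) (?k ` X)" if "w \<in> words X" for w
    using P.word_eval_in_generate[OF that k] word_eval_pclass[OF that, of R] by simp
  then have "generate (presented_group X R) (?k ` X) = carrier (presented_group X R)"
    using P.generate_incl[of "?k ` X"] funcset_image[OF k] by (auto simp: pclass_carrier)
  then show ?thesis
    unfolding presentation_of_def using k by (simp add: word_eval_pclass pclass_eq_iff)
qed

context group
begin

lemma presentation_surj:
  "presentation_of G X R k \<Longrightarrow> g \<in> carrier G \<Longrightarrow> \<exists>w\<in>words X. word_eval G k w = g"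
  unfolding presentation_of_def using word_generate by blast

text \<open>Von Dyck's theorem. An element is sent to the value in \<open>K\<close> of a chosen word
  for it; two words for the same element are congruent, so the choice does not matter.\<close>

lemma presentation_hom:
  assumes P: "presentation_of G X R k" and K: "group K" and f: "f \<in> X \<rightarrow> carrier K"
    and R: "\<And>l r. (l, r) \<in> R \<Longrightarrow> l \<in> words X \<Longrightarrow> r \<in> words X \<Longrightarrow> word_eval K f l = word_eval K f r"
  shows "\<exists>h\<in>hom G K. \<forall>w\<in>words X. h (word_eval G k w) = word_eval K f w"
proof -
  interpret K: group K by fact
  define wd where "wd g = (SOME w. w \<in> words X \<and> word_eval G k w = g)" for g
  have wd: "wd g \<in> words X" "word_eval G k (wd g) = g" if "g \<in> carrier G" for g
    using someI_ex[of "\<lambda>w. w \<in> words X \<and> word_eval G k w = g"] presentation_surj[OF P that]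
    unfolding wd_def by blast+
  have k: "k \<in> X \<rightarrow> carrier G" using P by (simp add: presentation_of_def)
  have eq: "word_eval K f v = word_eval K f w"
    if "v \<in> words X" "w \<in> words X" "word_eval G k v = word_eval G k w" for v w
    using K.word_eval_pres_equiv[where v = v and w = w, OF _ f R] P that by (auto simp: presentation_of_def)
  have h: "word_eval K f (wd (word_eval G k w)) = word_eval K f w" if "w \<in> words X" for w
    using that k by (intro eq wd) auto
  have "(\<lambda>g. word_eval K f (wd g)) \<in> hom G K"
  proof (rule homI)
    fix g g' assume g: "g \<in> carrier G" "g' \<in> carrier G"
    have "word_eval K f (wd (g \<otimes> g')) = word_eval K f (wd g @ wd g')"
      using g wd k by (intro eq) (auto simp: word_eval_append[where X = X])
    then show "word_eval K f (wd (g \<otimes> g')) = word_eval K f (wd g) \<otimes>\<^bsub>K\<^esub> word_eval K f (wd g')"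
      using g wd f by (simp add: K.word_eval_append[where X = X])
  qed (use wd f in auto)
  then show ?thesis using h by (intro bexI) auto
qed

lemma presentation_iso:
  assumes "presentation_of G X R k"
  shows "G \<cong> presented_group X R"
proof -
  let ?P = "presented_group X R" and ?f = "\<lambda>x. pclass X R [(x, True)]"
  interpret P: group ?P by (rule group_presented_group)
  have k: "k \<in> X \<rightarrow> carrier G" using assms by (simp add: presentation_of_def)
  have f: "?f \<in> X \<rightarrow> carrier ?P" by (auto simp: pclass_carrier)
  have R: "word_eval ?P ?f l = word_eval ?P ?f r"
    if "(l, r) \<in> R" "l \<in> words X" "r \<in> words X" for l r
    using that pres_equiv.rel[of "[]" X "[]" l r R]
    by (simp add: word_eval_pclass pclass_eq_iff)
  obtain h where h: "h \<in> hom G ?P" "\<And>w. w \<in> words X \<Longrightarrow> h (word_eval G k w) = pclass X R w"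
    using presentation_hom[OF assms group_presented_group f R] by (auto simp: word_eval_pclass)
  have "inj_on h (carrier G)"
  proof
    fix g g' assume g: "g \<in> carrier G" "g' \<in> carrier G" "h g = h g'"
    obtain w w' where "w \<in> words X" "w' \<in> words X" "g = word_eval G k w" "g' = word_eval G k w'"
      using presentation_surj[OF assms] g by metis
    then show "g = g'"
      using g h assms by (simp add: pclass_eq_iff presentation_of_def)
  qed
  moreover have "h ` carrier G = carrier ?P"
  proof
    show "h ` carrier G \<subseteq> carrier ?P" using h(1) hom_carrier by blast
    show "carrier ?P \<subseteq> h ` carrier G"
    proof
      fix p assume "p \<in> carrier ?P"
      then obtain w where "w \<in> words X" "p = pclass X R w" by (auto simp: pclass_carrier)
      then show "p \<in> h ` carrier G" using h(2)[of w] word_eval_closed[OF _ k] by force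
    qed
  qed
  ultimately have "h \<in> iso G ?P" using h(1) by (auto simp: iso_def bij_betw_def)
  then show ?thesis by (auto simp: is_iso_def)
qed

lemma finitely_presented_imp_presentation:
  assumes "finitely_presented G"
  shows "\<exists>(X :: nat set) R k. finite X \<and> finite R \<and> R \<subseteq> words X \<times> words X \<and> presentation_of G X R k"
proof -
  obtain X :: "nat set" and R where XR: "finite X" "finite R" "R \<subseteq> words X \<times> words X"
    "G \<cong> presented_group X R"
    using assms by (auto simp: finitely_presented_def)
  let ?P = "presented_group X R" and ?f = "\<lambda>x. pclass X R [(x, True)]"
  interpret P: group ?P by (rule group_presented_group)
  obtain h where h: "h \<in> iso ?P G"
    using XR(4) iso_sym by (auto simp: is_iso_def)
  then have hom: "h \<in> hom ?P G" and bij: "bij_betw h (carrier ?P) (carrier G)"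
    by (auto simp: iso_def)
  interpret h: group_hom ?P G h
    using hom by (simp add: group_hom_def group_hom_axioms_def)
  have f: "?f \<in> X \<rightarrow> carrier ?P" by (auto simp: pclass_carrier)
  note pp = presentation_of_presented_group[of X R, unfolded presentation_of_def]
  have ev: "word_eval G (\<lambda>x. h (?f x)) w = h (pclass X R w)" if "w \<in> words X" for w
    using P.word_eval_hom[OF hom is_group that f] word_eval_pclass[OF that, of R] by simp
  have "generate G ((\<lambda>x. h (?f x)) ` X) = h ` generate ?P (?f ` X)"
    using h.generate_img[of "?f ` X"] f by (auto simp: image_image)
  also have "\<dots> = carrier G" using pp bij by (simp add: bij_betw_def)
  finally have "presentation_of G X R (\<lambda>x. h (?f x))"
    unfolding presentation_of_def using f ev
  proof (intro conjI ballI)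
    show "(\<lambda>x. h (?f x)) \<in> X \<rightarrow> carrier G" using f h.hom_closed by (auto simp: Pi_iff)
    fix v w assume "v \<in> words X" "w \<in> words X"
    then show "word_eval G (\<lambda>x. h (?f x)) v = word_eval G (\<lambda>x. h (?f x)) w \<longleftrightarrow> pres_equiv X R v w"
      using bij by (auto simp: ev pclass_carrier bij_betw_def pclass_eq_iff inj_on_eq_iff)
  qed auto
  then show ?thesis using XR by blast
qed

end

section \<open>The theorem of Bieri and Strebel\<close>

text \<open>The target of the action in \<open>associated_subgroup_full\<close>. Its elements
  permute a whole type, so points outside the carrier of \<open>G\<close> will simply be
  fixed.\<close>

definition perm_group :: "('a \<Rightarrow> 'a) monoid" where
  "perm_group = \<lparr>carrier = {f. bij f}, mult = (\<circ>), one = id\<rparr>"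

lemma perm_group_simps [simp]:
  "carrier perm_group = {f. bij f}" "f \<otimes>\<^bsub>perm_group\<^esub> g = f \<circ> g" "\<one>\<^bsub>perm_group\<^esub> = id"
  by (simp_all add: perm_group_def)

lemma group_perm_group [simp]: "group perm_group"
  by (rule groupI)
    (auto simp: bij_comp comp_assoc intro!: exI[of _ "inv_into UNIV _"] bij_imp_bij_inv
      inv_o_cancel bij_is_inj)

lemma inv_perm_group [simp]: "bij f \<Longrightarrow> inv\<^bsub>perm_group\<^esub> f = inv_into UNIV f"
  by (rule group.inv_equality[OF group_perm_group])
    (auto simp: bij_imp_bij_inv inv_o_cancel bij_is_inj)

lemma group_hom_integer:
  "group G \<Longrightarrow> c \<in> hom G integer_group \<Longrightarrow> group_hom G integer_group c"
  by (simp add: group_hom_def group_hom_axioms_def)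

text \<open>An epimorphism onto \<int> together with a section: every element is a power of
  \<open>t\<close> times an element of the kernel of \<open>c\<close>.\<close>

locale character = group G for G (structure) +
  fixes c :: "'a \<Rightarrow> int" and t
  assumes c_hom: "c \<in> hom G integer_group" and t_closed [simp]: "t \<in> carrier G" and c_t [simp]: "c t = 1"
begin

sublocale c: group_hom G integer_group c
  by (rule group_hom_integer[OF is_group c_hom])

lemma c_simps [simp]:
  "a \<in> carrier G \<Longrightarrow> b \<in> carrier G \<Longrightarrow> c (a \<otimes> b) = c a + c b"
  "a \<in> carrier G \<Longrightarrow> c (inv a) = - c a"
  "c \<one> = 0"
  using c.hom_mult c.hom_inv c.hom_one by auto

lemma c_int_pow [simp]: "a \<in> carrier G \<Longrightarrow> c (a [^] (n::int)) = n * c a"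
  using c.hom_int_pow[of a n] by simp

lemma c_cj [simp]: "g \<in> carrier G \<Longrightarrow> a \<in> carrier G \<Longrightarrow> c (cj G g a) = c a"
  by (simp add: cj_def)

lemma c_generate:
  assumes "F \<subseteq> carrier G" "\<And>f. f \<in> F \<Longrightarrow> c f = 0" "b \<in> generate G F"
  shows "c b = 0"
  using assms(3)
proof induction
  case (inv h)
  then have "h \<in> carrier G" using assms(1) by blast
  then show ?case using inv assms(2) by simp
next
  case (eng h1 h2)
  then show ?case using generate_in_carrier[OF assms(1)] by simp
qed (use assms(2) in auto)

end

text \<open>No decomposition of \<open>G\<close> is assumed. The data are a finite presentation and
  a character with a section; the HNN structure is what gets proved.\<close>

locale HNN = character G c t for G (structure) and c :: "'a \<Rightarrow> int" and t +
  fixes X :: "'x set" and R and k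
  assumes pres: "presentation_of G X R k" and finite_X: "finite X" and finite_R: "finite R"
begin

text \<open>Each generator is corrected by a power of \<open>t\<close> so that it falls into the
  kernel of \<open>c\<close>. The conjugates of these elements by powers of \<open>t\<close>
  generate the kernel, as in the Reidemeister-Schreier method.\<close>

definition a :: "'x \<Rightarrow> 'a" where "a x = t [^] (- c (k x)) \<otimes> k x"

text \<open>Level \<open>j\<close> consists of the conjugates of the \<open>a x\<close> by
  \<open>t^j\<close>. The window starts at \<open>0\<close> because any bounded window can be
  shifted there by a power of \<open>t\<close>.\<close>

definition Bgen :: "int \<Rightarrow> 'a set" where "Bgen m = (\<lambda>(j, x). cj G (t [^] j) (a x)) ` ({0..m} \<times> X)"

definition B :: "int \<Rightarrow> 'a set" where "B m = generate G (Bgen m)"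

lemma k: "k \<in> X \<rightarrow> carrier G" using pres by (simp add: presentation_of_def)

lemma k_closed [simp]: "x \<in> X \<Longrightarrow> k x \<in> carrier G" using k by auto

lemma a_closed [simp]: "x \<in> X \<Longrightarrow> a x \<in> carrier G"
  by (simp add: a_def)

lemma c_a [simp]: "x \<in> X \<Longrightarrow> c (a x) = 0"
  by (simp add: a_def)

lemma Bgen_closed: "Bgen m \<subseteq> carrier G"
  by (auto simp: Bgen_def)

lemma subgroup_B: "subgroup (B m) G"
  unfolding B_def by (rule generate_is_subgroup[OF Bgen_closed])

lemma B_closed: "b \<in> B m \<Longrightarrow> b \<in> carrier G"
  using subgroup.mem_carrier[OF subgroup_B] .

lemma c_B: "b \<in> B m \<Longrightarrow> c b = 0"
  unfolding B_def by (rule c_generate[OF Bgen_closed]) (auto simp: Bgen_def)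

lemma finite_Bgen: "finite (Bgen m)"
  using finite_X by (simp add: Bgen_def)

lemma B_I: "0 \<le> j \<Longrightarrow> j \<le> m \<Longrightarrow> x \<in> X \<Longrightarrow> cj G (t [^] j) (a x) \<in> B m"
  unfolding B_def by (rule generate.incl) (auto simp: Bgen_def)

lemma cj_t_pow: "b \<in> carrier G \<Longrightarrow> cj G (t [^] (i::int)) (cj G (t [^] (j::int)) b) = cj G (t [^] (i + j)) b"
  by (simp add: cj_cj int_pow_mult)

lemma cj_t_Bgen: "cj G t ` Bgen (m - 1) \<subseteq> Bgen m"
proof
  fix b assume "b \<in> cj G t ` Bgen (m - 1)"
  then obtain j x where jx: "0 \<le> j" "j \<le> m - 1" "x \<in> X" "b = cj G t (cj G (t [^] j) (a x))"
    by (auto simp: Bgen_def)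
  then have "b = cj G (t [^] (1 + j)) (a x)"
    using cj_t_pow[of "a x" 1 j] by simp
  then show "b \<in> Bgen m" using jx unfolding Bgen_def
    by (intro image_eqI[of _ _ "(1 + j, x)"]) auto
qed

lemma cj_t_B: "b \<in> B (m - 1) \<Longrightarrow> cj G t b \<in> B m"
  using generate_cj_image[OF t_closed Bgen_closed, of "m - 1"] mono_generate[OF cj_t_Bgen, of m]
  unfolding B_def by blast

lemma B_mono: "m \<le> n \<Longrightarrow> B m \<subseteq> B n"
  unfolding B_def by (rule mono_generate) (force simp: Bgen_def)

text \<open>The relation \<open>stable\<close> is iterated \<open>j\<close> times. The elements
  conjugated on the way have levels \<open>0\<close> to \<open>j - 1\<close>, at most
  \<open>m - 1\<close>, so they lie in \<open>B (m - 1)\<close>, while the last result may have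
  level \<open>m\<close>.\<close>

lemma stable_shift:
  fixes K :: "('k, 'm) monoid_scheme"
  assumes K: "group K" and s: "s \<in> carrier K" and r_closed: "\<And>b. b \<in> B m \<Longrightarrow> r b \<in> carrier K"
    and stable: "\<And>b. b \<in> B (m - 1) \<Longrightarrow> cj K s (r b) = r (cj G t b)"
    and j: "0 \<le> j" "j \<le> m" and x: "x \<in> X"
  shows "cj K (s [^]\<^bsub>K\<^esub> j) (r (a x)) = r (cj G (t [^] j) (a x))"
proof -
  interpret K: group K by fact
  have rax: "r (a x) \<in> carrier K" using B_I[of 0 m x] j x r_closed by simp
  have "int i \<le> m \<Longrightarrow> cj K (s [^]\<^bsub>K\<^esub> int i) (r (a x)) = r (cj G (t [^] int i) (a x))" for i
  proof (induction i)
    case (Suc i)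
    have "cj G (t [^] int i) (a x) \<in> B (m - 1)" using Suc.prems x by (auto intro: B_I)
    then have "r (cj G t (cj G (t [^] int i) (a x))) = cj K s (cj K (s [^]\<^bsub>K\<^esub> int i) (r (a x)))"
      using stable Suc by simp
    then show ?case
      using s rax K.int_pow_mult[OF s, of 1 "int i"] cj_t_pow[of "a x" 1 "int i"] x by (simp add: K.cj_cj)
  qed (use rax x in simp)
  from this[of "nat j"] show ?thesis using j by simp
qed

text \<open>For large \<open>m\<close> the relators only see the levels \<open>0, \<dots>, m\<close>, so \<open>G\<close> is the HNN extension
  of \<open>B m\<close> with stable letter \<open>t\<close> and associated subgroups \<open>B (m - 1)\<close> and \<open>t B (m - 1) t\<inverse>\<close>;
  what is used is its universal property.\<close>

lemma HNN_word_eval: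
  fixes K :: "('k, 'm) monoid_scheme"
  assumes K: "group K" and s: "s \<in> carrier K" and rho_closed: "\<And>b. b \<in> B m \<Longrightarrow> r b \<in> carrier K"
    and rho: "\<And>b b'. b \<in> B m \<Longrightarrow> b' \<in> B m \<Longrightarrow> r (b \<otimes> b') = r b \<otimes>\<^bsub>K\<^esub> r b'"
    and stable: "\<And>b. b \<in> B (m - 1) \<Longrightarrow> cj K s (r b) = r (cj G t b)"
    and C: "\<And>x. x \<in> X \<Longrightarrow> \<bar>c (k x)\<bar> \<le> C" and m: "m \<ge> 2 * q"
    and w: "w \<in> words X" "int (length w) * C \<le> q"
  defines "f \<equiv> \<lambda>x. s [^]\<^bsub>K\<^esub> c (k x) \<otimes>\<^bsub>K\<^esub> r (a x)"
  shows "\<bar>c (word_eval G k w)\<bar> \<le> int (length w) * C \<and>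
    t [^] (q - c (word_eval G k w)) \<otimes> word_eval G k w \<otimes> t [^] (- q) \<in> B m \<and>
    word_eval K f w \<otimes>\<^bsub>K\<^esub> s [^]\<^bsub>K\<^esub> (- q) = s [^]\<^bsub>K\<^esub> (c (word_eval G k w) - q) \<otimes>\<^bsub>K\<^esub>
      r (t [^] (q - c (word_eval G k w)) \<otimes> word_eval G k w \<otimes> t [^] (- q))"
proof -
  interpret K: group K by fact
  have m0: "\<one> \<in> B m" by (rule subgroup.one_closed[OF subgroup_B])
  interpret r: group_hom "G\<lparr>carrier := B m\<rparr>" K r
    using rho rho_closed K by (auto simp: group_hom_def group_hom_axioms_def hom_def
        subgroup.subgroup_is_group[OF subgroup_B is_group])
  have r1: "r \<one> = \<one>\<^bsub>K\<^esub>" using r.hom_one by simp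
  have shift: "cj K (s [^]\<^bsub>K\<^esub> j) (r (a x)) = r (cj G (t [^] j) (a x))"
    if "0 \<le> j" "j \<le> m" "x \<in> X" for j x
    by (rule stable_shift[where r = r and m = m, OF K s rho_closed stable that])
  have aB: "a x \<in> B m" "r (a x) \<in> carrier K" if "0 \<le> m" "x \<in> X" for x
    using B_I[of 0 m x] that rho_closed by auto
  \<comment> \<open>\<open>b g\<close> is the kernel element \<open>t^(- c g) g\<close> conjugated
    by \<open>t^q\<close>. The levels that occur while a word is read from the right stay between
    \<open>- q\<close> and \<open>q\<close>, and this conjugation moves them into the range from
    \<open>0\<close> to \<open>2 * q\<close>, hence below \<open>m\<close>.\<close>
  define b where "b g = t [^] (q - c g) \<otimes> g \<otimes> t [^] (- q)" for g
  have step: "b (k x \<otimes> g) = cj G (t [^] (q - c g)) (a x) \<otimes> b g"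
    "b g \<in> B m \<Longrightarrow> s [^]\<^bsub>K\<^esub> (c (k x \<otimes> g) - q) \<otimes>\<^bsub>K\<^esub> r (b (k x \<otimes> g)) =
      f x \<otimes>\<^bsub>K\<^esub> (s [^]\<^bsub>K\<^esub> (c g - q) \<otimes>\<^bsub>K\<^esub> r (b g))"
    if x: "x \<in> X" and g: "g \<in> carrier G" and e: "0 \<le> q - c g" "q - c g \<le> m" for x g
  proof -
    let ?e = "q - c g"
    let ?A = "cj G (t [^] ?e) (a x)"
    have A: "?A \<in> B m" using B_I[OF e x] .
    have "?A \<otimes> b g = t [^] ?e \<otimes> t [^] (- c (k x)) \<otimes> (k x \<otimes> g \<otimes> t [^] (- q))"
      using g x by (simp add: cj_def a_def b_def group_simps)
    also have "t [^] ?e \<otimes> t [^] (- c (k x)) = t [^] (q - c (k x \<otimes> g))"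
      using g x by (simp flip: int_pow_mult add: algebra_simps)
    finally show Ab: "b (k x \<otimes> g) = ?A \<otimes> b g" unfolding b_def using g x by (simp add: m_assoc)
    assume bB: "b g \<in> B m"
    have rb: "r (b g) \<in> carrier K" "r (a x) \<in> carrier K" using bB rho_closed aB e x by auto
    have ie: "s [^]\<^bsub>K\<^esub> (c g - q) = inv\<^bsub>K\<^esub> (s [^]\<^bsub>K\<^esub> ?e)"
      using K.int_pow_neg[OF s, of ?e] by simp
    have "r (b (k x \<otimes> g)) = cj K (s [^]\<^bsub>K\<^esub> ?e) (r (a x)) \<otimes>\<^bsub>K\<^esub> r (b g)"
      unfolding Ab using shift[OF e x] rho[OF A bB] by simp
    moreover have "s [^]\<^bsub>K\<^esub> (c (k x \<otimes> g) - q) = s [^]\<^bsub>K\<^esub> c (k x) \<otimes>\<^bsub>K\<^esub> s [^]\<^bsub>K\<^esub> (c g - q)"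
      using s g x by (simp flip: K.int_pow_mult add: algebra_simps)
    ultimately show "s [^]\<^bsub>K\<^esub> (c (k x \<otimes> g) - q) \<otimes>\<^bsub>K\<^esub> r (b (k x \<otimes> g)) =
        f x \<otimes>\<^bsub>K\<^esub> (s [^]\<^bsub>K\<^esub> (c g - q) \<otimes>\<^bsub>K\<^esub> r (b g))"
      using rb s unfolding f_def ie by (simp add: cj_def K.group_simps)
  qed
  have "\<bar>c (word_eval G k w)\<bar> \<le> int (length w) * C \<and> b (word_eval G k w) \<in> B m \<and>
    word_eval K f w \<otimes>\<^bsub>K\<^esub> s [^]\<^bsub>K\<^esub> (- q) =
      s [^]\<^bsub>K\<^esub> (c (word_eval G k w) - q) \<otimes>\<^bsub>K\<^esub> r (b (word_eval G k w))"
    using w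
  proof (induction w)
    case Nil
    then have "t [^] q \<otimes> t [^] (- q) = \<one>" by (simp add: int_pow_neg)
    then show ?case using m0 s r1 by (simp add: b_def)
  next
    case (Cons l w)
    obtain x sgn where l: "l = (x, sgn)" by fastforce
    have x: "x \<in> X" and w: "w \<in> words X" using Cons.prems l by auto
    let ?g = "word_eval G k w" and ?h = "word_eval K f w"
    have g: "?g \<in> carrier G" using w k by blast
    have len: "int (length (l # w)) * C = C + int (length w) * C" by (simp add: algebra_simps)
    have C0: "0 \<le> C" using C[OF x] by simp
    then have lq: "int (length w) * C \<le> q" using Cons.prems(2) unfolding len by linarith
    have q0: "0 \<le> q" using lq C0 by (smt (verit) of_nat_0_le_iff mult_nonneg_nonneg)
    have f: "f \<in> X \<rightarrow> carrier K" using aB(2) q0 m s by (auto simp: f_def)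
    then have h: "?h \<in> carrier K" "f x \<in> carrier K" using w x K.word_eval_closed by auto
    have bB: "b ?g \<in> B m" and hb: "?h \<otimes>\<^bsub>K\<^esub> s [^]\<^bsub>K\<^esub> (- q) = s [^]\<^bsub>K\<^esub> (c ?g - q) \<otimes>\<^bsub>K\<^esub> r (b ?g)"
      and cg: "\<bar>c ?g\<bar> \<le> int (length w) * C" using Cons.IH[OF w lq] by blast+
    show ?case
    proof (cases sgn)
      case True
      have e: "0 \<le> q - c ?g" "q - c ?g \<le> m" using cg lq m by auto
      have "b (k x \<otimes> ?g) \<in> B m"
        unfolding step(1)[OF x g e] by (rule subgroup.m_closed[OF subgroup_B B_I[OF e x] bB])
      moreover have "f x \<otimes>\<^bsub>K\<^esub> ?h \<otimes>\<^bsub>K\<^esub> s [^]\<^bsub>K\<^esub> (- q) =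
          s [^]\<^bsub>K\<^esub> (c (k x \<otimes> ?g) - q) \<otimes>\<^bsub>K\<^esub> r (b (k x \<otimes> ?g))"
        unfolding step(2)[OF x g e bB] using h s hb by (simp add: K.m_assoc)
      moreover have "\<bar>c (k x \<otimes> ?g)\<bar> \<le> int (length (l # w)) * C"
        using cg C[OF x] g x unfolding len by simp
      ultimately show ?thesis using l True by simp
    next
      case False
      let ?g' = "inv k x \<otimes> ?g"
      have g': "?g' \<in> carrier G" "k x \<otimes> ?g' = ?g" "c ?g' = c ?g - c (k x)" using g x by auto
      have e: "0 \<le> q - c ?g'" "q - c ?g' \<le> m"
        using cg Cons.prems(2) C[OF x] m unfolding len g' by auto
      note st = step[OF x g'(1) e, unfolded g'(2)]
      let ?A = "cj G (t [^] (q - c ?g')) (a x)"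
      have A: "?A \<in> B m" using B_I[OF e x] .
      have "b ?g' = inv ?A \<otimes> b ?g" unfolding st(1) using g x by (simp add: b_def)
      then have b': "b ?g' \<in> B m"
        using subgroup.m_closed[OF subgroup_B subgroup.m_inv_closed[OF subgroup_B A] bB] by simp
      have fz: "f x \<otimes>\<^bsub>K\<^esub> (s [^]\<^bsub>K\<^esub> (c ?g' - q) \<otimes>\<^bsub>K\<^esub> r (b ?g')) = ?h \<otimes>\<^bsub>K\<^esub> s [^]\<^bsub>K\<^esub> (- q)"
        using st(2)[OF b'] hb by simp
      have "s [^]\<^bsub>K\<^esub> (c ?g' - q) \<otimes>\<^bsub>K\<^esub> r (b ?g') \<in> carrier K" using rho_closed[OF b'] s by simp
      from K.inv_cancel_left(1)[OF h(2) this] have "inv\<^bsub>K\<^esub> f x \<otimes>\<^bsub>K\<^esub> ?h \<otimes>\<^bsub>K\<^esub> s [^]\<^bsub>K\<^esub> (- q) =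
          s [^]\<^bsub>K\<^esub> (c ?g' - q) \<otimes>\<^bsub>K\<^esub> r (b ?g')"
        using h s unfolding fz by (simp add: K.m_assoc)
      moreover have "\<bar>c ?g'\<bar> \<le> int (length (l # w)) * C"
        using cg C[OF x] unfolding g'(3) len by linarith
      ultimately show ?thesis using l False b' by simp
    qed
  qed
  then show ?thesis unfolding b_def .
qed

text \<open>The two sides of a relator are short words with the same value in \<open>G\<close>, and
  \<open>HNN_word_eval\<close> computes their values in \<open>K\<close> from that value alone; so
  they agree in \<open>K\<close> and von Dyck's theorem applies. The bound \<open>m\<close> comes
  before \<open>s\<close> and \<open>r\<close>, since it depends only on word lengths and on the
  character.\<close>

lemma HNN_extension:
  fixes K :: "('k, 'm) monoid_scheme"
  assumes K: "group K"
  shows "\<exists>m\<ge>1. \<forall>s\<in>carrier K. \<forall>r\<in>B m \<rightarrow> carrier K.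
    (\<forall>b\<in>B m. \<forall>b'\<in>B m. r (b \<otimes> b') = r b \<otimes>\<^bsub>K\<^esub> r b') \<and>
    (\<forall>b\<in>B (m - 1). cj K s (r b) = r (cj G t b)) \<longrightarrow>
    (\<exists>h\<in>hom G K. h t = s \<and> (\<forall>b\<in>B m. h b = r b))"
proof -
  interpret K: group K by fact
  obtain wt where wt: "wt \<in> words X" "word_eval G k wt = t"
    using presentation_surj[OF pres t_closed] by blast
  define C where "C = (\<Sum>x\<in>X. \<bar>c (k x)\<bar>)"
  have C: "\<bar>c (k x)\<bar> \<le> C" if "x \<in> X" for x
    unfolding C_def using finite_X that by (intro member_le_sum) auto
  have C0: "0 \<le> C" unfolding C_def by (simp add: sum_nonneg)
  \<comment> \<open>The word \<open>wt\<close> is bounded along with the relators: \<open>t\<close>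
    need not be one of the generators, and \<open>h t = s\<close> is read off from this
    word.\<close>
  define N where "N = length wt + (\<Sum>(l, r)\<in>R. length l + length r)"
  have N: "length wt \<le> N" "length l \<le> N" "length r \<le> N" if "(l, r) \<in> R" for l r
    using member_le_sum[of "(l, r)" R "\<lambda>(l, r). length l + length r"] finite_R that
    unfolding N_def by auto
  have N0: "length wt \<le> N" unfolding N_def by simp
  \<comment> \<open>The product bounds all exponents that occur; the summand \<open>1\<close> makes
    \<open>m\<close> positive.\<close>
  define q where "q = int N * C + 1"
  define m where "m = 2 * q"
  have q: "int n * C \<le> q" if "n \<le> N" for n
    using mult_right_mono[of "int n" "int N" C] that C0 unfolding q_def by simp
  have m1: "1 \<le> m" "0 \<le> m" using C0 unfolding m_def q_def by simp_all
  show ?thesis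
  proof (intro exI[of _ m] conjI ballI impI m1)
    fix s r assume s: "s \<in> carrier K" and rB: "r \<in> B m \<rightarrow> carrier K"
      and *: "(\<forall>b\<in>B m. \<forall>b'\<in>B m. r (b \<otimes> b') = r b \<otimes>\<^bsub>K\<^esub> r b') \<and>
        (\<forall>b\<in>B (m - 1). cj K s (r b) = r (cj G t b))"
    define f where "f x = s [^]\<^bsub>K\<^esub> c (k x) \<otimes>\<^bsub>K\<^esub> r (a x)" for x
    have r_closed: "r b \<in> carrier K" if "b \<in> B m" for b using rB that by auto
    have aB: "a x \<in> B m" if "x \<in> X" for x using B_I[of 0 m x] m1 that by simp
    have f: "f \<in> X \<rightarrow> carrier K" using s r_closed aB by (auto simp: f_def)
    have ev: "word_eval K f w \<otimes>\<^bsub>K\<^esub> s [^]\<^bsub>K\<^esub> (- q) = s [^]\<^bsub>K\<^esub> (c (word_eval G k w) - q) \<otimes>\<^bsub>K\<^esub>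
      r (t [^] (q - c (word_eval G k w)) \<otimes> word_eval G k w \<otimes> t [^] (- q))"
      if "w \<in> words X" "length w \<le> N" for w
      using HNN_word_eval[where r = r and K = K and m = m and s = s and C = C, OF K s r_closed _ _ C _ that(1) q[OF that(2)]] *
      unfolding f_def m_def by blast
    have "word_eval K f l = word_eval K f r'" if "(l, r') \<in> R" "l \<in> words X" "r' \<in> words X" for l r'
    proof -
      have "pres_equiv X R ([] @ l @ []) ([] @ r' @ [])" using that by (intro pres_equiv.rel) auto
      then have "word_eval G k l = word_eval G k r'"
        using pres that by (simp add: presentation_of_def)
      then have "word_eval K f l \<otimes>\<^bsub>K\<^esub> s [^]\<^bsub>K\<^esub> (- q) = word_eval K f r' \<otimes>\<^bsub>K\<^esub> s [^]\<^bsub>K\<^esub> (- q)"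
        using ev that N by metis
      then show ?thesis
        using f s that by (subst (asm) K.right_cancel) (auto intro!: K.word_eval_closed[where X = X])
    qed
    then obtain h where h: "h \<in> hom G K" and hw: "\<And>w. w \<in> words X \<Longrightarrow> h (word_eval G k w) = word_eval K f w"
      using presentation_hom[OF pres K f] by blast
    interpret h: group_hom G K h using h K by (simp add: group_hom_def group_hom_axioms_def)
    have r1: "r \<one> = \<one>\<^bsub>K\<^esub>"
    proof -
      have o: "\<one> \<in> B m" by (rule subgroup.one_closed[OF subgroup_B])
      then have "r \<one> \<otimes>\<^bsub>K\<^esub> r \<one> = r \<one>" using * by (metis l_one one_closed)
      then show ?thesis using r_closed[OF o] K.l_cancel_one' by metis
    qed
    have ht: "h t = s"
    proof -
      have 1: "t [^] (q - 1) \<otimes> t \<otimes> t [^] (- q) = \<one>"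
        using int_pow_mult[OF t_closed, of "q - 1" 1] by (simp add: int_pow_neg)
      have "h t \<otimes>\<^bsub>K\<^esub> s [^]\<^bsub>K\<^esub> (- q) = s [^]\<^bsub>K\<^esub> (1 - q)"
        using ev[OF wt(1) N0] hw[OF wt(1)] wt(2) r1 s 1 by simp
      also have "\<dots> = s \<otimes>\<^bsub>K\<^esub> s [^]\<^bsub>K\<^esub> (- q)"
        using K.int_pow_mult[OF s, of 1 "- q"] s by simp
      finally show ?thesis using s by (subst (asm) K.right_cancel) auto
    qed
    have ha: "h (a x) = r (a x)" if "x \<in> X" for x
    proof -
      have hk: "h (k x) = f x" using hw[of "[(x, True)]"] that f by (simp add: Pi_iff)
      have "h (a x) = s [^]\<^bsub>K\<^esub> (- c (k x)) \<otimes>\<^bsub>K\<^esub> f x"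
        using that hk ht by (simp add: a_def h.hom_int_pow)
      then show ?thesis unfolding f_def using s r_closed[OF aB[OF that]] by (simp add: K.int_pow_neg)
    qed
    have shift: "h b = r b" if b: "b \<in> Bgen m" for b
    proof -
      obtain j x where jx: "0 \<le> j" "j \<le> m" "x \<in> X" "b = cj G (t [^] j) (a x)"
        using b by (auto simp: Bgen_def)
      have "h b = cj K (s [^]\<^bsub>K\<^esub> j) (r (a x))"
        unfolding jx(4) using jx ht ha by (simp add: cj_def h.hom_int_pow)
      then show ?thesis using stable_shift[where r = r and m = m, OF K s r_closed _ jx(1-3)] * jx(4) by simp
    qed
    have hr: "h b = r b" if "b \<in> B m" for b
    proof -
      interpret BG: group "G\<lparr>carrier := B m\<rparr>" by (rule subgroup.subgroup_is_group[OF subgroup_B is_group])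
      have sub: "Bgen m \<subseteq> B m" by (auto simp: B_def generate.incl)
      show ?thesis
      proof (rule BG.hom_eq_on_generate[OF _ _ K, of h r "Bgen m" b])
        show "h \<in> hom (G\<lparr>carrier := B m\<rparr>) K" using B_closed by (auto simp: hom_def)
        show "r \<in> hom (G\<lparr>carrier := B m\<rparr>) K" using * r_closed by (auto simp: hom_def)
        show "b \<in> generate (G\<lparr>carrier := B m\<rparr>) (Bgen m)"
          using that generate_consistent[OF sub subgroup_B] by (simp add: B_def)
      qed (use shift sub in auto)
    qed
    show "\<exists>h\<in>hom G K. h t = s \<and> (\<forall>b\<in>B m. h b = r b)" using h ht hr by blast
  qed
qed

text \<open>The group \<open>G\<close> acts on \<open>G \<times> \<int>\<close>: the base group by left translations, and the stable letter
  by the left translation twisted by permutations of \<open>\<int>\<close> that may be prescribed freely on the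
  cosets \<open>B (m - 1) g\<close>. A suitable choice makes two commutators act without commuting.\<close>

lemma associated_subgroup_full:
  assumes comm: "\<And>x y. x \<in> derived G (carrier G) \<Longrightarrow> y \<in> derived G (carrier G) \<Longrightarrow> x \<otimes> y = y \<otimes> x"
  shows "\<exists>m\<ge>1. B (m - 1) = B m \<or> cj G t ` B (m - 1) = B m"
proof (rule ccontr)
  assume contra: "\<not> ?thesis"
  let ?K = "perm_group :: ('a \<times> int \<Rightarrow> 'a \<times> int) monoid"
  obtain m where m: "m \<ge> 1"
    and ext: "\<forall>s\<in>carrier ?K. \<forall>r\<in>B m \<rightarrow> carrier ?K.
    (\<forall>b\<in>B m. \<forall>b'\<in>B m. r (b \<otimes> b') = r b \<otimes>\<^bsub>?K\<^esub> r b') \<and>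
    (\<forall>b\<in>B (m - 1). cj ?K s (r b) = r (cj G t b)) \<longrightarrow>
    (\<exists>h\<in>hom G ?K. h t = s \<and> (\<forall>b\<in>B m. h b = r b))"
    by (rule exE[OF HNN_extension[where K = ?K, OF group_perm_group]], erule conjE, erule (1) that)
  define S where "S = B (m - 1)"
  have SB: "S \<subseteq> B m" unfolding S_def by (rule B_mono) simp
  have TB: "cj G t ` S \<subseteq> B m" unfolding S_def using cj_t_B by blast
  have S_grp: "subgroup S G" unfolding S_def by (rule subgroup_B)
  have S_closed: "x \<in> carrier G" if "x \<in> S" for x by (rule subgroup.mem_carrier[OF S_grp that])
  have S_c: "c x = 0" if "x \<in> S" for x using that unfolding S_def by (rule c_B)
  \<comment> \<open>\<open>u\<close> and \<open>d\<close> witness that neither associated subgroup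
    is all of \<open>B m\<close>. The commutator of \<open>t\<close> with \<open>u\<close> and that
    of \<open>inv t\<close> with \<open>d\<close> will be the two elements of the derived group
    whose actions do not commute.\<close>
  obtain u where u: "u \<in> B m" "u \<notin> S" using contra m SB unfolding S_def by blast
  obtain d where d: "d \<in> B m" "d \<notin> cj G t ` S" using contra m TB unfolding S_def by blast
  have ud [simp]: "u \<in> carrier G" "d \<in> carrier G" "c u = 0" "c d = 0"
    using u d B_closed c_B by blast+
  \<comment> \<open>\<open>e\<close> is the inverse of the position at which \<sigma> is to act for
    the first commutator. It has value \<open>1\<close> under \<open>c\<close>, while
    \<open>d\<close> has value \<open>0\<close>, so the two marked cosets cannot interfere.\<close>
  define e where "e = inv (u \<otimes> inv t \<otimes> inv u)"
  have e [simp]: "e \<in> carrier G" "c e = 1" by (simp_all add: e_def)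
  define p where "p = (\<lambda>i::int. i + 1)"
  define r where "r = transpose 0 (1::int)"
  have bij: "bij p" "bij r"
    unfolding p_def r_def by (auto intro!: bij_betwI[of _ _ _ "\<lambda>i. i - 1"])
  \<comment> \<open>\<sigma> is non-trivial only on the right cosets of \<open>S\<close> through
    \<open>inv d\<close> and \<open>inv e\<close>. Being constant on right cosets of
    \<open>S\<close> is what makes the twisted translation by \<open>t\<close> compatible with the
    action of \<open>S\<close>.\<close>
  define \<sigma> where "\<sigma> g = (if g \<otimes> d \<in> S then p else if g \<otimes> e \<in> S then r else id)" for g
  have \<sigma>_bij: "bij (\<sigma> g)" for g using bij by (simp add: \<sigma>_def)
  have \<sigma>_S: "\<sigma> (s \<otimes> g) = \<sigma> g" if "s \<in> S" "g \<in> carrier G" for s g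
  proof -
    have "s \<otimes> g \<otimes> x \<in> S \<longleftrightarrow> g \<otimes> x \<in> S" if x: "x \<in> carrier G" for x
    proof -
      have s: "s \<in> carrier G" "inv s \<in> S" using \<open>s \<in> S\<close> S_closed subgroup.m_inv_closed[OF S_grp] by auto
      have "g \<otimes> x = inv s \<otimes> (s \<otimes> g \<otimes> x)" using s x \<open>g \<in> carrier G\<close> by (simp add: group_simps)
      moreover have "s \<otimes> g \<otimes> x = s \<otimes> (g \<otimes> x)" using s x \<open>g \<in> carrier G\<close> by (simp add: group_simps)
      ultimately show ?thesis using subgroup.m_closed[OF S_grp] \<open>s \<in> S\<close> s by metis
    qed
    then show ?thesis unfolding \<sigma>_def by simp
  qed
  have level0: "\<sigma> g \<in> {id, p}" if "g \<in> carrier G" "c g = 0" for g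
    using that S_c[of "g \<otimes> e"] unfolding \<sigma>_def by auto
  have level1: "\<sigma> g \<in> {id, r}" if "g \<in> carrier G" "c g = -1" for g
    using that S_c[of "g \<otimes> d"] unfolding \<sigma>_def by auto
  define \<rho> where "\<rho> b = (\<lambda>(g, i::int). if g \<in> carrier G then (b \<otimes> g, i) else (g, i))" for b
  define \<tau> where "\<tau> = (\<lambda>(g, i). if g \<in> carrier G then (t \<otimes> g, \<sigma> g i) else (g, i))"
  define \<tau>' where "\<tau>' = (\<lambda>(g, i). if g \<in> carrier G
    then (inv t \<otimes> g, inv_into UNIV (\<sigma> (inv t \<otimes> g)) i) else (g, i))"
  have \<sigma>_inv [simp]: "\<sigma> g (inv_into UNIV (\<sigma> g) i) = i" "inv_into UNIV (\<sigma> g) (\<sigma> g i) = i" for g i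
    using \<sigma>_bij[of g] by (simp_all add: bij_is_surj surj_f_inv_f bij_is_inj)
  have \<tau>\<tau>: "\<tau> \<circ> \<tau>' = id" "\<tau>' \<circ> \<tau> = id"
    by (auto simp: \<tau>_def \<tau>'_def fun_eq_iff)
  then have \<tau>_bij: "bij \<tau>" by (simp add: o_bij)
  have inv_\<tau>: "inv_into UNIV \<tau> = \<tau>'" using \<tau>\<tau> by (simp add: inv_unique_comp)
  have \<rho>_mult: "\<rho> (b \<otimes> b') = \<rho> b \<circ> \<rho> b'" if "b \<in> carrier G" "b' \<in> carrier G" for b b'
    using that by (auto simp: \<rho>_def fun_eq_iff m_assoc)
  have \<rho>_one: "\<rho> \<one> = id" by (auto simp: \<rho>_def)
  have \<rho>_inv: "\<rho> (inv b) \<circ> \<rho> b = id" "\<rho> b \<circ> \<rho> (inv b) = id" if "b \<in> carrier G" for b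
    using that \<rho>_mult[of b "inv b"] \<rho>_mult[of "inv b" b] \<rho>_one by simp_all
  have \<rho>_bij: "bij (\<rho> b)" if "b \<in> carrier G" for b
    using \<rho>_inv[OF that] by (simp add: o_bij)
  have inv_\<rho>: "inv_into UNIV (\<rho> b) = \<rho> (inv b)" if "b \<in> carrier G" for b
    using \<rho>_inv[OF that] by (simp add: inv_unique_comp)
  have \<tau>_\<rho>: "\<tau> \<circ> \<rho> b = \<rho> (cj G t b) \<circ> \<tau>" if "b \<in> S" for b
    using S_closed[OF that] \<sigma>_S[OF that] by (auto simp: \<tau>_def \<rho>_def fun_eq_iff cj_def group_simps)
  have stable: "cj ?K \<tau> (\<rho> b) = \<rho> (cj G t b)" if "b \<in> S" for b
  proof -
    have "cj ?K \<tau> (\<rho> b) = \<tau> \<circ> \<rho> b \<circ> \<tau>'" using \<tau>_bij by (simp add: cj_def inv_\<tau>)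
    also have "\<dots> = \<rho> (cj G t b) \<circ> (\<tau> \<circ> \<tau>')" unfolding \<tau>_\<rho>[OF that] by (simp add: comp_assoc)
    finally show ?thesis unfolding \<tau>\<tau> by simp
  qed
  have \<rho>K: "\<rho> \<in> B m \<rightarrow> carrier ?K" using \<rho>_bij B_closed by auto
  have \<tau>K: "\<tau> \<in> carrier ?K" using \<tau>_bij by simp
  have "(\<forall>b\<in>B m. \<forall>b'\<in>B m. \<rho> (b \<otimes> b') = \<rho> b \<otimes>\<^bsub>?K\<^esub> \<rho> b') \<and>
    (\<forall>b\<in>B (m - 1). cj ?K \<tau> (\<rho> b) = \<rho> (cj G t b))"
    using \<rho>_mult B_closed stable unfolding S_def by simp
  then obtain h where h: "h \<in> hom G ?K" and ht: "h t = \<tau>" and hb: "\<And>b. b \<in> B m \<Longrightarrow> h b = \<rho> b"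
    using ext[THEN bspec, OF \<tau>K, THEN bspec, OF \<rho>K, THEN mp] by auto
  interpret h: group_hom G ?K h using h by (simp add: group_hom_def group_hom_axioms_def)
  define y where "y = t \<otimes> u \<otimes> inv t \<otimes> inv u"
  define z where "z = inv t \<otimes> d \<otimes> t \<otimes> inv d"
  have yz [simp]: "y \<in> carrier G" "z \<in> carrier G" "c y = 0" "c z = 0" by (simp_all add: y_def z_def)
  have "y \<otimes> z = z \<otimes> y"
    using comm commutator_in_derived[of t u] commutator_in_derived[of "inv t" d]
    unfolding y_def z_def by simp
  then have hyz: "h y \<circ> h z = h z \<circ> h y" using h.hom_mult[of y z] h.hom_mult[of z y] by simp
  have app: "\<rho> b (g, i) = (b \<otimes> g, i)" "\<tau> (g, i) = (t \<otimes> g, \<sigma> g i)"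
    "\<tau>' (g, i) = (inv t \<otimes> g, inv_into UNIV (\<sigma> (inv t \<otimes> g)) i)"
    if "g \<in> carrier G" for b g i
    using that by (simp_all add: \<rho>_def \<tau>_def \<tau>'_def)
  have "h y = \<tau> \<circ> \<rho> u \<circ> \<tau>' \<circ> \<rho> (inv u)" "h z = \<tau>' \<circ> \<rho> d \<circ> \<tau> \<circ> \<rho> (inv d)"
    using u d hb[OF u(1)] hb[OF d(1)] ht \<tau>_bij \<rho>_bij[of u] \<rho>_bij[of d]
    by (simp_all add: y_def z_def inv_\<tau> inv_\<rho>)
  then have hy: "h y (g, i) = (y \<otimes> g, \<sigma> (u \<otimes> inv t \<otimes> inv u \<otimes> g)
      (inv_into UNIV (\<sigma> (inv t \<otimes> inv u \<otimes> g)) i))"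
    and hz: "h z (g, i) = (z \<otimes> g, inv_into UNIV (\<sigma> (z \<otimes> g)) (\<sigma> (inv d \<otimes> g) i))"
    if "g \<in> carrier G" for g i
    using that by (simp_all add: app y_def z_def m_assoc)
  have inv_r: "inv_into UNIV r = r" unfolding r_def by (simp add: inv_unique_comp)
  have inv_p: "inv_into UNIV p = (\<lambda>i. i - 1)"
    by (rule inv_unique_comp) (auto simp: p_def)
  have one_S: "\<one> \<in> S" by (rule subgroup.one_closed[OF S_grp])
  have z1: "h z (\<one>, i) = (z, p i)" for i
  proof -
    \<comment> \<open>This uses that \<open>d\<close> is not in the conjugate of \<open>S\<close> by
      \<open>t\<close>: otherwise \<sigma> would act a second time at \<open>z\<close>, by the
      inverse shift, and nothing would remain.\<close>
    have "z \<otimes> d \<notin> S"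
    proof
      assume *: "z \<otimes> d \<in> S"
      have "d = cj G t (z \<otimes> d)" by (simp add: z_def cj_def group_simps)
      then show False using d(2) * by blast
    qed
    moreover have "\<sigma> z \<in> {id, p}" by (rule level0) simp_all
    moreover have "\<sigma> z \<noteq> p" if "z \<otimes> d \<notin> S"
      using that S_c[of "z \<otimes> e"] by (auto simp: \<sigma>_def p_def fun_eq_iff)
    moreover have "\<sigma> (inv d) = p" using one_S by (simp add: \<sigma>_def)
    ultimately show ?thesis using hz[of \<one> i] by auto
  qed
  have y1: "h y (\<one>, i) = (y, r i)" for i
  proof -
    have "\<sigma> (u \<otimes> inv t \<otimes> inv u) = r"
      using one_S S_c[of "u \<otimes> inv t \<otimes> inv u \<otimes> d"]
      by (auto simp: \<sigma>_def e_def)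
    \<comment> \<open>The choice of \<open>e\<close> turns this product into \<open>inv u\<close>,
      which is outside \<open>S\<close>; so only one of the two occurrences of \<sigma> in
      \<open>y\<close> acts at the base point.\<close>
    moreover have "inv t \<otimes> inv u \<otimes> e \<notin> S"
    proof
      assume "inv t \<otimes> inv u \<otimes> e \<in> S"
      moreover have "inv t \<otimes> inv u \<otimes> e = inv u" by (simp add: e_def group_simps)
      ultimately show False using u(2) subgroup.m_inv_closed[OF S_grp, of "inv u"] by simp
    qed
    then have "\<sigma> (inv t \<otimes> inv u) = id"
      using S_c[of "inv t \<otimes> inv u \<otimes> d"] by (auto simp: \<sigma>_def)
    ultimately show ?thesis using hy[of \<one> i] by simp
  qed
  \<comment> \<open>After the first factor the base point has moved to \<open>z\<close> or
    \<open>y\<close>, where \<sigma> is not known exactly. The values under \<open>c\<close> alone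
    confine \<open>f\<close> and \<open>f'\<close> to a few permutations, and this is
    enough.\<close>
  define f where "f = \<sigma> (u \<otimes> inv t \<otimes> inv u \<otimes> z) \<circ> inv_into UNIV (\<sigma> (inv t \<otimes> inv u \<otimes> z))"
  define f' where "f' = inv_into UNIV (\<sigma> (z \<otimes> y)) \<circ> \<sigma> (inv d \<otimes> y)"
  have f: "f \<in> {id, r}"
  proof -
    have "\<sigma> (u \<otimes> inv t \<otimes> inv u \<otimes> z) \<in> {id, r}" "\<sigma> (inv t \<otimes> inv u \<otimes> z) \<in> {id, r}"
      by (intro level1; simp)+
    then show ?thesis unfolding f_def using inv_r by (auto simp: r_def)
  qed
  have f': "f' \<in> {id, p, \<lambda>i. i - 1}"
  proof -
    have "\<sigma> (z \<otimes> y) \<in> {id, p}" "\<sigma> (inv d \<otimes> y) \<in> {id, p}"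
      by (intro level0; simp)+
    then show ?thesis unfolding f'_def using inv_p by (auto simp: p_def)
  qed
  have eq: "f (p i) = f' (r i)" for i
  proof -
    have "h y (h z (\<one>, i)) = h z (h y (\<one>, i))" using hyz by (metis comp_apply)
    then show ?thesis unfolding z1 y1 by (simp add: hy hz f_def f'_def)
  qed
  \<comment> \<open>At \<open>10\<close>, away from the transposition, the identity reads
    \<open>11 = f' 10\<close>, so \<open>f'\<close> is the shift \<open>p\<close>. At
    \<open>0\<close> it then reads \<open>f 1 = 2\<close>, although \<open>f\<close> preserves the
    set \<open>{0, 1}\<close>.\<close>
  show False
    using eq[of 10] eq[of 0] f f' by (auto simp: p_def r_def transpose_def split: if_splits)
qed

text \<open>The elements that some power of \<open>u\<close> conjugates into
  \<open>generate G F\<close> form a subgroup, because \<open>stable\<close> makes the condition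
  persist for larger powers. It is normalized by \<open>t\<close> and contains all
  \<open>a x\<close>, so by induction on words it contains \<open>t^(- c g) g\<close> for every
  \<open>g\<close>.\<close>

lemma kernel_absorbed:
  assumes u: "u \<in> {t, inv t}" and F: "F \<subseteq> carrier G"
    and stable: "\<And>b. b \<in> generate G F \<Longrightarrow> cj G u b \<in> generate G F"
    and aF: "a ` X \<subseteq> generate G F" and g: "g \<in> carrier G" "c g = 0"
  shows "\<exists>j::nat. cj G (u [^] j) g \<in> generate G F"
proof -
  have uc [simp]: "u \<in> carrier G" using u by auto
  define N where "N = {n \<in> carrier G. \<exists>j::nat. cj G (u [^] j) n \<in> generate G F}"
  have sub: "subgroup (generate G F) G" by (rule generate_is_subgroup[OF F])
  have up: "cj G (u [^] (i + j)) n \<in> generate G F"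
    if n: "n \<in> carrier G" and j: "cj G (u [^] j) n \<in> generate G F" for i j :: nat and n
  proof (induction i)
    case 0
    show ?case using j by simp
  next
    case (Suc i)
    have "cj G (u [^] (Suc i + j)) n = cj G u (cj G (u [^] (i + j)) n)"
      using n nat_pow_mult[OF uc, of 1 "i + j"] by (simp add: cj_cj)
    then show ?case using stable[OF Suc] by simp
  qed
  have N_mult: "n \<otimes> n' \<in> N" if N: "n \<in> N" "n' \<in> N" for n n'
  proof -
    obtain i j :: nat where ij: "cj G (u [^] i) n \<in> generate G F" "cj G (u [^] j) n' \<in> generate G F"
      and c: "n \<in> carrier G" "n' \<in> carrier G" using N unfolding N_def by auto
    have "cj G (u [^] (i + j)) (n \<otimes> n') = cj G (u [^] (i + j)) n \<otimes> cj G (u [^] (i + j)) n'"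
      using c by (simp add: cj_mult)
    also have "\<dots> \<in> generate G F"
      using up[OF c(1) ij(1), of j] up[OF c(2) ij(2), of i]
      by (intro generate.eng) (simp_all add: add.commute)
    finally show ?thesis using c unfolding N_def by blast
  qed
  have N_inv: "inv n \<in> N" if N: "n \<in> N" for n
  proof -
    obtain j :: nat where j: "cj G (u [^] j) n \<in> generate G F" and n: "n \<in> carrier G"
      using N unfolding N_def by auto
    have "cj G (u [^] j) (inv n) \<in> generate G F"
      using subgroup.m_inv_closed[OF sub j] n by (simp add: cj_inv)
    then show ?thesis using n unfolding N_def by blast
  qed
  have N_u: "cj G u n \<in> N" "cj G (inv u) n \<in> N" if N: "n \<in> N" for n
  proof -
    obtain j :: nat where j: "cj G (u [^] j) n \<in> generate G F" and n: "n \<in> carrier G"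
      using N unfolding N_def by auto
    have "cj G (u [^] j) (cj G u n) \<in> generate G F"
      using up[OF n j, of 1] n nat_pow_mult[OF uc, of j 1] by (simp add: cj_cj)
    then show "cj G u n \<in> N" using n unfolding N_def by auto
    have "cj G (u [^] Suc j) (cj G (inv u) n) = cj G (u [^] j) n"
      using n by (simp add: cj_cj m_assoc)
    then have "cj G (u [^] Suc j) (cj G (inv u) n) \<in> generate G F" using j by simp
    moreover have "cj G (inv u) n \<in> carrier G" using n by simp
    ultimately show "cj G (inv u) n \<in> N" unfolding N_def mem_Collect_eq by (intro conjI exI)
  qed
  have N_t: "cj G t n \<in> N" "cj G (inv t) n \<in> N" if "n \<in> N" for n
    using u N_u[OF that] by auto
  have N_closed: "n \<in> carrier G" if "n \<in> N" for n using that by (simp add: N_def)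
  have N_t_int: "cj G (t [^] (i::int)) n \<in> N" if "n \<in> N" for n i
    by (rule cj_int_pow_closed[OF t_closed _ N_t that]) (use N_closed in auto)
  have aN: "a x \<in> N" if "x \<in> X" for x
  proof -
    have "cj G (u [^] (0::nat)) (a x) \<in> generate G F" using aF that by auto
    then show ?thesis unfolding N_def mem_Collect_eq using a_closed[OF that] by (intro conjI exI)
  qed
  have word: "t [^] (- c (word_eval G k w)) \<otimes> word_eval G k w \<in> N" if "w \<in> words X" for w
    using that
  proof (induction w)
    case Nil
    have "\<one> \<in> N" unfolding N_def by (auto intro!: exI[of _ 0] generate.one)
    then show ?case by simp
  next
    case (Cons l w)
    obtain x b where l: "l = (x, b)" by fastforce
    have x: "x \<in> X" and w: "w \<in> words X" using Cons.prems l by auto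
    let ?g = "word_eval G k w"
    have g: "?g \<in> carrier G" using w k by blast
    have IH: "t [^] (- c ?g) \<otimes> ?g \<in> N" using Cons.IH[OF w] .
    \<comment> \<open>The map sending \<open>h\<close> to \<open>t^(- c h) h\<close> is a crossed
      homomorphism; a new letter contributes one conjugate of \<open>a x\<close> by a power of
      \<open>t\<close>.\<close>
    have shift: "t [^] (- c (k x \<otimes> h)) \<otimes> (k x \<otimes> h) = cj G (t [^] (- c h)) (a x) \<otimes> (t [^] (- c h) \<otimes> h)"
      if h: "h \<in> carrier G" for h
    proof -
      have "- c (k x) - c h = - c h + - c (k x)" by simp
      then have "t [^] (- c (k x) - c h) = t [^] (- c h) \<otimes> t [^] (- c (k x))"
        by (simp only: int_pow_mult[OF t_closed])
      then show ?thesis using h x by (simp add: cj_def a_def group_simps)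
    qed
    show ?case
    proof (cases b)
      case True
      then show ?thesis using l shift[OF g] N_mult[OF N_t_int[OF aN[OF x]] IH] by simp
    next
      case False
      let ?h = "inv k x \<otimes> ?g"
      let ?A = "cj G (t [^] (- c ?h)) (a x)"
      have h: "?h \<in> carrier G" "k x \<otimes> ?h = ?g" using g x by auto
      have "t [^] (- c ?g) \<otimes> ?g = ?A \<otimes> (t [^] (- c ?h) \<otimes> ?h)" using shift[OF h(1)] unfolding h(2) .
      moreover have "inv ?A \<otimes> (?A \<otimes> (t [^] (- c ?h) \<otimes> ?h)) = t [^] (- c ?h) \<otimes> ?h"
        using h x by (intro inv_cancel_left) auto
      ultimately have "t [^] (- c ?h) \<otimes> ?h = inv ?A \<otimes> (t [^] (- c ?g) \<otimes> ?g)" by simp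
      then show ?thesis using l False N_mult[OF N_inv[OF N_t_int[OF aN[OF x]]] IH] by simp
    qed
  qed
  obtain w where "w \<in> words X" "word_eval G k w = g"
    using presentation_surj[OF pres g(1)] by blast
  then have "g \<in> N" using word[of w] g by simp
  then show ?thesis unfolding N_def by blast
qed

text \<open>If \<open>B (m - 1) = B m\<close>, conjugation by \<open>t\<close> maps
  \<open>B m\<close> into itself. If the conjugate of \<open>B (m - 1)\<close> is
  \<open>B m\<close>, it contains \<open>B (m - 1)\<close>, and conjugation by \<open>inv t\<close>
  maps \<open>B (m - 1)\<close> into itself. In both cases the kernel is the ascending union of the
  conjugates of the base by the powers of \<open>inv u\<close>.\<close>

theorem bieri_strebel:
  assumes comm: "\<And>x y. x \<in> derived G (carrier G) \<Longrightarrow> y \<in> derived G (carrier G) \<Longrightarrow> x \<otimes> y = y \<otimes> x"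
  shows "\<exists>u\<in>{t, inv t}. \<exists>F. finite F \<and> F \<subseteq> {g \<in> carrier G. c g = 0} \<and>
    (\<forall>b\<in>generate G F. cj G u b \<in> generate G F) \<and>
    (\<forall>g\<in>carrier G. c g = 0 \<longrightarrow> (\<exists>j::nat. cj G (u [^] j) g \<in> generate G F))"
proof -
  obtain m where m: "m \<ge> 1" and cases: "B (m - 1) = B m \<or> cj G t ` B (m - 1) = B m"
    using associated_subgroup_full[OF comm] by blast
  have Bgen_ker: "Bgen n \<subseteq> {g \<in> carrier G. c g = 0}" for n
    by (auto simp: Bgen_def)
  have a_B: "a ` X \<subseteq> B n" if "n \<ge> 0" for n
    using B_I[of 0 n] that by auto
  show ?thesis using cases
  proof
    assume eq: "B (m - 1) = B m"
    have "\<forall>b\<in>B m. cj G t b \<in> B m" using cj_t_B[of _ m] eq by blast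
    then show ?thesis
      using kernel_absorbed[of t "Bgen m"] Bgen_closed Bgen_ker[of m] finite_Bgen[of m] a_B[of m] m
      unfolding B_def by (intro bexI[of _ t] exI[of _ "Bgen m"]) auto
  next
    assume eq: "cj G t ` B (m - 1) = B m"
    have "\<forall>b\<in>B (m - 1). cj G (inv t) b \<in> B (m - 1)"
    proof
      fix b assume "b \<in> B (m - 1)"
      then have "b \<in> cj G t ` B (m - 1)" using B_mono[of "m - 1" m] eq by auto
      then obtain b' where b': "b' \<in> B (m - 1)" "b = cj G t b'" by blast
      then show "cj G (inv t) b \<in> B (m - 1)" using B_closed[OF b'(1)] by simp
    qed
    then show ?thesis
      using kernel_absorbed[of "inv t" "Bgen (m - 1)"] Bgen_closed Bgen_ker[of "m - 1"]
        finite_Bgen[of "m - 1"] a_B[of "m - 1"] m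
      unfolding B_def by (intro bexI[of _ "inv t"] exI[of _ "Bgen (m - 1)"]) auto
  qed
qed

text \<open>Conjugation by \<open>u\<close> maps \<open>?B\<close> into itself, so conjugation by
  \<open>inv u\<close> maps its image \<open>?B'\<close> under \<alpha> into itself. Since
  \<open>F\<close> is finite, one exponent \<open>j\<close> gives that \<open>?B\<close> lies in the
  conjugate of \<open>?B'\<close> by \<open>u^j\<close>. A kernel element is moved into
  \<open>?B\<close> by some \<open>u^i\<close>; moving it back by \<open>inv u^i\<close> does not
  leave that conjugate, which is therefore the whole kernel.\<close>

theorem kernel_finitely_generated:
  assumes comm: "\<And>x y. x \<in> derived G (carrier G) \<Longrightarrow> y \<in> derived G (carrier G) \<Longrightarrow> x \<otimes> y = y \<otimes> x"
    and \<alpha>: "\<alpha> \<in> hom G G" "\<And>g. g \<in> carrier G \<Longrightarrow> \<alpha> (\<alpha> g) = g" "\<alpha> t = inv t"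
    and c_\<alpha>: "\<And>g. g \<in> carrier G \<Longrightarrow> c (\<alpha> g) = - c g"
  shows "\<exists>F. finite F \<and> F \<subseteq> carrier G \<and> generate G F = {g \<in> carrier G. c g = 0}"
proof -
  interpret \<alpha>: group_hom G G \<alpha> using \<alpha> by (simp add: group_hom_def group_hom_axioms_def)
  obtain u F where u: "u \<in> {t, inv t}" and F: "finite F" "F \<subseteq> {g \<in> carrier G. c g = 0}"
    and stable: "\<And>b. b \<in> generate G F \<Longrightarrow> cj G u b \<in> generate G F"
    and absorb: "\<And>g. g \<in> carrier G \<Longrightarrow> c g = 0 \<Longrightarrow> \<exists>j::nat. cj G (u [^] j) g \<in> generate G F"
    using bieri_strebel[OF comm] by blast
  have uc [simp]: "u \<in> carrier G" and \<alpha>_u: "\<alpha> u = inv u" using u \<alpha>(3) by auto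
  have Fc: "F \<subseteq> carrier G" using F by blast
  have \<alpha>_cj: "\<alpha> (cj G g h) = cj G (\<alpha> g) (\<alpha> h)" if "g \<in> carrier G" "h \<in> carrier G" for g h
    using that by (simp add: cj_def)
  let ?B = "generate G F" and ?B' = "generate G (\<alpha> ` F)"
  have B': "?B' = \<alpha> ` ?B" using \<alpha>.generate_img[OF Fc] by simp
  have Bc: "b \<in> carrier G" if "b \<in> ?B" for b using generate_in_carrier[OF Fc that] .
  have B'c: "b \<in> carrier G" if "b \<in> ?B'" for b using that Bc unfolding B' by auto
  have stable': "cj G (inv u) b \<in> ?B'" if "b \<in> ?B'" for b
  proof -
    obtain b' where b': "b' \<in> ?B" "b = \<alpha> b'" using \<open>b \<in> ?B'\<close> unfolding B' by blast
    then have "cj G (inv u) b = \<alpha> (cj G u b')" using Bc by (simp add: \<alpha>_cj \<alpha>_u)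
    then show ?thesis using stable[OF b'(1)] unfolding B' by blast
  qed
  have stable'': "cj G (inv u [^] j) b \<in> ?B'" if "b \<in> ?B'" for b and j :: nat
  proof (induction j)
    case (Suc j)
    have "cj G (inv u [^] Suc j) b = cj G (inv u) (cj G (inv u [^] j) b)"
      using B'c[OF \<open>b \<in> ?B'\<close>] nat_pow_Suc2[of "inv u" j] by (simp add: cj_cj)
    then show ?case using stable'[OF Suc] by simp
  qed (use that B'c in simp)
  have "\<exists>j::nat. cj G (inv u [^] j) f \<in> ?B'" if f: "f \<in> F" for f
  proof -
    have fc: "f \<in> carrier G" "c f = 0" using f F by auto
    then obtain j :: nat where j: "cj G (u [^] j) (\<alpha> f) \<in> ?B"
      using absorb[of "\<alpha> f"] c_\<alpha> by auto
    have "\<alpha> (u [^] j) = inv u [^] j" using \<alpha>.hom_nat_pow[of u j] \<alpha>_u by simp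
    then have "\<alpha> (cj G (u [^] j) (\<alpha> f)) = cj G (inv u [^] j) f"
      using fc \<alpha>(2) by (simp add: \<alpha>_cj)
    then show ?thesis using j unfolding B' by (metis imageI)
  qed
  then obtain J :: "'a \<Rightarrow> nat" where J: "\<And>f. f \<in> F \<Longrightarrow> cj G (inv u [^] J f) f \<in> ?B'"
    by metis
  define j where "j = (\<Sum>f\<in>F. J f)"
  have inB': "cj G (inv u [^] j) f \<in> ?B'" if f: "f \<in> F" for f
  proof -
    have "J f \<le> j" unfolding j_def using F(1) f by (intro member_le_sum) auto
    then have "inv u [^] j = inv u [^] (j - J f) \<otimes> inv u [^] J f"
      by (simp add: nat_pow_mult)
    then have "cj G (inv u [^] j) f = cj G (inv u [^] (j - J f)) (cj G (inv u [^] J f) f)"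
      using f Fc by (subst cj_cj) auto
    then show ?thesis using stable''[OF J[OF f]] by simp
  qed
  let ?F = "cj G (u [^] j) ` \<alpha> ` F"
  have \<alpha>Fc: "\<alpha> ` F \<subseteq> carrier G" using Fc by auto
  have gen: "generate G ?F = cj G (u [^] j) ` ?B'"
    using generate_cj_image[OF _ \<alpha>Fc] by simp
  have u_inv_pow: "u [^] i \<otimes> inv u [^] i = \<one>" "inv u [^] i \<otimes> u [^] i = \<one>" for i :: nat
    by (simp_all add: nat_pow_inv)
  have "?B \<subseteq> generate G ?F"
  proof (rule generate_absorb)
    show "?F \<subseteq> carrier G" using \<alpha>Fc by auto
    show "F \<subseteq> generate G ?F"
    proof
      fix f assume f: "f \<in> F"
      then have "f = cj G (u [^] j) (cj G (inv u [^] j) f)"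
        using Fc by (subst cj_cj) (auto simp: u_inv_pow)
      then show "f \<in> generate G ?F" unfolding gen using inB'[OF f] by blast
    qed
  qed
  then have BB: "b \<in> cj G (u [^] j) ` ?B'" if "b \<in> ?B" for b using that gen by blast
  have "g \<in> generate G ?F" if g: "g \<in> carrier G" "c g = 0" for g
  proof -
    obtain i :: nat where i: "cj G (u [^] i) g \<in> ?B" using absorb[OF g] by blast
    then obtain b where b: "b \<in> ?B'" "cj G (u [^] i) g = cj G (u [^] j) b" using BB by blast
    have "g = cj G (inv u [^] i) (cj G (u [^] i) g)"
      using g by (subst cj_cj) (auto simp: u_inv_pow)
    also have "\<dots> = cj G (inv u [^] i \<otimes> u [^] j) b" unfolding b(2) using B'c[OF b(1)] by (simp add: cj_cj)
    also have "inv u [^] i \<otimes> u [^] j = u [^] j \<otimes> inv u [^] i"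
    proof -
      have "u [^] (- int i) \<otimes> u [^] int j = u [^] int j \<otimes> u [^] (- int i)"
        by (simp flip: int_pow_mult add: add.commute)
      then show ?thesis by (simp add: int_pow_neg_int int_pow_int nat_pow_inv)
    qed
    also have "cj G (u [^] j \<otimes> inv u [^] i) b = cj G (u [^] j) (cj G (inv u [^] i) b)"
      using B'c[OF b(1)] by (simp add: cj_cj)
    finally show ?thesis unfolding gen using stable''[OF b(1)] by blast
  qed
  moreover have "c g = 0" if "g \<in> generate G ?F" for g
    using \<alpha>Fc F c_\<alpha> by (intro c_generate[OF _ _ that]) auto
  moreover have "g \<in> carrier G" if "g \<in> generate G ?F" for g
    by (rule generate_in_carrier[OF _ that]) (use \<alpha>Fc in auto)
  moreover have "finite ?F" "?F \<subseteq> carrier G" using F(1) \<alpha>Fc by auto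
  ultimately show ?thesis by (intro exI[of _ ?F]) auto
qed

end

section \<open>Polycyclic groups\<close>

context group
begin

lemma generate_insert_normalizing:
  assumes K: "subgroup K G" and g: "g \<in> carrier G"
    and closed: "\<And>b. b \<in> K \<Longrightarrow> cj G g b \<in> K" "\<And>b. b \<in> K \<Longrightarrow> cj G (inv g) b \<in> K"
    and h: "h \<in> generate G (insert g K)"
  shows "\<exists>b\<in>K. \<exists>n::int. h = b \<otimes> g [^] n"
  using h
proof induction
  case one
  show ?case using subgroup.one_closed[OF K] by (intro bexI[of _ \<one>] exI[of _ 0]) auto
next
  case (incl h)
  then consider "h = g" | "h \<in> K" by blast
  then show ?case
  proof cases
    case 1
    then show ?thesis using subgroup.one_closed[OF K] g by (intro bexI[of _ \<one>] exI[of _ 1]) auto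
  next
    case 2
    then show ?thesis using subgroup.mem_carrier[OF K] by (intro bexI[of _ h] exI[of _ 0]) auto
  qed
next
  case (inv h)
  then consider "h = g" | "h \<in> K" by blast
  then show ?case
  proof cases
    case 1
    then show ?thesis using subgroup.one_closed[OF K] g
      by (intro bexI[of _ \<one>] exI[of _ "-1"]) (auto simp: int_pow_neg)
  next
    case 2
    then show ?thesis using subgroup.mem_carrier[OF K] subgroup.m_inv_closed[OF K]
      by (intro bexI[of _ "inv h"] exI[of _ 0]) auto
  qed
next
  case (eng h1 h2)
  then obtain b1 b2 n1 n2 where b: "b1 \<in> K" "b2 \<in> K"
    and h: "h1 = b1 \<otimes> g [^] (n1::int)" "h2 = b2 \<otimes> g [^] (n2::int)" by blast
  have bc: "b1 \<in> carrier G" "b2 \<in> carrier G" using b subgroup.mem_carrier[OF K] by auto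
  have c: "cj G (g [^] n1) b2 \<in> K"
    by (rule cj_int_pow_closed[OF g subgroup.subset[OF K] closed b(2)])
  have "h1 \<otimes> h2 = (b1 \<otimes> cj G (g [^] n1) b2) \<otimes> g [^] (n1 + n2)"
    using bc g unfolding h by (simp add: cj_def group_simps int_pow_mult)
  then show ?case using subgroup.m_closed[OF K b(1) c] by blast
qed

lemma generate_insert_generate:
  assumes "insert g D \<subseteq> carrier G"
  shows "generate G (insert g (generate G D)) = generate G (insert g D)"
proof (rule equalityI)
  show "generate G (insert g (generate G D)) \<subseteq> generate G (insert g D)"
  proof (rule generate_absorb[OF assms])
    show "insert g (generate G D) \<subseteq> generate G (insert g D)"
      using mono_generate[of D "insert g D"] by (auto intro: generate.incl)
  qed
  show "generate G (insert g D) \<subseteq> generate G (insert g (generate G D))"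
    by (rule mono_generate) (auto intro: generate.incl)
qed

lemma polycyclic_seq_insert:
  assumes K: "polycyclic_seq G K" "subgroup K G" and g: "g \<in> carrier G"
    and closed: "\<And>b. b \<in> K \<Longrightarrow> cj G g b \<in> K" "\<And>b. b \<in> K \<Longrightarrow> cj G (inv g) b \<in> K"
  shows "polycyclic_seq G (generate G (insert g K))"
proof -
  define H where "H = generate G (insert g K)"
  have Kc: "K \<subseteq> carrier G" by (rule subgroup.subset[OF K(2)])
  let ?H = "G\<lparr>carrier := H\<rparr>" and ?Q = "G\<lparr>carrier := H\<rparr> Mod K"
  have H: "subgroup H G" unfolding H_def using g Kc by (intro generate_is_subgroup) auto
  have KH: "K \<subseteq> H" unfolding H_def by (auto intro: generate.incl)
  have gH: "g \<in> H" unfolding H_def by (auto intro: generate.incl)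
  interpret H: group "?H" by (rule subgroup.subgroup_is_group[OF H is_group])
  have form: "\<exists>b\<in>K. \<exists>n::int. h = b \<otimes> g [^] n" if "h \<in> H" for h
    using generate_insert_normalizing[OF K(2) g closed] that unfolding H_def by blast
  have "K \<lhd> ?H"
  proof (rule H.normal_inv_iff[THEN iffD2], intro conjI ballI)
    show "subgroup K (?H)" by (rule subgroup_incl[OF K(2) H KH])
    fix x b assume x: "x \<in> carrier (?H)" and b: "b \<in> K"
    then obtain b' and n :: int where b': "b' \<in> K" "x = b' \<otimes> g [^] n" using form[of x] by auto
    have c: "cj G (g [^] n) b \<in> K"
      by (rule cj_int_pow_closed[OF g Kc closed b])
    have bc: "b \<in> carrier G" "b' \<in> carrier G" using b b' Kc by auto
    have "x \<otimes> b \<otimes> inv x = b' \<otimes> cj G (g [^] n) b \<otimes> inv b'"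
      using bc g unfolding b'(2) by (simp add: cj_def group_simps)
    also have "\<dots> \<in> K"
      using c b' subgroup.m_closed[OF K(2)] subgroup.m_inv_closed[OF K(2)] by simp
    finally show "x \<otimes>\<^bsub>?H\<^esub> b \<otimes>\<^bsub>?H\<^esub> inv\<^bsub>?H\<^esub> x \<in> K"
      using x m_inv_consistent[OF H] by simp
  qed
  then interpret N: normal K "?H" .
  interpret Q: group "?Q" by (rule N.factorgroup_is_group)
  have "cyclic_group (?Q)"
    unfolding Q.cyclic_group
  proof (intro bexI[of _ "K #>\<^bsub>?H\<^esub> g"] equalityI subsetI)
    have "K #>\<^bsub>?H\<^esub> g \<in> carrier (?Q)"
      using gH by (auto simp: carrier_FactGroup)
    then show "K #>\<^bsub>?H\<^esub> g \<in> carrier (?Q)" .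
    fix q assume "q \<in> carrier (?Q)"
    then obtain h where h: "h \<in> H" "q = K #>\<^bsub>?H\<^esub> h" by (auto simp: carrier_FactGroup)
    obtain b n where b: "b \<in> K" "h = b \<otimes> g [^] (n::int)" using form[OF h(1)] by blast
    have gn: "g [^] n \<in> H" using subgroup_int_pow_closed[OF H gH] .
    have "q = K #>\<^bsub>?H\<^esub> (b \<otimes>\<^bsub>?H\<^esub> g [^] n)" unfolding h(2) b(2) by simp
    also have "\<dots> = (K #>\<^bsub>?H\<^esub> b) #>\<^bsub>?H\<^esub> g [^] n"
      using KH b gn by (intro H.coset_mult_assoc[symmetric]) auto
    also have "K #>\<^bsub>?H\<^esub> b = K" using b KH N.subgroup_axioms by (intro H.coset_join2) auto
    also have "g [^] n = g [^]\<^bsub>?H\<^esub> n" using int_pow_consistent[OF H gH] .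
    also have "K #>\<^bsub>?H\<^esub> g [^]\<^bsub>?H\<^esub> n =
        (K #>\<^bsub>?H\<^esub> g) [^]\<^bsub>?Q\<^esub> n"
      using gH by (intro N.FactGroup_int_pow[symmetric]) auto
    finally show "q \<in> range (\<lambda>n::int. (K #>\<^bsub>?H\<^esub> g) [^]\<^bsub>?Q\<^esub> n)"
      by blast
  next
    fix q assume "q \<in> range (\<lambda>n::int. (K #>\<^bsub>?H\<^esub> g) [^]\<^bsub>?Q\<^esub> n)"
    moreover have "K #>\<^bsub>?H\<^esub> g \<in> carrier (?Q)"
      using gH by (auto simp: carrier_FactGroup)
    ultimately show "q \<in> carrier (?Q)" by auto
  qed
  then show ?thesis
    using polycyclic_seq.extension[OF K(1) N.normal_axioms H] unfolding H_def by blast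
qed

text \<open>The series first adjoins the generators of the derived group one by one, where
  commutativity gives normality, and then those of \<open>G\<close>, where every subgroup contains
  the derived group and is therefore normal.\<close>

lemma polycyclic_if_derived_finitely_generated:
  assumes F: "finite F" "F \<subseteq> carrier G" "generate G F = derived G (carrier G)"
    and F': "finite F'" "F' \<subseteq> carrier G" "generate G F' = carrier G"
    and comm: "\<And>x y. x \<in> derived G (carrier G) \<Longrightarrow> y \<in> derived G (carrier G) \<Longrightarrow> x \<otimes> y = y \<otimes> x"
  shows "polycyclic G"
proof -
  have 1: "polycyclic_seq G (generate G D)" if "finite D" "D \<subseteq> F" for D
    using that
  proof (induction D)
    case empty
    show ?case using polycyclic_seq.unity[of G] by (simp add: generate_empty)
  next
    case (insert g D)
    have c: "insert g D \<subseteq> carrier G" using insert.prems F by blast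
    have der: "x \<in> derived G (carrier G)" if "x \<in> generate G D \<or> x = g \<or> x = inv g" for x
      using that F(3) mono_generate[of D F] insert.prems generate.incl[of g F G] generate.inv[of g F G] by auto
    have cj: "cj G x b = b" if "x = g \<or> x = inv g" "b \<in> generate G D" for x b
      using comm[OF der der, of x b] that c generate_in_carrier[of D b] by (subst cj_eq_self_iff) auto
    have "polycyclic_seq G (generate G (insert g (generate G D)))"
    proof (rule polycyclic_seq_insert)
      show "polycyclic_seq G (generate G D)" using insert by blast
      show "subgroup (generate G D) G" using c by (intro generate_is_subgroup) auto
    qed (use c cj in auto)
    then show ?case using generate_insert_generate[OF c] by simp
  qed
  have "polycyclic_seq G (generate G (D \<union> F))" if "finite D" "D \<subseteq> F'" for D
    using that
  proof (induction D)
    case empty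
    show ?case using 1[OF F(1)] by simp
  next
    case (insert g D)
    have c: "insert g (D \<union> F) \<subseteq> carrier G" using insert.prems F F' by blast
    have sub: "subgroup (generate G (D \<union> F)) G" using c by (intro generate_is_subgroup) auto
    have der: "derived G (carrier G) \<subseteq> generate G (D \<union> F)"
      unfolding F(3)[symmetric] by (rule mono_generate) auto
    have "polycyclic_seq G (generate G (insert g (generate G (D \<union> F))))"
    proof (rule polycyclic_seq_insert[OF _ sub])
      show "polycyclic_seq G (generate G (D \<union> F))" using insert by blast
    qed (use c cj_in_supergroup_of_derived[OF sub der] in auto)
    then show ?case using generate_insert_generate[OF c] by simp
  qed
  from this[OF F'(1)] have "polycyclic_seq G (generate G (F' \<union> F))" by simp
  moreover have "generate G (F' \<union> F) = carrier G"
    using generate_incl[of "F' \<union> F"] mono_generate[of F' "F' \<union> F"] F F' by auto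
  ultimately show ?thesis by (simp add: polycyclic_def)
qed

end


section \<open>Polycyclic groups are finitely presented\<close>

lemma pres_equiv_mono:
  assumes "pres_equiv X R v w" "X \<subseteq> X'" "R \<subseteq> R'"
  shows "pres_equiv X' R' v w"
proof -
  have "words X \<subseteq> words X'" using assms(2) by (auto simp: words_def)
  with assms show ?thesis
  proof (induction rule: pres_equiv.induct)
    case (cancel u v x b)
    then show ?case using pres_equiv.cancel[of u X' v x R' b] by blast
  next
    case (rel u v l r)
    then show ?case using pres_equiv.rel[of u X' v l r R'] by blast
  qed (auto intro: pres_equiv.intros)
qed

text \<open>Subgroups of \<int> are principal. The generator is natural so that it can serve as the
  length of a word; \<open>m = 0\<close> stands for the case that only \<open>0\<close> satisfies
  \<open>P\<close>.\<close>

lemma int_ideal_generator: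
  fixes P :: "int \<Rightarrow> bool"
  assumes "P 0" "\<And>i j. P i \<Longrightarrow> P j \<Longrightarrow> P (i - j)"
  shows "\<exists>m::nat. \<forall>n. P n \<longleftrightarrow> int m dvd n"
proof -
  have neg: "P (- i)" if "P i" for i using assms(2)[OF assms(1) that] by simp
  have add: "P (i + j)" if "P i" "P j" for i j using assms(2)[OF that(1) neg[OF that(2)]] by simp
  have mult_nat: "P (int k * i)" if "P i" for i and k :: nat
    by (induction k) (auto simp: algebra_simps assms(1) add that)
  have mult: "P (k * i)" if "P i" for i k
    using mult_nat[OF that, of "nat k"] neg[OF mult_nat[OF that, of "nat (- k)"]]
    by (cases "0 \<le> k") simp_all
  show ?thesis
  proof (cases "\<exists>m::nat. m > 0 \<and> P (int m)")
    case False
    have "n = 0" if "P n" for n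
    proof (rule ccontr)
      assume "n \<noteq> 0"
      moreover have "P \<bar>n\<bar>" using that neg by (simp add: abs_if)
      ultimately show False using False by (metis nat_0_le zero_less_abs_iff zero_less_nat_eq abs_ge_zero)
    qed
    then show ?thesis using assms(1) by (intro exI[of _ 0]) auto
  next
    case True
    define m where "m = (LEAST m::nat. m > 0 \<and> P (int m))"
    have m: "m > 0" "P (int m)" using LeastI_ex[OF True] unfolding m_def by auto
    have "int m dvd n" if "P n" for n
    proof (rule ccontr)
      assume "\<not> int m dvd n"
      then have pos: "0 < n mod int m" using m(1) by (metis mod_eq_0_iff_dvd of_nat_0_less_iff pos_mod_sign order_le_less)
      have "n mod int m = n - n div int m * int m" by (simp add: minus_div_mult_eq_mod)
      then have "P (n mod int m)" using assms(2)[OF that mult[OF m(2), of "n div int m"]] by simp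
      then have "0 < nat (n mod int m) \<and> P (int (nat (n mod int m)))" using pos by simp
      then have "m \<le> nat (n mod int m)"
        using Least_le[of "\<lambda>m. m > 0 \<and> P (int m)"] unfolding m_def by blast
      then show False using m(1) pos_mod_bound[of "int m" n] pos by linarith
    qed
    moreover have "P n" if "int m dvd n" for n
      using that mult[OF m(2)] by (auto simp: dvd_def mult.commute)
    ultimately show ?thesis by blast
  qed
qed

context group
begin

lemma word_eval_subgroup:
  assumes "subgroup K G" "k \<in> X \<rightarrow> K" "w \<in> words X"
  shows "word_eval (G\<lparr>carrier := K\<rparr>) k w = word_eval G k w"
  using assms(3)
proof (induction w)
  case (Cons a w)
  obtain x b where "a = (x, b)" by fastforce
  then show ?case using Cons assms(2) m_inv_consistent[OF assms(1)] by (auto simp: Pi_iff)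
qed simp

text \<open>New relations say how the new generator \<open>z\<close> conjugates the old ones and express \<open>z\<^sup>m\<close> in the old
  ones, where \<open>m\<close> generates the ideal of all \<open>n\<close> with \<open>h\<^sup>n \<in> K\<close>; if \<open>m = 0\<close>, the latter is vacuous.\<close>

lemma presentation_cyclic_extension:
  fixes X :: "nat set"
  assumes K: "subgroup K G" and h: "h \<in> carrier G"
    and normal: "\<And>b. b \<in> K \<Longrightarrow> cj G h b \<in> K" "\<And>b. b \<in> K \<Longrightarrow> cj G (inv h) b \<in> K"
    and gen: "\<And>g. g \<in> carrier G \<Longrightarrow> \<exists>b\<in>K. \<exists>n::int. g = b \<otimes> h [^] n"
    and X: "finite X" "finite R" "R \<subseteq> words X \<times> words X" "presentation_of (G\<lparr>carrier := K\<rparr>) X R k"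
  shows "\<exists>(X' :: nat set) R' k'. finite X' \<and> finite R' \<and> R' \<subseteq> words X' \<times> words X' \<and> presentation_of G X' R' k'"
proof -
  interpret K: group "G\<lparr>carrier := K\<rparr>" by (rule subgroup.subgroup_is_group[OF K is_group])
  have kK: "k \<in> X \<rightarrow> K" using X(4) by (simp add: presentation_of_def)
  have Kc: "K \<subseteq> carrier G" by (rule subgroup.subset[OF K])
  have evK: "word_eval (G\<lparr>carrier := K\<rparr>) k w = word_eval G k w" if "w \<in> words X" for w
    by (rule word_eval_subgroup[OF K kK that])
  have "\<forall>b\<in>K. \<exists>w\<in>words X. word_eval G k w = b"
    using K.presentation_surj[OF X(4)] evK by fastforce
  then obtain wd where wd: "\<And>b. b \<in> K \<Longrightarrow> wd b \<in> words X" "\<And>b. b \<in> K \<Longrightarrow> word_eval G k (wd b) = b"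
    by metis
  obtain z where z: "z \<notin> X" using ex_new_if_finite[OF infinite_UNIV_nat X(1)] by blast
  obtain m :: nat where m: "\<And>n::int. h [^] n \<in> K \<longleftrightarrow> int m dvd n"
  proof -
    have "h [^] (i - j) \<in> K" if "h [^] i \<in> K" "h [^] j \<in> K" for i j :: int
      using that subgroup.m_closed[OF K] subgroup.m_inv_closed[OF K] int_pow_diff[OF h] by simp
    then show ?thesis
      using int_ideal_generator[of "\<lambda>n. h [^] n \<in> K"] subgroup.one_closed[OF K] that by auto
  qed
  define X' where "X' = insert z X"
  define k' where "k' = k(z := h)"
  define R1 where "R1 = (\<lambda>x. ([(z, True), (x, True), (z, False)], wd (cj G h (k x)))) ` X"
  define R2 where "R2 = (\<lambda>x. ([(z, False), (x, True), (z, True)], wd (cj G (inv h) (k x)))) ` X"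
  define R3 where "R3 = {(replicate m (z, True), wd (h [^] int m))}"
  define R' where "R' = R \<union> R1 \<union> R2 \<union> R3"
  have XX: "X \<subseteq> X'" by (auto simp: X'_def)
  have wXX: "words X \<subseteq> words X'" using XX by (auto simp: words_def)
  have hm: "h [^] int m \<in> K" using m by simp
  have rep: "replicate m (z, True) \<in> words X'" by (simp add: words_def X'_def in_listsI)
  have R': "finite R'" "R' \<subseteq> words X' \<times> words X'"
    using X wd(1) hm kK normal wXX rep
    by (auto simp: R'_def R1_def R2_def R3_def X'_def Pi_iff)
  have k': "k' \<in> X' \<rightarrow> carrier G" using kK h Kc by (auto simp: k'_def X'_def)
  have k'k: "word_eval G k' w = word_eval G k w" if "w \<in> words X" for w
    by (rule word_eval_cong[OF that]) (use z in \<open>auto simp: k'_def\<close>)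
  have ev_rep: "word_eval G k' (replicate n (z, True)) = h [^] int n" for n
  proof (induction n)
    case (Suc n)
    then show ?case using int_pow_mult[OF h, of 1 "int n"] h by (simp add: k'_def)
  qed simp
  \<comment> \<open>What remains is injectivity of the evident map \<phi> from \<open>P\<close> to
    \<open>G\<close>. It is injective on the subgroup \<open>KP\<close> of the old generators, and
    every element of \<open>P\<close> is one of \<open>KP\<close> times a power of
    \<open>Z\<close>.\<close>
  define P where "P = presented_group X' R'"
  interpret P: group P unfolding P_def by (rule group_presented_group)
  let ?cl = "pclass X' R'"
  define f where "f x = ?cl [(x, True)]" for x
  have Pp: "presentation_of P X' R' f" unfolding P_def f_def by (rule presentation_of_presented_group)
  have fP: "f \<in> X' \<rightarrow> carrier P" using Pp by (simp add: presentation_of_def)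
  have evP: "word_eval P f w = ?cl w" if "w \<in> words X'" for w
    using word_eval_pclass[OF that] unfolding P_def f_def .
  have clP: "?cl w \<in> carrier P" if "w \<in> words X'" for w
    using that by (simp add: P_def pclass_carrier)
  have rel: "?cl l = ?cl r" if "(l, r) \<in> R'" for l r
    using that R'(2) pres_equiv.rel[of "[]" X' "[]" l r R'] by (subst pclass_eq_iff) auto
  have k'_X: "k' x = k x" "k x \<in> carrier G" "k x \<in> K" if "x \<in> X" for x
    using that z kK Kc by (auto simp: k'_def)
  have k'_z: "k' z = h" by (simp add: k'_def)
  have relG: "word_eval G k' l = word_eval G k' r" if lr: "(l, r) \<in> R'" for l r
  proof -
    consider "(l, r) \<in> R" | "(l, r) \<in> R1" | "(l, r) \<in> R2" | "(l, r) \<in> R3"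
      using lr by (auto simp: R'_def)
    then show ?thesis
    proof cases
      case 1
      then have lrX: "l \<in> words X" "r \<in> words X" using X(3) by auto
      then have "pres_equiv X R l r" using pres_equiv.rel[of "[]" X "[]" l r R] 1 by simp
      then show ?thesis using X(4) lrX evK k'k by (simp add: presentation_of_def)
    next
      case 2
      obtain x where x: "x \<in> X" "l = [(z, True), (x, True), (z, False)]" "r = wd (cj G h (k x))"
        using 2 by (auto simp: R1_def)
      have "word_eval G k' r = cj G h (k x)"
        using wd[OF normal(1)[OF k'_X(3)[OF x(1)]]] k'k x(3) by simp
      then show ?thesis using k'_X[OF x(1)] h k'_z x(2) by (simp add: cj_def m_assoc)
    next
      case 3
      obtain x where x: "x \<in> X" "l = [(z, False), (x, True), (z, True)]" "r = wd (cj G (inv h) (k x))"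
        using 3 by (auto simp: R2_def)
      have "word_eval G k' r = cj G (inv h) (k x)"
        using wd[OF normal(2)[OF k'_X(3)[OF x(1)]]] k'k x(3) by simp
      then show ?thesis using k'_X[OF x(1)] h k'_z x(2) by (simp add: cj_def m_assoc)
    next
      case 4
      then show ?thesis using ev_rep wd[OF hm] k'k by (simp add: R3_def)
    qed
  qed
  obtain \<phi> where \<phi>: "\<phi> \<in> hom P G" and \<phi>_ev: "\<And>w. w \<in> words X' \<Longrightarrow> \<phi> (?cl w) = word_eval G k' w"
    using P.presentation_hom[OF Pp is_group k' relG] evP by auto
  interpret \<phi>: group_hom P G \<phi> using \<phi> by (simp add: group_hom_def group_hom_axioms_def)
  define KP where "KP = generate P (f ` X)"
  have fX: "f ` X \<subseteq> carrier P" using fP XX by auto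
  have subKP: "subgroup KP P" unfolding KP_def by (rule P.generate_is_subgroup[OF fX])
  have KP_eq: "KP = ?cl ` words X"
  proof
    show "KP \<subseteq> ?cl ` words X"
    proof
      fix p assume "p \<in> KP"
      then obtain w where "w \<in> words X" "word_eval P f w = p"
        unfolding KP_def using P.word_generate[of f X p] fP XX by (auto simp: Pi_iff)
      then show "p \<in> ?cl ` words X" using evP wXX by (intro image_eqI[of _ _ w]) auto
    qed
    show "?cl ` words X \<subseteq> KP"
    proof
      fix p assume "p \<in> ?cl ` words X"
      then obtain w where w: "w \<in> words X" "p = ?cl w" by blast
      then have "p = word_eval P f w" using evP wXX by auto
      then show "p \<in> KP" unfolding KP_def using P.word_eval_in_generate[OF w(1), of f] fP XX by (auto simp: Pi_iff)
    qed
  qed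
  define Z where "Z = f z"
  have Zc: "Z \<in> carrier P" using fP by (auto simp: Z_def X'_def)
  have fc: "f x \<in> carrier P" if "x \<in> X" for x using fX that by auto
  have cjZ: "cj P Z (f x) \<in> KP" "cj P (inv\<^bsub>P\<^esub> Z) (f x) \<in> KP" if x: "x \<in> X" for x
  proof -
    have w: "[(z, True), (x, True), (z, False)] \<in> words X'" "[(z, False), (x, True), (z, True)] \<in> words X'"
      using x by (auto simp: X'_def)
    have "cj P Z (f x) = ?cl [(z, True), (x, True), (z, False)]"
      using evP[OF w(1)] Zc fc[OF x] by (simp add: cj_def Z_def P.m_assoc)
    also have "\<dots> = ?cl (wd (cj G h (k x)))" by (rule rel) (use x in \<open>auto simp: R'_def R1_def\<close>)
    finally show "cj P Z (f x) \<in> KP" unfolding KP_eq using wd(1)[OF normal(1)] k'_X[OF x] by auto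
    have "cj P (inv\<^bsub>P\<^esub> Z) (f x) = ?cl [(z, False), (x, True), (z, True)]"
      using evP[OF w(2)] Zc fc[OF x] by (simp add: cj_def Z_def P.m_assoc)
    also have "\<dots> = ?cl (wd (cj G (inv h) (k x)))" by (rule rel) (use x in \<open>auto simp: R'_def R2_def\<close>)
    finally show "cj P (inv\<^bsub>P\<^esub> Z) (f x) \<in> KP" unfolding KP_eq using wd(1)[OF normal(2)] k'_X[OF x] by auto
  qed
  have KPZ: "cj P Z b \<in> KP" "cj P (inv\<^bsub>P\<^esub> Z) b \<in> KP" if "b \<in> KP" for b
    using that cjZ Zc fX unfolding KP_def
    by (auto intro!: P.generate_cj_closed[where b = b and F = "f ` X"])
  have Zm: "Z [^]\<^bsub>P\<^esub> int m \<in> KP"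
  proof -
    have "word_eval P f (replicate n (z, True)) = Z [^]\<^bsub>P\<^esub> int n" for n
    proof (induction n)
      case (Suc n)
      then show ?case using P.int_pow_mult[OF Zc, of 1 "int n"] Zc by (simp add: Z_def)
    qed simp
    then have "Z [^]\<^bsub>P\<^esub> int m = ?cl (replicate m (z, True))" using evP[OF rep] by simp
    also have "\<dots> = ?cl (wd (h [^] int m))" by (rule rel) (auto simp: R'_def R3_def)
    finally show ?thesis unfolding KP_eq using wd(1)[OF hm] by auto
  qed
  have \<phi>Z: "\<phi> Z = h"
    using \<phi>_ev[of "[(z, True)]"] h unfolding Z_def f_def by (simp add: X'_def k'_def)
  \<comment> \<open>A word in the old generators that is trivial in \<open>G\<close> is trivial in
    \<open>K\<close>, hence already a consequence of \<open>R\<close>.\<close>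
  have KP_ker: "p = \<one>\<^bsub>P\<^esub>" if p: "p \<in> KP" "\<phi> p = \<one>" for p
  proof -
    obtain w where w: "w \<in> words X" "p = ?cl w" using p(1) KP_eq by auto
    then have "word_eval G k w = \<one>" using p(2) \<phi>_ev[of w] k'k[of w] wXX by auto
    moreover have "\<forall>v\<in>words X. \<forall>v'\<in>words X.
        word_eval (G\<lparr>carrier := K\<rparr>) k v = word_eval (G\<lparr>carrier := K\<rparr>) k v' \<longleftrightarrow> pres_equiv X R v v'"
      using X(4) by (simp add: presentation_of_def)
    from this[rule_format, OF w(1), of "[]"]
    have "word_eval G k w = \<one> \<longleftrightarrow> pres_equiv X R w []" using evK[OF w(1)] by simp
    ultimately have "pres_equiv X R w []" by blast
    then have "pres_equiv X' R' w []" by (rule pres_equiv_mono[OF _ XX]) (auto simp: R'_def)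
    then have "?cl w = ?cl []" using w wXX by (subst pclass_eq_iff) auto
    then show ?thesis using w by (simp add: pclass_Nil P_def)
  qed
  have \<phi>_KP: "\<phi> p \<in> K" if p: "p \<in> KP" for p
  proof -
    obtain w where w: "w \<in> words X" "p = ?cl w" using p KP_eq by auto
    then have "\<phi> p = word_eval (G\<lparr>carrier := K\<rparr>) k w" using \<phi>_ev[of w] k'k[of w] wXX evK by auto
    then show ?thesis using K.word_eval_closed[OF w(1)] kK by simp
  qed
  have ker: "p = \<one>\<^bsub>P\<^esub>" if p: "p \<in> carrier P" "\<phi> p = \<one>" for p
  proof -
    have "carrier P = generate P (f ` X')" using Pp by (simp add: presentation_of_def)
    also have "\<dots> \<subseteq> generate P (insert Z KP)"
      by (rule P.mono_generate) (auto simp: X'_def Z_def KP_def intro: generate.incl)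
    finally have "p \<in> generate P (insert Z KP)" using p by blast
    then obtain b and n :: int where b: "b \<in> KP" "p = b \<otimes>\<^bsub>P\<^esub> Z [^]\<^bsub>P\<^esub> n"
      using P.generate_insert_normalizing[OF subKP Zc KPZ] by blast
    have bc: "b \<in> carrier P" by (rule subgroup.mem_carrier[OF subKP b(1)])
    have "\<phi> b \<otimes> h [^] n = \<one>" using p b bc Zc \<phi>Z by (simp add: \<phi>.hom_int_pow)
    then have "h [^] n = inv (\<phi> b)"
      using bc h by (metis \<phi>.hom_closed int_pow_closed inv_equality inv_comm inv_unique')
    then have "h [^] n \<in> K" using subgroup.m_inv_closed[OF K \<phi>_KP[OF b(1)]] by simp
    \<comment> \<open>By the choice of \<open>m\<close> the power of \<open>Z\<close> is a power of
      \<open>Z^m\<close>, which the last relation puts into \<open>KP\<close>. For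
      \<open>m = 0\<close> this just says \<open>n = 0\<close>.\<close>
    then obtain q where q: "n = int m * q" using m by (auto simp: dvd_def)
    have "Z [^]\<^bsub>P\<^esub> n = (Z [^]\<^bsub>P\<^esub> int m) [^]\<^bsub>P\<^esub> q" unfolding q by (rule P.int_pow_pow[OF Zc, symmetric])
    also have "\<dots> \<in> KP" by (rule P.subgroup_int_pow_closed[OF subKP Zm])
    finally have "p \<in> KP" using b subgroup.m_closed[OF subKP] by blast
    then show ?thesis using KP_ker p by blast
  qed
  have "presentation_of G X' R' k'"
    unfolding presentation_of_def
  proof (intro conjI ballI k')
    have "k' ` X' \<subseteq> carrier G" using k' by auto
    moreover have "g \<in> generate G (k' ` X')" if "g \<in> carrier G" for g
    proof -
      obtain b n where b: "b \<in> K" "g = b \<otimes> h [^] (n::int)" using gen[OF \<open>g \<in> carrier G\<close>] by blast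
      have "b = word_eval G k' (wd b)" using wd[OF b(1)] k'k by simp
      then have "b \<in> generate G (k' ` X')"
        using word_eval_in_generate[of "wd b" X' k'] wd(1)[OF b(1)] wXX k' by auto
      moreover have "h \<in> generate G (k' ` X')" by (rule generate.incl) (auto simp: X'_def k'_def)
      then have "h [^] n \<in> generate G (k' ` X')"
        using subgroup_int_pow_closed[OF generate_is_subgroup] \<open>k' ` X' \<subseteq> carrier G\<close> by blast
      ultimately show ?thesis unfolding b(2) by (rule generate.eng)
    qed
    ultimately show "generate G (k' ` X') = carrier G" using generate_incl by blast
    fix v w assume vw: "v \<in> words X'" "w \<in> words X'"
    show "word_eval G k' v = word_eval G k' w \<longleftrightarrow> pres_equiv X' R' v w"
    proof
      assume "word_eval G k' v = word_eval G k' w"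
      then have "\<phi> (?cl v \<otimes>\<^bsub>P\<^esub> inv\<^bsub>P\<^esub> ?cl w) = \<one>"
        using vw clP \<phi>_ev word_eval_closed[OF vw(2) k'] by simp
      then have "?cl v \<otimes>\<^bsub>P\<^esub> inv\<^bsub>P\<^esub> ?cl w = \<one>\<^bsub>P\<^esub>" using ker vw clP by simp
      then have "?cl v = ?cl w" using vw clP P.inv_solve_right'[of "\<one>\<^bsub>P\<^esub>" "?cl v" "?cl w"] by simp
      then show "pres_equiv X' R' v w" using vw by (simp add: pclass_eq_iff)
    next
      assume "pres_equiv X' R' v w"
      then show "word_eval G k' v = word_eval G k' w"
        using word_eval_pres_equiv[OF _ k' relG] by blast
    qed
  qed
  moreover have "finite X'" using X by (simp add: X'_def)
  ultimately show ?thesis using R' by blast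
qed

lemma polycyclic_seq_presentation:
  assumes "polycyclic_seq G H"
  shows "\<exists>(X :: nat set) R k. finite X \<and> finite R \<and> R \<subseteq> words X \<times> words X \<and>
    presentation_of (G\<lparr>carrier := H\<rparr>) X R k"
  using assms
proof induction
  case unity
  have "words ({} :: nat set) = {[]}" by (auto simp: words_def)
  moreover have "pres_equiv ({} :: nat set) {} [] []" by (rule pres_equiv.refl) simp
  moreover interpret triv: group "G\<lparr>carrier := {\<one>}\<rparr>"
    by (rule subgroup.subgroup_is_group[OF triv_subgroup is_group])
  have "generate (G\<lparr>carrier := {\<one>}\<rparr>) {} = {\<one>}" using triv.generate_empty by simp
  ultimately have "presentation_of (G\<lparr>carrier := {\<one>}\<rparr>) ({} :: nat set) {} (\<lambda>_. \<one>)"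
    by (simp add: presentation_of_def)
  then show ?case by (intro exI[of _ "{}"] exI[of _ "\<lambda>_. \<one>"]) auto
next
  case (extension K H)
  let ?H = "G\<lparr>carrier := H\<rparr>" and ?Q = "G\<lparr>carrier := H\<rparr> Mod K"
  obtain X :: "nat set" and R k where X: "finite X" "finite R" "R \<subseteq> words X \<times> words X"
    "presentation_of (G\<lparr>carrier := K\<rparr>) X R k" using extension.IH by blast
  interpret H: group "?H" by (rule subgroup.subgroup_is_group[OF extension.hyps(3) is_group])
  interpret N: normal K "?H" by (rule extension.hyps(2))
  interpret Q: group "?Q" by (rule N.factorgroup_is_group)
  obtain q where q: "q \<in> carrier (?Q)"
    "carrier (?Q) = range (\<lambda>n::int. q [^]\<^bsub>?Q\<^esub> n)"
    using extension.hyps(4) unfolding Q.cyclic_group by blast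
  obtain h where h: "h \<in> H" "q = K #>\<^bsub>?H\<^esub> h" using q(1) by (auto simp: carrier_FactGroup)
  have "\<exists>b\<in>K. \<exists>n::int. g = b \<otimes>\<^bsub>?H\<^esub> h [^]\<^bsub>?H\<^esub> n" if g: "g \<in> H" for g
  proof -
    have "K #>\<^bsub>?H\<^esub> g \<in> carrier (?Q)" using g by (auto simp: carrier_FactGroup)
    then obtain n :: int where "K #>\<^bsub>?H\<^esub> g = q [^]\<^bsub>?Q\<^esub> n" using q(2) by blast
    also have "\<dots> = K #>\<^bsub>?H\<^esub> h [^]\<^bsub>?H\<^esub> n"
      using N.FactGroup_int_pow[of h n] h by simp
    finally have "g \<in> K #>\<^bsub>?H\<^esub> h [^]\<^bsub>?H\<^esub> n"
      using H.rcos_self[of g K] g N.subgroup_axioms by simp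
    then show ?thesis unfolding r_coset_def by auto
  qed
  moreover have "cj (?H) h b \<in> K" "cj (?H) (inv\<^bsub>?H\<^esub> h) b \<in> K" if "b \<in> K" for b
    using N.inv_op_closed2[of h b] N.inv_op_closed2[of "inv\<^bsub>?H\<^esub> h" b] h that H.inv_closed[of h]
    unfolding cj_def by auto
  ultimately show ?case
    using H.presentation_cyclic_extension[OF N.subgroup_axioms _ _ _ _ X(1-3), of h k] h X(4) by simp
qed

lemma polycyclic_imp_finitely_presented:
  assumes "polycyclic G"
  shows "finitely_presented G"
proof -
  from polycyclic_seq_presentation[OF assms[unfolded polycyclic_def]]
  obtain X :: "nat set" and R k where X: "finite X" "finite R" "R \<subseteq> words X \<times> words X"
    and p: "presentation_of (G\<lparr>carrier := carrier G\<rparr>) X R k"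
    by (elim exE conjE) (rule that)
  have k: "k \<in> X \<rightarrow> carrier G" using p by (simp add: presentation_of_def)
  have "generate (G\<lparr>carrier := carrier G\<rparr>) (k ` X) = generate G (k ` X)"
    using k by (intro generate_consistent subgroup_self) auto
  then have "presentation_of G X R k"
    using p word_eval_subgroup[OF subgroup_self k] by (simp add: presentation_of_def)
  from presentation_iso[OF this] X show ?thesis
    unfolding finitely_presented_def by (intro exI conjI)
qed

end

section \<open>Finite generation in abelian and metabelian groups\<close>

context group
begin

text \<open>Induction on the generators. The exponents of \<open>g\<close> that occur in
  \<open>H\<close>, modulo the span of the other generators, form an ideal of \<int>; an element
  \<open>h0\<close> of \<open>H\<close> realizing its generator, together with finitely many
  generators of the intersection of \<open>H\<close> with that span, generates
  \<open>H\<close>.\<close>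

lemma subgroup_of_finitely_generated_abelian:
  assumes "finite F" "F \<subseteq> carrier G"
    and "\<And>x y. x \<in> generate G F \<Longrightarrow> y \<in> generate G F \<Longrightarrow> x \<otimes> y = y \<otimes> x"
    and "subgroup H G" "H \<subseteq> generate G F"
  shows "\<exists>F'. finite F' \<and> F' \<subseteq> carrier G \<and> generate G F' = H"
  using assms
proof (induction F arbitrary: H)
  case empty
  then have "H = {\<one>}" using subgroup.one_closed[OF empty.prems(3)] by (auto simp: generate_empty)
  then show ?case by (intro exI[of _ "{}"]) (auto simp: generate_empty)
next
  case (insert g F)
  let ?K = "generate G F"
  note comm = insert.prems(2) and H = insert.prems(3)
  have g: "g \<in> carrier G" and F: "F \<subseteq> carrier G" using insert.prems(1) by auto
  have K: "subgroup ?K G" by (rule generate_is_subgroup[OF F])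
  have KF: "?K \<subseteq> generate G (insert g F)" by (rule mono_generate) auto
  have gF: "g \<in> generate G (insert g F)" by (rule generate.incl) simp
  have Kc: "b \<in> carrier G" if "b \<in> ?K" for b by (rule generate_in_carrier[OF F that])
  have gb: "g \<otimes> b = b \<otimes> g" if "b \<in> ?K" for b using comm[OF gF] that KF by blast
  have cj: "cj G g b = b" "cj G (inv g) b = b" if "b \<in> ?K" for b
  proof -
    show "cj G g b = b" using gb[OF that] g Kc[OF that] by (simp add: cj_eq_self_iff)
    then show "cj G (inv g) b = b" using g Kc[OF that] cj_cancel(2) by metis
  qed
  have form: "\<exists>b\<in>?K. \<exists>n::int. h = b \<otimes> g [^] n" if "h \<in> H" for h
    using generate_insert_normalizing[OF K g, of h] cj that insert.prems(1,4) generate_insert_generate[of g F]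
    by auto
  have pow_K: "g [^] (n::int) \<in> generate G (insert g F)" for n
    by (rule subgroup_int_pow_closed[OF generate_is_subgroup[OF insert.prems(1)] gF])
  define P where "P n \<longleftrightarrow> (\<exists>b\<in>?K. b \<otimes> g [^] n \<in> H)" for n :: int
  have "P 0" unfolding P_def using subgroup.one_closed[OF K] subgroup.one_closed[OF H]
    by (intro bexI[of _ \<one>]) auto
  moreover have "P (i - j)" if ij: "P i" "P j" for i j
  proof -
    obtain b b' where b: "b \<in> ?K" "b' \<in> ?K" "b \<otimes> g [^] i \<in> H" "b' \<otimes> g [^] j \<in> H"
      using ij unfolding P_def by blast
    have bc: "b \<in> carrier G" "b' \<in> carrier G" using Kc b by auto
    have ib: "inv b' \<in> ?K" by (rule subgroup.m_inv_closed[OF K b(2)])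
    have "(b \<otimes> g [^] i) \<otimes> inv (b' \<otimes> g [^] j) = b \<otimes> (g [^] (i - j) \<otimes> inv b')"
      using bc g by (simp add: group_simps int_pow_diff)
    also have "g [^] (i - j) \<otimes> inv b' = inv b' \<otimes> g [^] (i - j)"
      using comm[OF pow_K] ib KF by blast
    finally have "(b \<otimes> inv b') \<otimes> g [^] (i - j) \<in> H"
      using subgroup.m_closed[OF H b(3) subgroup.m_inv_closed[OF H b(4)]] bc g by (simp add: m_assoc)
    then show ?thesis unfolding P_def using subgroup.m_closed[OF K b(1) ib] by blast
  qed
  ultimately obtain m :: nat where m: "\<And>n. P n \<longleftrightarrow> int m dvd n"
    using int_ideal_generator[of P] by blast
  then obtain b0 where b0: "b0 \<in> ?K" "b0 \<otimes> g [^] int m \<in> H" unfolding P_def by (meson dvd_refl)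
  define h0 where "h0 = b0 \<otimes> g [^] int m"
  have h0: "h0 \<in> H" using b0 by (simp add: h0_def)
  have h0c: "h0 \<in> carrier G" by (rule subgroup.mem_carrier[OF H h0])
  obtain F0 where F0: "finite F0" "F0 \<subseteq> carrier G" "generate G F0 = H \<inter> ?K"
    using insert.IH[OF F _ subgroups_Inter_pair[OF H K]] comm KF by blast
  have "generate G (insert h0 F0) = H"
  proof
    have "insert h0 F0 \<subseteq> H" using h0 F0(3) by (auto intro: generate.incl)
    then show "generate G (insert h0 F0) \<subseteq> H" using generate_subgroup_incl H by blast
    show "H \<subseteq> generate G (insert h0 F0)"
    proof
      fix h assume h: "h \<in> H"
      then obtain b n where b: "b \<in> ?K" "h = b \<otimes> g [^] (n::int)" using form by blast
      then have "P n" using h unfolding P_def by blast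
      then obtain q where q: "n = int m * q" using m by (auto simp: dvd_def)
      have bc: "b \<in> carrier G" "b0 \<in> carrier G" using Kc b b0 by auto
      have "h0 [^] q = b0 [^] q \<otimes> g [^] n"
        unfolding h0_def q using comm[of b0 "g [^] int m"] pow_K b0(1) KF bc g
        by (subst int_pow_mult_distrib) (auto simp: int_pow_pow)
      then have e: "h \<otimes> inv (h0 [^] q) = b \<otimes> inv (b0 [^] q)"
        using bc g b(2) by (simp add: group_simps)
      have "b \<otimes> inv (b0 [^] q) \<in> ?K"
        using subgroup.m_closed[OF K b(1)] subgroup.m_inv_closed[OF K] subgroup_int_pow_closed[OF K b0(1)] by blast
      moreover have "h \<otimes> inv (h0 [^] q) \<in> H"
        using subgroup.m_closed[OF H h] subgroup.m_inv_closed[OF H] subgroup_int_pow_closed[OF H h0] by blast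
      ultimately have "h \<otimes> inv (h0 [^] q) \<in> generate G F0" using F0(3) e by simp
      then have "h \<otimes> inv (h0 [^] q) \<in> generate G (insert h0 F0)"
        using mono_generate[of F0 "insert h0 F0"] by blast
      moreover have "h0 [^] q \<in> generate G (insert h0 F0)"
        using subgroup_int_pow_closed[OF generate_is_subgroup] h0c F0(2) generate.incl[of h0 "insert h0 F0" G] by auto
      ultimately have "h \<otimes> inv (h0 [^] q) \<otimes> h0 [^] q \<in> generate G (insert h0 F0)" by (rule generate.eng)
      then show "h \<in> generate G (insert h0 F0)"
        using h0c subgroup.mem_carrier[OF H h] by (simp add: m_assoc)
    qed
  qed
  then show ?case using F0 h0c by (intro exI[of _ "insert h0 F0"]) auto
qed

lemma generate_directed_union:
  fixes D :: "nat \<Rightarrow> 'a set"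
  assumes mono: "\<And>i j. i \<le> j \<Longrightarrow> D i \<subseteq> D j" and b: "b \<in> generate G (\<Union>i. D i)"
  shows "\<exists>n. b \<in> generate G (D n)"
  using b
proof induction
  case one
  show ?case by (auto intro: generate.one)
next
  case (eng h1 h2)
  then obtain i j where "h1 \<in> generate G (D i)" "h2 \<in> generate G (D j)" by blast
  then have "h1 \<in> generate G (D (max i j))" "h2 \<in> generate G (D (max i j))"
    using mono_generate[OF mono, of i "max i j"] mono_generate[OF mono, of j "max i j"] by auto
  then show ?case by (blast intro: generate.eng)
qed (auto intro: generate.incl generate.inv)

lemma cj_int_pow_mod:
  fixes j :: int and L :: nat
  assumes g: "g \<in> carrier G" and w: "w \<in> carrier G" and fixed: "cj G (g [^] int L) w = w"
  shows "cj G (g [^] j) w = cj G (g [^] (j mod int L)) w"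
proof -
  have gL: "g [^] int L \<in> carrier G" using g by simp
  have inv: "cj G (inv (g [^] int L)) w = w" using cj_cancel(2)[OF gL w] fixed by simp
  have "cj G ((g [^] int L) [^] (j div int L)) w \<in> {w}"
    by (rule cj_int_pow_closed[OF gL]) (use w fixed inv in auto)
  then have 1: "cj G (g [^] (int L * (j div int L))) w = w" using g by (simp add: int_pow_pow)
  have "g [^] j = g [^] (j mod int L) \<otimes> g [^] (int L * (j div int L))"
    using g by (simp flip: int_pow_mult)
  then show ?thesis using 1 g w by (simp flip: cj_cj)
qed

end

text \<open>Both directions are demanded, because conjugation may map an infinite subgroup properly
  into itself.\<close>

definition normalized_by :: "('a, 'b) monoid_scheme \<Rightarrow> 'a \<Rightarrow> 'a set \<Rightarrow> bool" where
  "normalized_by G s H \<longleftrightarrow> (\<forall>b\<in>H. cj G s b \<in> H \<and> cj G (inv\<^bsub>G\<^esub> s) b \<in> H)"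

locale metabelian = group G for G (structure) +
  assumes derived_comm: "\<And>x y. x \<in> derived G (carrier G) \<Longrightarrow> y \<in> derived G (carrier G) \<Longrightarrow> x \<otimes> y = y \<otimes> x"
begin

abbreviation A :: "'a set" where "A \<equiv> derived G (carrier G)"

section \<open>The conjugation action on an abelian derived group\<close>

lemma A_closed: "a \<in> A \<Longrightarrow> a \<in> carrier G"
  using subgroup.mem_carrier[OF subgroup_derived] .

lemma A_subset: "A \<subseteq> carrier G"
  using A_closed by blast

lemma generate_A: "F \<subseteq> A \<Longrightarrow> generate G F \<subseteq> A"
  by (rule generate_subgroup_incl[OF _ subgroup_derived])

lemma cj_A_trivial: "a \<in> A \<Longrightarrow> b \<in> A \<Longrightarrow> cj G a b = b"
  using derived_comm[of a b] by (simp add: cj_eq_self_iff A_closed)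

lemma cj_cong_mod_A:
  assumes "g \<in> carrier G" "h \<in> carrier G" "g \<otimes> inv h \<in> A" "a \<in> A"
  shows "cj G g a = cj G h a"
proof -
  have "cj G g a = cj G (g \<otimes> inv h) (cj G h a)"
    using assms A_closed by (simp add: cj_cj m_assoc)
  then show ?thesis using cj_A_trivial[OF assms(3) derived_cj[OF assms(2,4)]] by simp
qed

lemma cj_swap:
  assumes "g \<in> carrier G" "h \<in> carrier G" "a \<in> A"
  shows "cj G g (cj G h a) = cj G h (cj G g a)"
proof -
  have "g \<otimes> h \<otimes> inv (h \<otimes> g) = g \<otimes> h \<otimes> inv g \<otimes> inv h"
    using assms by (simp add: group_simps)
  then have "g \<otimes> h \<otimes> inv (h \<otimes> g) \<in> A" using commutator_in_derived[OF assms(1,2)] by simp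
  then show ?thesis using cj_cong_mod_A[of "g \<otimes> h" "h \<otimes> g" a] assms A_closed by (simp add: cj_cj)
qed

lemma cj_swap_fixed:
  assumes "g \<in> carrier G" "h \<in> carrier G" "a \<in> A" "cj G g a = a"
  shows "cj G g (cj G h a) = cj G h a"
  using cj_swap[OF assms(1-3)] assms(4) by simp

text \<open>The subgroup spanned by the whole orbit lies in the finitely generated abelian group
  \<open>generate G D\<close>, so it is finitely generated itself, and finitely many generators
  involve only finitely many members of the orbit.\<close>

lemma finite_orbit_generates:
  assumes s: "s \<in> carrier G" and D: "finite D" "D \<subseteq> A" "normalized_by G s (generate G D)"
    and f: "f \<in> generate G D"
  shows "\<exists>N::nat. \<forall>n::int. cj G (s [^] n) f \<in> generate G ((\<lambda>j. cj G (s [^] j) f) ` {- int N..int N})"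
proof -
  have Dc: "D \<subseteq> carrier G" using D(2) A_subset by blast
  have DA: "generate G D \<subseteq> A" by (rule generate_A[OF D(2)])
  have fc: "f \<in> carrier G" using f DA A_closed by blast
  define Orb where "Orb N = (\<lambda>j. cj G (s [^] j) f) ` {- int N..int N}" for N :: nat
  define Oall where "Oall = (\<Union>N. Orb N)"
  have orb: "cj G (s [^] (n::int)) f \<in> Oall" for n
  proof -
    have "n \<in> {- int (nat \<bar>n\<bar>)..int (nat \<bar>n\<bar>)}" by auto
    then show ?thesis unfolding Oall_def Orb_def by blast
  qed
  have Orb_c: "Orb N \<subseteq> carrier G" for N using s fc by (auto simp: Orb_def)
  then have Oall_c: "Oall \<subseteq> carrier G" by (auto simp: Oall_def)
  have "cj G (s [^] n) f \<in> generate G D" for n :: int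
    by (rule cj_int_pow_closed[OF s generate_incl[OF Dc] _ _ f])
      (use D(3) in \<open>auto simp: normalized_by_def\<close>)
  then have "Oall \<subseteq> generate G D" by (auto simp: Oall_def Orb_def)
  then have "generate G Oall \<subseteq> generate G D" by (rule generate_absorb[OF Dc])
  then obtain F' where F': "finite F'" "F' \<subseteq> carrier G" "generate G F' = generate G Oall"
    using subgroup_of_finitely_generated_abelian[OF D(1) Dc _ generate_is_subgroup[OF Oall_c]]
      derived_comm DA by blast
  have mono: "Orb i \<subseteq> Orb j" if "i \<le> j" for i j using that by (force simp: Orb_def)
  have "\<exists>n. f' \<in> generate G (Orb n)" if "f' \<in> F'" for f'
    using generate_directed_union[of Orb f', OF mono] generate.incl[OF that, of G] F'(3)
    unfolding Oall_def by blast
  then obtain k where k: "\<And>f'. f' \<in> F' \<Longrightarrow> f' \<in> generate G (Orb (k f'))" by metis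
  define N where "N = (\<Sum>f'\<in>F'. k f')"
  have "F' \<subseteq> generate G (Orb N)"
  proof
    fix f' assume f': "f' \<in> F'"
    have "k f' \<le> N" unfolding N_def using F'(1) f' by (intro member_le_sum) auto
    then show "f' \<in> generate G (Orb N)" using k[OF f'] mono_generate[OF mono] by blast
  qed
  then have "generate G Oall \<subseteq> generate G (Orb N)"
    unfolding F'(3)[symmetric] by (rule generate_absorb[OF Orb_c])
  then show ?thesis using orb generate.incl[of _ Oall G] unfolding Orb_def by blast
qed

lemma normalized_by_generateI:
  assumes s: "s \<in> carrier G" and F: "F \<subseteq> carrier G"
    and "\<And>f. f \<in> F \<Longrightarrow> cj G s f \<in> generate G F" "\<And>f. f \<in> F \<Longrightarrow> cj G (inv s) f \<in> generate G F"
  shows "normalized_by G s (generate G F)"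
  using assms by (auto simp: normalized_by_def intro: generate_cj_closed)

text \<open>This works one element of \<open>T\<close> at a time, because the actions of any two elements on \<open>A\<close> commute.\<close>

lemma finitely_generated_normalized:
  assumes F: "finite F" "F \<subseteq> A" and T: "finite T" "T \<subseteq> carrier G"
    and local: "\<And>s f. s \<in> T \<Longrightarrow> f \<in> F \<Longrightarrow>
      \<exists>D. finite D \<and> D \<subseteq> A \<and> f \<in> generate G D \<and> normalized_by G s (generate G D)"
  shows "\<exists>F'. finite F' \<and> F \<subseteq> F' \<and> F' \<subseteq> A \<and> (\<forall>s\<in>T. normalized_by G s (generate G F'))"
proof -
  \<comment> \<open>The induction has to preserve this property for all of \<open>T\<close>,
    including the elements not yet treated. It survives the enlargement of the generating set
    because only conjugates of old elements are added and \<open>lf\<close> passes to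
    conjugates.\<close>
  define lf where "lf s f \<longleftrightarrow> (\<exists>D. finite D \<and> D \<subseteq> A \<and> f \<in> generate G D \<and> normalized_by G s (generate G D))" for s f
  have lf_cj: "lf s (cj G g f)" if "lf s f" and s: "s \<in> carrier G" and g: "g \<in> carrier G" for s g f
  proof -
    obtain D where D: "finite D" "D \<subseteq> A" "f \<in> generate G D" "normalized_by G s (generate G D)"
      using \<open>lf s f\<close> unfolding lf_def by blast
    have Dc: "D \<subseteq> carrier G" using D(2) A_subset by blast
    have img: "generate G (cj G g ` D) = cj G g ` generate G D" using generate_cj_image[OF g Dc] by simp
    have sw: "cj G h (cj G g b) = cj G g (cj G h b)" if "b \<in> generate G D" "h \<in> carrier G" for h b
      using cj_swap[OF that(2) g] generate_A[OF D(2)] that(1) by blast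
    have "normalized_by G s (generate G (cj G g ` D))"
      using D(4) s sw unfolding img normalized_by_def by auto
    moreover have "cj G g ` D \<subseteq> A" using D(2) derived_cj[OF g] by auto
    ultimately show ?thesis unfolding lf_def using D(1,3) img by (intro exI[of _ "cj G g ` D"]) auto
  qed
  have "\<exists>F'. finite F' \<and> F \<subseteq> F' \<and> F' \<subseteq> A \<and> (\<forall>s\<in>T. \<forall>f\<in>F'. lf s f) \<and> (\<forall>s\<in>T'. normalized_by G s (generate G F'))"
    if "finite T'" "T' \<subseteq> T" for T'
    using that
  proof (induction T')
    case empty
    show ?case using F local by (intro exI[of _ F]) (auto simp: lf_def)
  next
    case (insert s T')
    have sT: "s \<in> T" using insert.prems by simp
    obtain F' where F': "finite F'" "F \<subseteq> F'" "F' \<subseteq> A" "\<And>s f. s \<in> T \<Longrightarrow> f \<in> F' \<Longrightarrow> lf s f"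
      "\<And>s. s \<in> T' \<Longrightarrow> normalized_by G s (generate G F')"
      using insert by auto
    have s: "s \<in> carrier G" using insert.prems T by auto
    have "\<exists>N::nat. \<forall>n::int. cj G (s [^] n) f \<in> generate G ((\<lambda>j. cj G (s [^] j) f) ` {- int N..int N})"
      if "f \<in> F'" for f
      using F'(4)[OF sT that] finite_orbit_generates[OF s] unfolding lf_def by blast
    then obtain N :: "'a \<Rightarrow> nat" where N: "\<And>f n. f \<in> F' \<Longrightarrow> cj G (s [^] (n::int)) f \<in>
        generate G ((\<lambda>j. cj G (s [^] j) f) ` {- int (N f)..int (N f)})" by metis
    define F'' where "F'' = (\<Union>f\<in>F'. (\<lambda>j. cj G (s [^] j) f) ` {- int (N f)..int (N f)})"
    have fin: "finite F''" using F'(1) by (auto simp: F''_def)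
    have F'c: "F' \<subseteq> carrier G" using F'(3) A_subset by blast
    have F''A: "F'' \<subseteq> A" using F'(3) derived_cj s by (auto simp: F''_def)
    then have F''c: "F'' \<subseteq> carrier G" using A_subset by blast
    have orb: "cj G (s [^] n) f \<in> generate G F''" if "f \<in> F'" for f and n :: int
      using N[OF that, of n] mono_generate[of "(\<lambda>j. cj G (s [^] j) f) ` {- int (N f)..int (N f)}" F''] that
      unfolding F''_def by blast
    have F'F'': "F' \<subseteq> F''"
    proof
      fix f assume f: "f \<in> F'"
      then have "f = cj G (s [^] (0::int)) f" using F'c by auto
      then show "f \<in> F''" using f unfolding F''_def by force
    qed
    have orb_gen: "cj G (s [^] n) b \<in> generate G F''" if b: "b \<in> generate G F'" for b and n :: int
    proof -
      have "cj G (s [^] n) ` generate G F' = generate G (cj G (s [^] n) ` F')"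
        using generate_cj_image[OF _ F'c] s by simp
      also have "\<dots> \<subseteq> generate G F''" using orb by (intro generate_absorb[OF F''c]) auto
      finally show ?thesis using b by blast
    qed
    have norm_s: "normalized_by G s (generate G F'')"
    proof (rule normalized_by_generateI[OF s F''c])
      fix f'' assume "f'' \<in> F''"
      then obtain f j where f: "f \<in> F'" "f'' = cj G (s [^] (j::int)) f" by (auto simp: F''_def)
      have fc: "f \<in> carrier G" using f F'c by blast
      have "cj G s f'' = cj G (s [^] (1 + j)) f"
        using s fc int_pow_mult[OF s, of 1 j] unfolding f(2) by (simp add: cj_cj)
      then show "cj G s f'' \<in> generate G F''" using orb[OF f(1)] by simp
      have "cj G (inv s) f'' = cj G (s [^] (- 1 + j)) f"
        using s fc int_pow_mult[OF s, of "- 1" j] int_pow_neg[OF s, of 1] unfolding f(2) by (simp add: cj_cj)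
      then show "cj G (inv s) f'' \<in> generate G F''" using orb[OF f(1)] by simp
    qed
    \<comment> \<open>The elements treated earlier keep normalizing the larger subgroup: their
      action moves past the power of \<open>s\<close> and meets a generator from
      \<open>F'\<close>.\<close>
    have norm_T': "normalized_by G s' (generate G F'')" if s': "s' \<in> T'" for s'
    proof (rule normalized_by_generateI[OF _ F''c])
      show s'c: "s' \<in> carrier G" using s' insert.prems T by auto
      fix f'' assume "f'' \<in> F''"
      then obtain f j where f: "f \<in> F'" "f'' = cj G (s [^] (j::int)) f" by (auto simp: F''_def)
      have fA: "f \<in> A" using f F'(3) by blast
      have "cj G s' f \<in> generate G F'" "cj G (inv s') f \<in> generate G F'"
        using F'(5)[OF s'] f(1) generate.incl[of f F' G] unfolding normalized_by_def by blast+
      then show "cj G s' f'' \<in> generate G F''" "cj G (inv s') f'' \<in> generate G F''"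
        unfolding f(2) using s s'c fA orb_gen by (simp_all add: cj_swap[of _ "s [^] j"])
    qed
    have "lf s' f''" if s': "s' \<in> T" and f'': "f'' \<in> F''" for s' f''
    proof -
      obtain f j where f: "f \<in> F'" "f'' = cj G (s [^] (j::int)) f" using f'' by (auto simp: F''_def)
      have "s' \<in> carrier G" using s' T by blast
      then show ?thesis unfolding f(2) using lf_cj[OF F'(4)[OF s' f(1)]] s by simp
    qed
    moreover have "F \<subseteq> F''" using F'(2) F'F'' by blast
    ultimately show ?case using fin F''A norm_s norm_T' by (intro exI[of _ F'']) simp
  qed
  from this[OF T(1)] show ?thesis by blast
qed

text \<open>A subgroup normalized by every element of a generating set of \<open>G\<close> is
  normal, so as soon as it contains \<open>F\<close> it contains all conjugates of \<open>F\<close>,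
  which generate \<open>A\<close>.\<close>

lemma derived_finitely_generated:
  assumes T: "finite T" "T \<subseteq> carrier G" "generate G T = carrier G"
    and F: "finite F" "F \<subseteq> A" "A \<subseteq> generate G {cj G g f | g f. g \<in> carrier G \<and> f \<in> F}"
    and local: "\<And>s f. s \<in> T \<Longrightarrow> f \<in> F \<Longrightarrow>
      \<exists>D. finite D \<and> D \<subseteq> A \<and> f \<in> generate G D \<and> normalized_by G s (generate G D)"
  shows "\<exists>F'. finite F' \<and> F' \<subseteq> carrier G \<and> generate G F' = A"
proof -
  obtain F' where F': "finite F'" "F \<subseteq> F'" "F' \<subseteq> A" "\<And>s. s \<in> T \<Longrightarrow> normalized_by G s (generate G F')"
    using finitely_generated_normalized[OF F(1,2) T(1,2) local] by blast
  have F'c: "F' \<subseteq> carrier G" using F'(3) A_subset by blast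
  have "cj G g b \<in> generate G F'" if "g \<in> generate G T" "b \<in> generate G F'" for g b
    using that
  proof (induction arbitrary: b)
    case one
    then show ?case using generate_in_carrier[OF F'c] by simp
  next
    case (eng h1 h2)
    have "cj G (h1 \<otimes> h2) b = cj G h1 (cj G h2 b)"
      using eng.hyps eng.prems generate_in_carrier[OF T(2)] generate_in_carrier[OF F'c] by (simp add: cj_cj)
    then show ?case using eng by simp
  qed (use F'(4) in \<open>auto simp: normalized_by_def\<close>)
  then have "cj G g f \<in> generate G F'" if "g \<in> carrier G" "f \<in> F" for g f
    using that T(3) F'(2) generate.incl[of f F' G] by blast
  then have "{cj G g f | g f. g \<in> carrier G \<and> f \<in> F} \<subseteq> generate G F'"
    by blast
  then have "A \<subseteq> generate G F'" using F(3) generate_absorb[OF F'c] by blast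
  then show ?thesis using F'(1) F'c generate_A[OF F'(3)] by (intro exI[of _ F']) simp
qed

text \<open>Here \<open>\<pi> a = [x\<^sup>L, a]\<close> kills \<open>U\<close>, and \<open>y\<^sup>L\<close> centralizes the image of \<open>\<pi>\<close>.
  Hence finite generation over \<open>\<langle>x\<rangle>\<close> and over \<open>\<langle>y\<rangle>\<close> reduces to finite generation.\<close>

lemma bicyclic_finitely_generated:
  fixes L :: nat
  assumes x: "x \<in> carrier G" and y: "y \<in> carrier G" and L: "L > 0"
    and V: "V \<subseteq> A" "subgroup V G" "normalized_by G x V" "normalized_by G y V"
    and Fx: "finite Fx" "Fx \<subseteq> V" "V \<subseteq> generate G {cj G (x [^] (j::int)) f | j f. f \<in> Fx}"
    and Fy: "finite Fy" "Fy \<subseteq> V" "V \<subseteq> generate G {cj G (y [^] (j::int)) f | j f. f \<in> Fy}"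
    and U: "V \<subseteq> generate G {cj G g u | g u. g \<in> carrier G \<and> u \<in> U \<union> U'}" "U \<union> U' \<subseteq> A"
    and fixed: "\<And>u. u \<in> U \<Longrightarrow> cj G (x [^] int L) u = u" "\<And>u. u \<in> U' \<Longrightarrow> cj G (y [^] int L) u = u"
  shows "\<exists>F. finite F \<and> F \<subseteq> A \<and> generate G F = V"
proof -
  define \<pi> where "\<pi> a = cj G (x [^] int L) a \<otimes> inv a" for a
  let ?A = "G\<lparr>carrier := A\<rparr>"
  interpret GA: group ?A by (rule subgroup.subgroup_is_group[OF subgroup_derived is_group])
  have V_pow: "cj G (x [^] (j::int)) v \<in> V" "cj G (y [^] (j::int)) v \<in> V" if "v \<in> V" for v j
    using cj_int_pow_closed[OF x, of V v j] cj_int_pow_closed[OF y, of V v j] V that A_subset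
    unfolding normalized_by_def by auto
  have inv_A: "inv a \<in> A" if "a \<in> A" for a using subgroup.m_inv_closed[OF subgroup_derived that] .
  have \<pi>_A: "\<pi> a \<in> A" if "a \<in> A" for a
    unfolding \<pi>_def using that x inv_A derived_cj subgroup.m_closed[OF subgroup_derived] by simp
  have \<pi>_V: "\<pi> v \<in> V" if "v \<in> V" for v
    unfolding \<pi>_def using subgroup.m_closed[OF V(2) V_pow(1)[OF that] subgroup.m_inv_closed[OF V(2) that]] .
  have \<pi>_mult: "\<pi> (a \<otimes> b) = \<pi> a \<otimes> \<pi> b" if "a \<in> A" "b \<in> A" for a b
  proof -
    have c: "a \<in> carrier G" "b \<in> carrier G" using that A_closed by auto
    let ?a = "cj G (x [^] int L) a" and ?b = "cj G (x [^] int L) b"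
    have A: "?a \<in> A" "?b \<in> A" using that derived_cj x by auto
    have "\<pi> (a \<otimes> b) = ?a \<otimes> (?b \<otimes> inv b \<otimes> inv a)"
      unfolding \<pi>_def using c x by (simp add: cj_mult group_simps)
    also have "?b \<otimes> inv b \<otimes> inv a = inv a \<otimes> (?b \<otimes> inv b)"
      using derived_comm subgroup.m_closed[OF subgroup_derived A(2) inv_A[OF that(2)]] inv_A[OF that(1)] by blast
    finally show ?thesis unfolding \<pi>_def using c x by (simp add: m_assoc)
  qed
  have \<pi>_cj: "\<pi> (cj G g a) = cj G g (\<pi> a)" if "g \<in> carrier G" "a \<in> A" for g a
    unfolding \<pi>_def using that x A_closed[OF that(2)]
    by (simp add: cj_mult cj_inv cj_swap[of "x [^] int L" g a])
  interpret \<pi>: group_hom ?A ?A \<pi>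
    using \<pi>_A \<pi>_mult GA.is_group by (auto simp: group_hom_def group_hom_axioms_def hom_def)
  have \<pi>_gen: "\<pi> b \<in> generate G (\<pi> ` D)" if D: "D \<subseteq> A" and b: "b \<in> generate G D" for D b
  proof -
    have "\<pi> ` D \<subseteq> A" using \<pi>_A D by blast
    then have "generate G (\<pi> ` D) = \<pi> ` generate G D"
      using \<pi>.generate_img[of D] generate_consistent[OF D subgroup_derived]
        generate_consistent[OF _ subgroup_derived, of "\<pi> ` D"] D by simp
    then show ?thesis using b by blast
  qed
  have yL: "y [^] int L \<in> carrier G" using y by simp
  have \<pi>_U: "cj G (y [^] int L) (\<pi> u) = \<pi> u" if "u \<in> U \<union> U'" for u
  proof (cases "u \<in> U")
    case True
    then have "\<pi> u = \<one>" unfolding \<pi>_def using fixed(1) U(2) A_closed[of u] by auto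
    then show ?thesis using yL by simp
  next
    case False
    then have "u \<in> U'" "u \<in> A" using that U(2) by auto
    then show ?thesis using \<pi>_cj[OF yL, of u] fixed(2) by simp
  qed
  have fixed_V: "cj G (y [^] int L) (\<pi> v) = \<pi> v" if v: "v \<in> V" for v
  proof -
    let ?D = "{cj G g u | g u. g \<in> carrier G \<and> u \<in> U \<union> U'}"
    have D: "?D \<subseteq> A" using U(2) derived_cj by blast
    have \<pi>D: "\<pi> ` ?D \<subseteq> carrier G" using \<pi>_A D A_closed by blast
    have fix_D: "cj G (y [^] int L) (\<pi> d) = \<pi> d" if d: "d \<in> ?D" for d
    proof -
      obtain g u where g: "g \<in> carrier G" "u \<in> U \<union> U'" "d = cj G g u" using d by blast
      have u: "u \<in> A" using g(2) U(2) by blast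
      show ?thesis unfolding g(3) \<pi>_cj[OF g(1) u]
        by (rule cj_swap_fixed[OF yL g(1) \<pi>_A[OF u] \<pi>_U[OF g(2)]])
    qed
    have id: "(\<lambda>b. b) \<in> hom G G" by (simp add: hom_def)
    have "cj G (y [^] int L) b = b" if "b \<in> generate G (\<pi> ` ?D)" for b
    proof (rule hom_eq_on_generate[OF cj_hom[OF yL] id is_group \<pi>D _ that])
      fix f assume "f \<in> \<pi> ` ?D"
      then show "cj G (y [^] int L) f = f" using fix_D by (auto simp only: image_iff)
    qed
    then show ?thesis using \<pi>_gen[OF D] v U(1) by blast
  qed
  have y_mod: "cj G (y [^] (j::int)) w = cj G (y [^] (j mod int L)) w"
    if w: "w \<in> A" "cj G (y [^] int L) w = w" for w j
    using cj_int_pow_mod[OF y A_closed[OF w(1)] w(2)] .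
  \<comment> \<open>The image of \<open>V\<close> under \<pi> is spanned by the
    \<open>y\<close>-conjugates of the elements \<open>\<pi> f\<close> with
    \<open>f \<in> Fy\<close>. As \<open>y^L\<close> fixes this image, exponents below
    \<open>L\<close> suffice, and the finite set \<open>P\<close> spans it.\<close>
  define P where "P = (\<lambda>(j, f). cj G (y [^] (j::int)) (\<pi> f)) ` ({0..<int L} \<times> Fy)"
  define E where "E = (\<lambda>(j, f). cj G (x [^] (j::int)) f) ` ({0..<int L} \<times> Fx)"
  have PV: "P \<subseteq> V" using V_pow(2) \<pi>_V Fy(2) by (auto simp: P_def)
  have EV: "E \<subseteq> V" using V_pow(1) Fx(2) by (auto simp: E_def)
  have EPc: "E \<union> P \<subseteq> carrier G" using PV EV V(1) A_subset by blast
  have \<pi>V_P: "\<pi> v \<in> generate G P" if v: "v \<in> V" for v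
  proof -
    let ?D = "{cj G (y [^] (j::int)) f | j f. f \<in> Fy}"
    have D: "?D \<subseteq> A" using V_pow(2) Fy(2) V(1) by blast
    have "\<pi> ` ?D \<subseteq> P"
    proof
      fix d assume "d \<in> \<pi> ` ?D"
      then obtain j f where f: "f \<in> Fy" "d = \<pi> (cj G (y [^] (j::int)) f)" by blast
      have fV: "f \<in> V" using f Fy(2) by blast
      have "d = cj G (y [^] j) (\<pi> f)" using f y fV V(1) \<pi>_cj by auto
      also have "\<dots> = cj G (y [^] (j mod int L)) (\<pi> f)"
        by (rule y_mod) (use fV V(1) \<pi>_A fixed_V in auto)
      finally show "d \<in> P" unfolding P_def using f(1) L by (intro image_eqI[of _ _ "(j mod int L, f)"]) auto
    qed
    then have "generate G (\<pi> ` ?D) \<subseteq> generate G P" by (rule mono_generate)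
    then show ?thesis using \<pi>_gen[OF D] v Fy(3) by blast
  qed
  let ?W = "generate G (E \<union> P)"
  have PW: "generate G P \<subseteq> ?W" by (rule mono_generate) auto
  have W: "subgroup ?W G" by (rule generate_is_subgroup[OF EPc])
  have xW: "cj G (x [^] (r + int L * q)) f \<in> ?W" if f: "f \<in> Fx" and r: "0 \<le> r" "r < int L" for f r q
  proof -
    have fV: "f \<in> V" using f Fx(2) by blast
    then have fc: "f \<in> carrier G" using V(1) A_closed by blast
    \<comment> \<open>Raising the exponent of \<open>x\<close> by \<open>L\<close> multiplies the
      conjugate by a value of \<pi>, which is already in the span of \<open>P\<close>. So the
      conjugates in \<open>E\<close>, with exponents below \<open>L\<close>, account for the whole
      orbit.\<close>
    have step: "cj G (x [^] (j + int L)) f = \<pi> (cj G (x [^] j) f) \<otimes> cj G (x [^] j) f" for j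
    proof -
      have "x [^] (j + int L) = x [^] int L \<otimes> x [^] j" using x by (simp flip: int_pow_mult add: add.commute)
      then show ?thesis unfolding \<pi>_def using x fc by (simp add: m_assoc flip: cj_cj)
    qed
    have \<pi>W: "\<pi> (cj G (x [^] j) f) \<in> ?W" for j :: int using \<pi>V_P V_pow(1)[OF fV] PW by blast
    show ?thesis
    proof (induction q rule: int_induct[where k = 0])
      case base
      have "cj G (x [^] r) f \<in> E" unfolding E_def using f r by (intro image_eqI[of _ _ "(r, f)"]) auto
      then show ?case by (auto intro: generate.incl)
    next
      case (step1 i)
      have e: "r + int L * (i + 1) = (r + int L * i) + int L" by (simp add: algebra_simps)
      show ?case unfolding e step by (rule generate.eng[OF \<pi>W step1(2)])
    next
      case (step2 i)
      let ?b = "cj G (x [^] (r + int L * (i - 1))) f" and ?p = "\<pi> (cj G (x [^] (r + int L * (i - 1))) f)"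
      have e': "r + int L * i = (r + int L * (i - 1)) + int L" by (simp add: algebra_simps)
      have e: "cj G (x [^] (r + int L * i)) f = ?p \<otimes> ?b" by (subst e', rule step)
      have "?p \<in> carrier G" using \<pi>W generate_in_carrier[OF EPc] by blast
      then have "?b = inv ?p \<otimes> cj G (x [^] (r + int L * i)) f" unfolding e using x fc by simp
      also have "\<dots> \<in> ?W" by (rule subgroup.m_closed[OF W subgroup.m_inv_closed[OF W \<pi>W] step2(2)])
      finally show ?case .
    qed
  qed
  have "{cj G (x [^] (j::int)) f | j f. f \<in> Fx} \<subseteq> ?W"
  proof
    fix b assume "b \<in> {cj G (x [^] (j::int)) f | j f. f \<in> Fx}"
    then obtain j f where b: "f \<in> Fx" "b = cj G (x [^] (j::int)) f" by blast
    then show "b \<in> ?W" using xW[OF b(1), of "j mod int L" "j div int L"] L by simp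
  qed
  then have "V \<subseteq> ?W" using Fx(3) generate_absorb[OF EPc] by blast
  moreover have "?W \<subseteq> V" using PV EV by (intro generate_subgroup_incl[OF _ V(2)]) auto
  moreover have "finite (E \<union> P)" using Fx(1) Fy(1) by (simp add: E_def P_def)
  ultimately show ?thesis using PV EV V(1) by (intro exI[of _ "E \<union> P"]) auto
qed

end

section \<open>Homomorphisms from Artin groups and their metabelian tops\<close>

context group
begin

lemma rcos_eq_iff:
  assumes "subgroup N G" "x \<in> carrier G" "y \<in> carrier G"
  shows "N #> x = N #> y \<longleftrightarrow> x \<otimes> inv y \<in> N"
  using repr_independence[of x N y] rcos_self[OF assms(2,1)] subgroup.rcos_module[OF assms(1) is_group assms(3,2)]
    assms by auto

lemma generate_commute:
  assumes "T \<subseteq> carrier G" "\<And>s t. s \<in> T \<Longrightarrow> t \<in> T \<Longrightarrow> s \<otimes> t = t \<otimes> s"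
    and "x \<in> generate G T" "y \<in> generate G T"
  shows "x \<otimes> y = y \<otimes> x"
proof -
  have c: "g \<in> carrier G" if "g \<in> generate G T" for g by (rule generate_in_carrier[OF assms(1) that])
  have id: "(\<lambda>b. b) \<in> hom G G" by (simp add: hom_def)
  have *: "cj G g b = b" if "g \<in> carrier G" "\<And>t. t \<in> T \<Longrightarrow> g \<otimes> t = t \<otimes> g" "b \<in> generate G T" for g b
    by (rule hom_eq_on_generate[OF cj_hom[OF that(1)] id is_group assms(1) _ that(3)])
      (use that(1,2) assms(1) in \<open>auto simp: cj_eq_self_iff\<close>)
  have "x \<otimes> t = t \<otimes> x" if "t \<in> T" for t
    using *[of t x] assms that c[OF assms(3)] by (auto simp: cj_eq_self_iff)
  then show ?thesis using *[of x y] assms(3,4) c by (simp add: cj_eq_self_iff)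
qed

lemma second_derived_trivial:
  assumes "\<And>x y. x \<in> derived G (carrier G) \<Longrightarrow> y \<in> derived G (carrier G) \<Longrightarrow> x \<otimes> y = y \<otimes> x"
  shows "derived G (derived G (carrier G)) = {\<one>}"
proof -
  have "h \<otimes> h' \<otimes> inv h \<otimes> inv h' = \<one>" if "h \<in> derived G (carrier G)" "h' \<in> derived G (carrier G)" for h h'
  proof -
    have c: "h \<in> carrier G" "h' \<in> carrier G" using that subgroup.mem_carrier[OF subgroup_derived] by auto
    have "h \<otimes> h' \<otimes> inv h \<otimes> inv h' = h' \<otimes> h \<otimes> inv h \<otimes> inv h'" using assms[OF that] by simp
    then show ?thesis using c by (simp add: m_assoc)
  qed
  then have "derived_set G (derived G (carrier G)) \<subseteq> {\<one>}"
    by blast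
  then have "derived G (derived G (carrier G)) \<subseteq> {\<one>}"
    unfolding derived_def[of G "derived G (carrier G)"] by (rule generate_subgroup_incl[OF _ triv_subgroup])
  moreover have "\<one> \<in> derived G (derived G (carrier G))"
    unfolding derived_def[of G "derived G (carrier G)"] by (rule generate.one)
  ultimately show ?thesis by blast
qed

lemma metabelian_top_hom:
  assumes h: "h \<in> hom G K" and K: "metabelian K"
  shows "\<exists>h'\<in>hom (metabelian_top G) K. \<forall>g\<in>carrier G. h' (derived G (derived G (carrier G)) #> g) = h g"
proof -
  interpret K: metabelian K by fact
  interpret h: group_hom G K h using h K.is_group by (simp add: group_hom_def group_hom_axioms_def)
  let ?N = "derived G (derived G (carrier G))"
  have N: "?N \<lhd> G" by (rule second_derived_normal)
  have A: "derived G (carrier G) \<subseteq> carrier G" by (rule derived_in_carrier) simp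
  have "h ` ?N = derived K (derived K (h ` carrier G))" using h.derived_img A by simp
  also have "\<dots> \<subseteq> derived K (derived K (carrier K))" by (intro K.mono_derived) auto
  also have "\<dots> = {\<one>\<^bsub>K\<^esub>}" by (rule K.second_derived_trivial[OF K.derived_comm])
  finally have ker: "h n = \<one>\<^bsub>K\<^esub>" if "n \<in> ?N" for n using that by blast
  have "h x = h y" if xy: "x \<in> carrier G" "y \<in> carrier G" "?N #> x = ?N #> y" for x y
  proof -
    have "x \<otimes> inv y \<in> ?N" using xy rcos_eq_iff[OF normal_imp_subgroup[OF N]] by blast
    then have "h x \<otimes>\<^bsub>K\<^esub> inv\<^bsub>K\<^esub> h y = \<one>\<^bsub>K\<^esub>" using ker[of "x \<otimes> inv y"] xy by simp
    then show ?thesis using xy K.inv_solve_right'[of "\<one>\<^bsub>K\<^esub>" "h x" "h y"] by simp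
  qed
  then obtain h' where "h' \<in> hom (G Mod ?N) K" "\<And>x. x \<in> carrier G \<Longrightarrow> h' (?N #> x) = h x"
    using FactGroup_universal[OF h N] by metis
  then show ?thesis unfolding metabelian_top_def by blast
qed

lemma metabelian_metabelian_top: "metabelian (metabelian_top G)"
proof -
  let ?N = "derived G (derived G (carrier G))"
  interpret N: normal ?N G by (rule second_derived_normal)
  interpret M: group "metabelian_top G" by (rule group_metabelian_top)
  interpret p: group_hom G "metabelian_top G" "\<lambda>a. ?N #> a"
    using N.r_coset_hom_Mod M.is_group
    by (simp add: group_hom_def group_hom_axioms_def metabelian_top_def)
  have surj: "(\<lambda>a. ?N #> a) ` carrier G = carrier (metabelian_top G)"
    by (simp add: metabelian_top_def carrier_FactGroup)
  have A: "derived G (carrier G) \<subseteq> carrier G" by (rule derived_in_carrier) simp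
  have D: "derived (metabelian_top G) (carrier (metabelian_top G)) = (\<lambda>a. ?N #> a) ` derived G (carrier G)"
    using p.derived_img[of "carrier G"] surj by simp
  show ?thesis
  proof (intro metabelian.intro metabelian_axioms.intro M.is_group)
    fix x y assume "x \<in> derived (metabelian_top G) (carrier (metabelian_top G))"
      "y \<in> derived (metabelian_top G) (carrier (metabelian_top G))"
    then obtain a b where ab: "a \<in> derived G (carrier G)" "b \<in> derived G (carrier G)" "x = ?N #> a" "y = ?N #> b"
      unfolding D by blast
    have c: "a \<in> carrier G" "b \<in> carrier G" using ab A by auto
    have "a \<otimes> b \<otimes> inv a \<otimes> inv b \<in> ?N"
      unfolding derived_def[of G "derived G (carrier G)"] by (rule generate.incl) (use ab in blast)
    then have "?N #> (a \<otimes> b) = ?N #> (b \<otimes> a)"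
      using c rcos_eq_iff[OF N.subgroup_axioms, of "a \<otimes> b" "b \<otimes> a"] by (simp add: group_simps)
    then show "x \<otimes>\<^bsub>metabelian_top G\<^esub> y = y \<otimes>\<^bsub>metabelian_top G\<^esub> x"
      using c p.hom_mult[of a b] p.hom_mult[of b a] unfolding ab by simp
  qed
qed

lemma word_eval_alt_word_even:
  assumes "k s \<in> carrier G" "k t \<in> carrier G"
  shows "word_eval G k (alt_word (2 * m) s t) = (k s \<otimes> k t) [^] m"
proof (induction m)
  case (Suc m)
  have "alt_word (2 * Suc m) s t = (s, True) # (t, True) # alt_word (2 * m) s t" by simp
  then show ?case using Suc assms nat_pow_Suc2[of "k s \<otimes> k t" m] by (simp add: m_assoc del: nat_pow_Suc)
qed simp

lemma word_eval_alt_word_odd: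
  assumes "k s \<in> carrier G" "k t \<in> carrier G"
  shows "word_eval G k (alt_word (2 * m + 1) s t) = k s \<otimes> (k t \<otimes> k s) [^] m"
  using word_eval_alt_word_even[of k t s m] assms by simp

lemma pow_swap:
  assumes "a \<in> carrier G" "b \<in> carrier G"
  shows "a \<otimes> (b \<otimes> a) [^] (m::nat) = (a \<otimes> b) [^] m \<otimes> a"
proof (induction m)
  case (Suc m)
  have "a \<otimes> (b \<otimes> a) [^] Suc m = (a \<otimes> (b \<otimes> a) [^] m) \<otimes> (b \<otimes> a)" using assms by (simp add: m_assoc)
  then show ?case using Suc assms by (simp add: m_assoc)
qed (use assms in simp)

end

section \<open>Maps that respect the Artin relations\<close>

definition artin_map :: "'s set \<Rightarrow> 's set set \<Rightarrow> ('s set \<Rightarrow> nat) \<Rightarrow> ('g, 'm) monoid_scheme \<Rightarrow> ('s \<Rightarrow> 'g) \<Rightarrow> bool" where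
  "artin_map S E lam K k \<longleftrightarrow> k \<in> S \<rightarrow> carrier K \<and>
    (\<forall>s t. {s, t} \<in> E \<longrightarrow> word_eval K k (alt_word (lam {s, t}) s t) = word_eval K k (alt_word (lam {s, t}) t s))"

context labelled_graph
begin

lemma edge_vertices: "{s, t} \<in> E \<Longrightarrow> s \<in> S \<and> t \<in> S \<and> s \<noteq> t"
  using edges by (fastforce simp: card_2_iff')

lemma finite_E: "finite E"
  by (rule finite_subset[of _ "Pow S"]) (use edges finite_vertices in auto)

lemma alt_word_words: "s \<in> S \<Longrightarrow> t \<in> S \<Longrightarrow> alt_word n s t \<in> words S"
  by (induction n arbitrary: s t) auto

text \<open>Words disappear here: an alternating word of even length is a power of a product of two
  generators, and odd length adds one letter. All later checks of Artin relations are about these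
  group equations.\<close>

lemma artin_map_iff:
  assumes "group K" "k \<in> S \<rightarrow> carrier K"
  shows "artin_map S E lam K k \<longleftrightarrow> (\<forall>s t m. {s, t} \<in> E \<longrightarrow>
      (lam {s, t} = 2 * m \<longrightarrow> (k s \<otimes>\<^bsub>K\<^esub> k t) [^]\<^bsub>K\<^esub> m = (k t \<otimes>\<^bsub>K\<^esub> k s) [^]\<^bsub>K\<^esub> m) \<and>
      (lam {s, t} = 2 * m + 1 \<longrightarrow> k s \<otimes>\<^bsub>K\<^esub> (k t \<otimes>\<^bsub>K\<^esub> k s) [^]\<^bsub>K\<^esub> m = k t \<otimes>\<^bsub>K\<^esub> (k s \<otimes>\<^bsub>K\<^esub> k t) [^]\<^bsub>K\<^esub> m))"
    (is "_ \<longleftrightarrow> ?R")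
proof -
  interpret K: group K by fact
  have k: "k s \<in> carrier K" "k t \<in> carrier K" if "{s, t} \<in> E" for s t
    using edge_vertices[OF that] assms(2) by auto
  note ev = K.word_eval_alt_word_even[of k] K.word_eval_alt_word_odd[of k]
  show ?thesis
  proof
    assume L: "artin_map S E lam K k"
    show ?R
    proof (intro allI impI conjI)
      fix s t m assume e: "{s, t} \<in> E"
      have *: "word_eval K k (alt_word (lam {s, t}) s t) = word_eval K k (alt_word (lam {s, t}) t s)"
        using L e unfolding artin_map_def by blast
      show "(k s \<otimes>\<^bsub>K\<^esub> k t) [^]\<^bsub>K\<^esub> m = (k t \<otimes>\<^bsub>K\<^esub> k s) [^]\<^bsub>K\<^esub> m" if "lam {s, t} = 2 * m"
        using * k[OF e] ev unfolding that by metis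
      show "k s \<otimes>\<^bsub>K\<^esub> (k t \<otimes>\<^bsub>K\<^esub> k s) [^]\<^bsub>K\<^esub> m = k t \<otimes>\<^bsub>K\<^esub> (k s \<otimes>\<^bsub>K\<^esub> k t) [^]\<^bsub>K\<^esub> m" if "lam {s, t} = 2 * m + 1"
        using * k[OF e] ev unfolding that by metis
    qed
  next
    assume R: ?R
    have "word_eval K k (alt_word (lam {s, t}) s t) = word_eval K k (alt_word (lam {s, t}) t s)"
      if e: "{s, t} \<in> E" for s t
    proof (cases "even (lam {s, t})")
      case True
      then obtain m where m: "lam {s, t} = 2 * m" by blast
      have "(k s \<otimes>\<^bsub>K\<^esub> k t) [^]\<^bsub>K\<^esub> m = (k t \<otimes>\<^bsub>K\<^esub> k s) [^]\<^bsub>K\<^esub> m" using R e m by blast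
      then show ?thesis unfolding m using k[OF e] ev(1) by metis
    next
      case False
      then obtain m where m: "lam {s, t} = 2 * m + 1" using oddE by blast
      have "k s \<otimes>\<^bsub>K\<^esub> (k t \<otimes>\<^bsub>K\<^esub> k s) [^]\<^bsub>K\<^esub> m = k t \<otimes>\<^bsub>K\<^esub> (k s \<otimes>\<^bsub>K\<^esub> k t) [^]\<^bsub>K\<^esub> m" using R e m by blast
      then show ?thesis unfolding m using k[OF e] ev(2) by metis
    qed
    then show "artin_map S E lam K k" using assms(2) unfolding artin_map_def by blast
  qed
qed

text \<open>An odd relation is trivial once both ends have the same image. This serves maps that are
  constant on the components of the odd edges.\<close>

lemma artin_map_commuteI:
  assumes "group K" "k \<in> S \<rightarrow> carrier K"
    and "\<And>s t. {s, t} \<in> E \<Longrightarrow> odd (lam {s, t}) \<Longrightarrow> k s = k t"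
    and "\<And>s t m. {s, t} \<in> E \<Longrightarrow> lam {s, t} = 2 * m \<Longrightarrow> (k s \<otimes>\<^bsub>K\<^esub> k t) [^]\<^bsub>K\<^esub> m = (k t \<otimes>\<^bsub>K\<^esub> k s) [^]\<^bsub>K\<^esub> m"
  shows "artin_map S E lam K k"
  unfolding artin_map_iff[OF assms(1,2)]
proof (intro allI impI conjI)
  fix s t m assume e: "{s, t} \<in> E"
  show "(k s \<otimes>\<^bsub>K\<^esub> k t) [^]\<^bsub>K\<^esub> m = (k t \<otimes>\<^bsub>K\<^esub> k s) [^]\<^bsub>K\<^esub> m" if "lam {s, t} = 2 * m"
    using assms(4)[OF e that] .
  show "k s \<otimes>\<^bsub>K\<^esub> (k t \<otimes>\<^bsub>K\<^esub> k s) [^]\<^bsub>K\<^esub> m = k t \<otimes>\<^bsub>K\<^esub> (k s \<otimes>\<^bsub>K\<^esub> k t) [^]\<^bsub>K\<^esub> m" if "lam {s, t} = 2 * m + 1"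
    using assms(3)[OF e] that by simp
qed

definition top_gen :: "'s \<Rightarrow> 's word set set" where
  "top_gen s = r_coset (artin_group S E lam)
     (derived (artin_group S E lam) (derived (artin_group S E lam) (carrier (artin_group S E lam))))
     (pclass S (artin_relations E lam) [(s, True)])"

lemma metabelian_top_artin_ext:
  assumes K: "metabelian K" and k: "artin_map S E lam K k"
  shows "\<exists>h\<in>hom (metabelian_top (artin_group S E lam)) K. \<forall>s\<in>S. h (top_gen s) = k s"
proof -
  let ?G = "artin_group S E lam" and ?R = "artin_relations E lam"
  interpret G: group ?G by (rule group_artin_group)
  interpret K: metabelian K by fact
  have kc: "k \<in> S \<rightarrow> carrier K" using k by (simp add: artin_map_def)
  have pres: "presentation_of ?G S ?R (\<lambda>x. pclass S ?R [(x, True)])"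
    unfolding artin_group_def by (rule presentation_of_presented_group)
  have gen: "pclass S ?R [(s, True)] \<in> carrier ?G" if "s \<in> S" for s
    using that by (simp add: artin_group_def pclass_carrier)
  have "word_eval K k l = word_eval K k r" if "(l, r) \<in> ?R" for l r
    using that k unfolding artin_relations_def artin_map_def by blast
  then obtain h where h: "h \<in> hom ?G K"
    "\<And>w. w \<in> words S \<Longrightarrow> h (word_eval ?G (\<lambda>x. pclass S ?R [(x, True)]) w) = word_eval K k w"
    using G.presentation_hom[OF pres K.is_group kc] by blast
  have hs: "h (pclass S ?R [(s, True)]) = k s" if "s \<in> S" for s
    using h(2)[of "[(s, True)]"] that gen[OF that] kc by (simp add: Pi_iff)
  obtain h' where "h' \<in> hom (metabelian_top ?G) K"
    "\<And>g. g \<in> carrier ?G \<Longrightarrow> h' (derived ?G (derived ?G (carrier ?G)) #>\<^bsub>?G\<^esub> g) = h g"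
    using G.metabelian_top_hom[OF h(1) K] by blast
  then show ?thesis using hs gen by (intro bexI[of _ h']) (simp_all add: top_gen_def)
qed

lemma metabelian_top_artin_generated:
  "top_gen \<in> S \<rightarrow> carrier (metabelian_top (artin_group S E lam))"
  "generate (metabelian_top (artin_group S E lam)) (top_gen ` S) = carrier (metabelian_top (artin_group S E lam))"
  "artin_map S E lam (metabelian_top (artin_group S E lam)) top_gen"
proof -
  let ?G = "artin_group S E lam" and ?R = "artin_relations E lam"
  let ?M = "metabelian_top ?G" and ?N = "derived ?G (derived ?G (carrier ?G))" and ?p = "\<lambda>x. pclass S ?R [(x, True)]"
  interpret G: group ?G by (rule group_artin_group)
  interpret N: normal ?N ?G by (rule G.second_derived_normal)
  interpret M: group ?M by (rule G.group_metabelian_top)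
  interpret p: group_hom ?G ?M "\<lambda>a. ?N #>\<^bsub>?G\<^esub> a"
    using N.r_coset_hom_Mod M.is_group by (simp add: group_hom_def group_hom_axioms_def metabelian_top_def)
  have pres: "presentation_of ?G S ?R ?p"
    unfolding artin_group_def by (rule presentation_of_presented_group)
  then have pc: "?p \<in> S \<rightarrow> carrier ?G" and gen: "generate ?G (?p ` S) = carrier ?G"
    by (simp_all add: presentation_of_def)
  have tg: "top_gen = (\<lambda>x. ?N #>\<^bsub>?G\<^esub> ?p x)" by (simp add: fun_eq_iff top_gen_def)
  show g: "top_gen \<in> S \<rightarrow> carrier ?M" using pc p.hom_closed by (auto simp: top_gen_def Pi_iff)
  have "generate ?M (top_gen ` S) = (\<lambda>a. ?N #>\<^bsub>?G\<^esub> a) ` generate ?G (?p ` S)"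
    using p.generate_img[of "?p ` S"] pc by (auto simp: top_gen_def image_image)
  then show "generate ?M (top_gen ` S) = carrier ?M"
    unfolding gen by (simp add: metabelian_top_def carrier_FactGroup)
  have "word_eval ?M top_gen (alt_word (lam {s, t}) s t) = word_eval ?M top_gen (alt_word (lam {s, t}) t s)"
    if e: "{s, t} \<in> E" for s t
  proof -
    have w: "alt_word (lam {s, t}) s t \<in> words S" "alt_word (lam {s, t}) t s \<in> words S"
      using edge_vertices[OF e] by (auto intro: alt_word_words)
    have "(alt_word (lam {s, t}) s t, alt_word (lam {s, t}) t s) \<in> ?R"
      using e by (auto simp: artin_relations_def)
    then have "pres_equiv S ?R ([] @ alt_word (lam {s, t}) s t @ []) ([] @ alt_word (lam {s, t}) t s @ [])"
      using w by (intro pres_equiv.rel) auto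
    then have "word_eval ?G ?p (alt_word (lam {s, t}) s t) = word_eval ?G ?p (alt_word (lam {s, t}) t s)"
      using pres w by (simp add: presentation_of_def)
    then show ?thesis
      using G.word_eval_hom[OF p.homh M.is_group w(1) pc] G.word_eval_hom[OF p.homh M.is_group w(2) pc]
      unfolding tg by simp
  qed
  then show "artin_map S E lam ?M top_gen" using g unfolding artin_map_def by blast
qed

end


section \<open>The lamplighter groups\<close>

text \<open>The wreath product of \<int>\<open>/p\<close> by \<int>, for \<open>p\<close> not
  necessarily prime: a shift and a configuration of lamps, with residues represented in the range
  from \<open>0\<close> to \<open>p - 1\<close>. Finite support matters: a finitely generated
  subgroup of the base lights only finitely many positions altogether.\<close>

definition lamplighter :: "int \<Rightarrow> (int \<times> (int \<Rightarrow> int)) monoid" where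
  "lamplighter p = \<lparr>carrier = {(n, f). (\<forall>j. 0 \<le> f j \<and> f j < p) \<and> finite {j. f j \<noteq> 0}},
     mult = (\<lambda>(n, f) (m, g). (n + m, \<lambda>j. (f j + g (j - n)) mod p)),
     one = (0, \<lambda>_. 0)\<rparr>"

lemma lamplighter_simps:
  "(n, f) \<in> carrier (lamplighter p) \<longleftrightarrow> (\<forall>j. 0 \<le> f j \<and> f j < p) \<and> finite {j. f j \<noteq> 0}"
  "(n, f) \<otimes>\<^bsub>lamplighter p\<^esub> (m, g) = (n + m, \<lambda>j. (f j + g (j - n)) mod p)"
  "\<one>\<^bsub>lamplighter p\<^esub> = (0, \<lambda>_. 0)"
  by (simp_all add: lamplighter_def)

lemma finite_shift: "finite {j. f j \<noteq> (0::int)} \<Longrightarrow> finite {j. f (j - n) \<noteq> 0}" for n :: int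
proof -
  assume "finite {j. f j \<noteq> 0}"
  moreover have "{j. f (j - n) \<noteq> 0} = (\<lambda>j. j + n) ` {j. f j \<noteq> 0}"
    by (auto simp: image_iff intro!: exI[of _ "_ - n"])
  ultimately show ?thesis by simp
qed

lemma lamplighter_mult_closed:
  assumes p: "p > 0" and "x \<in> carrier (lamplighter p)" "y \<in> carrier (lamplighter p)"
  shows "x \<otimes>\<^bsub>lamplighter p\<^esub> y \<in> carrier (lamplighter p)"
proof -
  obtain n f m g where x: "x = (n, f)" and y: "y = (m, g)" by fastforce
  have "{j. (f j + g (j - n)) mod p \<noteq> 0} \<subseteq> {j. f j \<noteq> 0} \<union> {j. g (j - n) \<noteq> 0}" by auto
  moreover have "finite ({j. f j \<noteq> 0} \<union> {j. g (j - n) \<noteq> 0})"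
    using assms finite_shift[of g n] unfolding x y by (simp add: lamplighter_simps)
  ultimately have "finite {j. (f j + g (j - n)) mod p \<noteq> 0}" by (rule finite_subset)
  then show ?thesis using p unfolding x y by (simp add: lamplighter_simps)
qed

lemma lamplighter_inv:
  assumes p: "p > 0" and "(n, f) \<in> carrier (lamplighter p)"
  shows "(- n, \<lambda>j. (- f (j + n)) mod p) \<in> carrier (lamplighter p)"
    "(- n, \<lambda>j. (- f (j + n)) mod p) \<otimes>\<^bsub>lamplighter p\<^esub> (n, f) = \<one>\<^bsub>lamplighter p\<^esub>"
proof -
  have "{j. (- f (j + n)) mod p \<noteq> 0} \<subseteq> {j. f (j - (- n)) \<noteq> 0}" by auto
  moreover have "finite {j. f (j - (- n)) \<noteq> 0}" using assms by (intro finite_shift) (simp add: lamplighter_simps)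
  ultimately have "finite {j. (- f (j + n)) mod p \<noteq> 0}" by (rule finite_subset)
  then show "(- n, \<lambda>j. (- f (j + n)) mod p) \<in> carrier (lamplighter p)"
    using p by (simp add: lamplighter_simps)
  show "(- n, \<lambda>j. (- f (j + n)) mod p) \<otimes>\<^bsub>lamplighter p\<^esub> (n, f) = \<one>\<^bsub>lamplighter p\<^esub>"
    by (simp add: lamplighter_simps mod_simps)
qed

lemma group_lamplighter:
  assumes p: "p > 0"
  shows "group (lamplighter p)"
proof (rule groupI)
  show "\<one>\<^bsub>lamplighter p\<^esub> \<in> carrier (lamplighter p)" using p by (simp add: lamplighter_simps)
  fix x y z assume x: "x \<in> carrier (lamplighter p)" and y: "y \<in> carrier (lamplighter p)"
    and z: "z \<in> carrier (lamplighter p)"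
  obtain n f m g l h where xyz: "x = (n, f)" "y = (m, g)" "z = (l, h)" by fastforce
  show "x \<otimes>\<^bsub>lamplighter p\<^esub> y \<otimes>\<^bsub>lamplighter p\<^esub> z = x \<otimes>\<^bsub>lamplighter p\<^esub> (y \<otimes>\<^bsub>lamplighter p\<^esub> z)"
    unfolding xyz by (simp add: lamplighter_simps mod_simps algebra_simps)
next
  fix x assume x: "x \<in> carrier (lamplighter p)"
  obtain n f where xx: "x = (n, f)" by fastforce
  show "\<one>\<^bsub>lamplighter p\<^esub> \<otimes>\<^bsub>lamplighter p\<^esub> x = x"
    using x unfolding xx by (simp add: lamplighter_simps)
  show "\<exists>y\<in>carrier (lamplighter p). y \<otimes>\<^bsub>lamplighter p\<^esub> x = \<one>\<^bsub>lamplighter p\<^esub>"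
    using lamplighter_inv[OF p, of n f] x unfolding xx by blast
qed (rule lamplighter_mult_closed[OF p])

lemma fst_lamplighter_hom: "fst \<in> hom (lamplighter p) integer_group"
  by (rule homI) (auto simp: lamplighter_simps split: prod.splits)

lemma metabelian_lamplighter:
  assumes p: "p > 0"
  shows "metabelian (lamplighter p)"
proof -
  interpret K: group "lamplighter p" by (rule group_lamplighter[OF p])
  interpret f: group_hom "lamplighter p" integer_group fst
    using fst_lamplighter_hom by (simp add: group_hom_def group_hom_axioms_def K.is_group)
  have "fst x = 0" if "x \<in> derived (lamplighter p) (carrier (lamplighter p))" for x
  proof -
    have "fst ` derived (lamplighter p) (carrier (lamplighter p)) = derived integer_group (fst ` carrier (lamplighter p))"
      using f.derived_img by simp
    also have "\<dots> \<subseteq> {\<one>\<^bsub>integer_group\<^esub>}"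
      using comm_group.derived_eq_singleton[OF abelian_integer_group] by auto
    finally show ?thesis using that by auto
  qed
  then show ?thesis
  proof (intro metabelian.intro metabelian_axioms.intro K.is_group)
    fix x y
    assume *: "\<And>x. x \<in> derived (lamplighter p) (carrier (lamplighter p)) \<Longrightarrow> fst x = 0"
      "x \<in> derived (lamplighter p) (carrier (lamplighter p))" "y \<in> derived (lamplighter p) (carrier (lamplighter p))"
    obtain f g where "x = (0, f)" "y = (0, g)" using *(1)[OF *(2)] *(1)[OF *(3)] by (cases x; cases y) auto
    then show "x \<otimes>\<^bsub>lamplighter p\<^esub> y = y \<otimes>\<^bsub>lamplighter p\<^esub> x"
      by (simp add: lamplighter_simps add.commute)
  qed
qed

lemma metabelian_integer_group: "metabelian integer_group"
  by (intro metabelian.intro metabelian_axioms.intro group_integer_group) auto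

section \<open>Finitely presented metabelian tops of Artin groups\<close>

text \<open>The map sending \<open>g\<close> to \<open>r g\<close> times \<open>x^(- c g)\<close> is
  a crossed homomorphism: its value at \<open>g1 \<otimes> g2\<close> is the value at
  \<open>g1\<close> times the value at \<open>g2\<close> conjugated by \<open>x^(c g1)\<close>.
  Hence generators determine it up to conjugation by powers of \<open>x\<close>.\<close>

lemma (in group) twisted_generate:
  assumes r: "r \<in> hom G G" and c: "c \<in> hom G integer_group" and x: "x \<in> carrier G"
    and F: "F \<subseteq> carrier G" and g: "g \<in> generate G F"
  shows "r g \<otimes> x [^] (- c g) \<in> generate G {cj G (x [^] (j::int)) (r f \<otimes> x [^] (- c f)) | j f. f \<in> F}"
proof -
  interpret r: group_hom G G r using r by (simp add: group_hom_def group_hom_axioms_def)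
  interpret c: group_hom G integer_group c by (rule group_hom_integer[OF is_group c])
  have c_simps: "c (a \<otimes> b) = c a + c b" "c (inv a) = - c a" if "a \<in> carrier G" "b \<in> carrier G" for a b
    using that c.hom_mult c.hom_inv by auto
  let ?X = "{cj G (x [^] (j::int)) (r f \<otimes> x [^] (- c f)) | j f. f \<in> F}"
  have X: "?X \<subseteq> carrier G" using x F by auto
  have W: "subgroup (generate G ?X) G" by (rule generate_is_subgroup[OF X])
  have X_cj: "cj G (x [^] (i::int)) (cj G (x [^] (j::int)) (r f \<otimes> x [^] (- c f))) \<in> ?X" if "f \<in> F" for i j f
  proof -
    have "cj G (x [^] i) (cj G (x [^] j) (r f \<otimes> x [^] (- c f))) = cj G (x [^] (i + j)) (r f \<otimes> x [^] (- c f))"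
      using x F that by (subst cj_cj) (auto simp: int_pow_mult)
    then show ?thesis using that by blast
  qed
  have W_cj: "cj G (x [^] (i::int)) b \<in> generate G ?X" if "b \<in> generate G ?X" for b i
    by (rule generate_cj_closed[OF int_pow_closed[OF x] X _ that]) (use X_cj in \<open>auto intro: generate.incl\<close>)
  have base: "r f \<otimes> x [^] (- c f) \<in> generate G ?X" if "f \<in> F" for f
  proof (rule generate.incl)
    have "cj G (x [^] (0::int)) (r f \<otimes> x [^] (- c f)) = r f \<otimes> x [^] (- c f)"
      using x F that by auto
    then show "r f \<otimes> x [^] (- c f) \<in> ?X" using that by (auto intro!: exI[of _ 0] exI[of _ f])
  qed
  show ?thesis using g
  proof induction
    case one
    show ?case using c.hom_one by (simp add: generate.one)
  next
    case (incl f)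
    then show ?case by (rule base)
  next
    case (inv f)
    have f: "f \<in> carrier G" using inv F by blast
    have "r (inv f) \<otimes> x [^] (- c (inv f)) = inv (cj G (x [^] (- c f)) (r f \<otimes> x [^] (- c f)))"
      using f x c_simps by (simp add: cj_def group_simps int_pow_neg)
    then show ?case using subgroup.m_inv_closed[OF W W_cj[OF base[OF inv]]] by simp
  next
    case (eng g1 g2)
    have g: "g1 \<in> carrier G" "g2 \<in> carrier G" using eng generate_in_carrier[OF F] by auto
    have "x [^] (- c g1 - c g2) = x [^] (- c g2) \<otimes> x [^] (- c g1)"
      using x by (simp flip: int_pow_mult add: algebra_simps)
    then have "r (g1 \<otimes> g2) \<otimes> x [^] (- c (g1 \<otimes> g2)) =
        (r g1 \<otimes> x [^] (- c g1)) \<otimes> cj G (x [^] c g1) (r g2 \<otimes> x [^] (- c g2))"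
      using g x c_simps by (simp add: cj_def group_simps int_pow_neg)
    then show ?case using generate.eng[OF eng.IH(1) W_cj[OF eng.IH(2)]] by simp
  qed
qed

text \<open>The universal property of the metabelian top is assumed for three targets, since locale
  assumptions cannot quantify over types: \<open>G\<close> itself for the inversion and the
  retractions, \<int> for the characters, and the lamplighter groups.\<close>

locale artin_metabelian = metabelian G + labelled_graph S E lam
  for G (structure) and S :: "'s set" and E lam +
  fixes \<gamma>
  assumes \<gamma>_map: "artin_map S E lam G \<gamma>"
    and \<gamma>_gen: "generate G (\<gamma> ` S) = carrier G"
    and ext_self: "\<And>k. artin_map S E lam G k \<Longrightarrow> \<exists>h\<in>hom G G. \<forall>s\<in>S. h (\<gamma> s) = k s"
    and ext_int: "\<And>k. artin_map S E lam integer_group k \<Longrightarrow> \<exists>h\<in>hom G integer_group. \<forall>s\<in>S. h (\<gamma> s) = k s"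
    and ext_lamplighter: "\<And>k p. p > 0 \<Longrightarrow> artin_map S E lam (lamplighter p) k \<Longrightarrow>
      \<exists>h\<in>hom G (lamplighter p). \<forall>s\<in>S. h (\<gamma> s) = k s"
begin

lemma \<gamma>_Pi: "\<gamma> \<in> S \<rightarrow> carrier G" using \<gamma>_map by (simp add: artin_map_def)

lemma \<gamma>_closed [simp, intro]: "s \<in> S \<Longrightarrow> \<gamma> s \<in> carrier G" using \<gamma>_Pi by auto

lemma \<gamma>_image: "\<gamma> ` S \<subseteq> carrier G" by auto

lemma hom_eqI:
  assumes "group K" "h \<in> hom G K" "h' \<in> hom G K" "\<And>s. s \<in> S \<Longrightarrow> h (\<gamma> s) = h' (\<gamma> s)" "g \<in> carrier G"
  shows "h g = h' g"
  using hom_eq_on_generate[OF assms(2,3,1) \<gamma>_image, of g] assms(4,5) \<gamma>_gen by auto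

lemma \<gamma>_even:
  "{s, t} \<in> E \<Longrightarrow> lam {s, t} = 2 * m \<Longrightarrow> (\<gamma> s \<otimes> \<gamma> t) [^] m = (\<gamma> t \<otimes> \<gamma> s) [^] m"
  using \<gamma>_map artin_map_iff[OF is_group \<gamma>_Pi] by blast

lemma \<gamma>_odd:
  "{s, t} \<in> E \<Longrightarrow> lam {s, t} = 2 * m + 1 \<Longrightarrow> \<gamma> s \<otimes> (\<gamma> t \<otimes> \<gamma> s) [^] m = \<gamma> t \<otimes> (\<gamma> s \<otimes> \<gamma> t) [^] m"
  using \<gamma>_map artin_map_iff[OF is_group \<gamma>_Pi] by blast

section \<open>Components of the odd edges, and characters\<close>

definition odd_edge :: "('s \<times> 's) set" where
  "odd_edge = {(s, t). {s, t} \<in> E \<and> odd (lam {s, t})}"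

definition component :: "'s \<Rightarrow> 's set" where "component s = {t. (s, t) \<in> odd_edge\<^sup>*}"

lemma odd_edge_sym: "(s, t) \<in> odd_edge \<Longrightarrow> (t, s) \<in> odd_edge"
  by (simp add: odd_edge_def insert_commute)

lemma odd_edge_S: "(s, t) \<in> odd_edge \<Longrightarrow> s \<in> S \<and> t \<in> S"
  using edge_vertices by (auto simp: odd_edge_def)

lemma component_self [simp]: "s \<in> component s" by (simp add: component_def)

lemma sym_odd_edge_rtrancl: "(s, t) \<in> odd_edge\<^sup>* \<Longrightarrow> (t, s) \<in> odd_edge\<^sup>*"
  by (meson odd_edge_sym sym_def sym_rtrancl)

lemma component_eq_iff: "component s = component t \<longleftrightarrow> t \<in> component s"
  unfolding component_def using sym_odd_edge_rtrancl by (auto intro: rtrancl_trans)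

lemma component_S: "t \<in> component s \<Longrightarrow> s \<in> S \<Longrightarrow> t \<in> S"
  unfolding component_def mem_Collect_eq by (induction rule: rtrancl_induct) (use odd_edge_S in auto)

lemma component_odd_edge: "(t, u) \<in> odd_edge \<Longrightarrow> t \<in> component s \<longleftrightarrow> u \<in> component s"
  unfolding component_def using odd_edge_sym by (auto intro: rtrancl_into_rtrancl)

lemma component_odd_label: "{t, u} \<in> E \<Longrightarrow> odd (lam {t, u}) \<Longrightarrow> t \<in> component s \<longleftrightarrow> u \<in> component s"
  by (rule component_odd_edge) (simp add: odd_edge_def)

lemma integer_character:
  assumes "\<And>s t. (s, t) \<in> odd_edge \<Longrightarrow> c s = c t"
  shows "\<exists>\<chi>\<in>hom G integer_group. \<forall>s\<in>S. \<chi> (\<gamma> s) = c s"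
proof (rule ext_int, rule artin_map_commuteI)
  fix s t assume "{s, t} \<in> E" "odd (lam {s, t})"
  then show "c s = c t" using assms by (simp add: odd_edge_def)
qed (auto simp: algebra_simps)

text \<open>The relations are invariant under inverting all generators.\<close>

lemma inversion:
  "\<exists>\<alpha>\<in>hom G G. (\<forall>s\<in>S. \<alpha> (\<gamma> s) = inv \<gamma> s) \<and> (\<forall>g\<in>carrier G. \<alpha> (\<alpha> g) = g)"
proof -
  have i: "(\<lambda>s. inv \<gamma> s) \<in> S \<rightarrow> carrier G" by auto
  have "artin_map S E lam G (\<lambda>s. inv \<gamma> s)"
    unfolding artin_map_iff[OF is_group i]
  proof (intro allI impI conjI)
    fix s t and m :: nat assume e: "{s, t} \<in> E"
    have c: "\<gamma> s \<in> carrier G" "\<gamma> t \<in> carrier G" using edge_vertices[OF e] by auto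
    have p: "(inv a \<otimes> inv b) [^] m = inv ((b \<otimes> a) [^] m)" if "a \<in> carrier G" "b \<in> carrier G" for a b
      using that nat_pow_inv[of "b \<otimes> a" m] inv_mult_group[of b a] by simp
    show "(inv \<gamma> s \<otimes> inv \<gamma> t) [^] m = (inv \<gamma> t \<otimes> inv \<gamma> s) [^] m" if "lam {s, t} = 2 * m"
      using \<gamma>_even[OF e that] c by (simp add: p)
    show "inv \<gamma> s \<otimes> (inv \<gamma> t \<otimes> inv \<gamma> s) [^] m = inv \<gamma> t \<otimes> (inv \<gamma> s \<otimes> inv \<gamma> t) [^] m" if "lam {s, t} = 2 * m + 1"
    proof -
      have q: "inv a \<otimes> (inv b \<otimes> inv a) [^] m = inv (a \<otimes> (b \<otimes> a) [^] m)"
        if "a \<in> carrier G" "b \<in> carrier G" for a b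
        using that p[of b a] pow_swap[of a b m] by (simp add: inv_mult_group)
      show ?thesis using \<gamma>_odd[OF e that] c by (simp add: q)
    qed
  qed
  then obtain \<alpha> where \<alpha>: "\<alpha> \<in> hom G G" "\<And>s. s \<in> S \<Longrightarrow> \<alpha> (\<gamma> s) = inv \<gamma> s"
    using ext_self by blast
  interpret \<alpha>: group_hom G G \<alpha> using \<alpha> by (simp add: group_hom_def group_hom_axioms_def)
  have "\<alpha> (\<alpha> g) = g" if "g \<in> carrier G" for g
  proof -
    have "(\<lambda>g. \<alpha> (\<alpha> g)) \<in> hom G G" "(\<lambda>g. g) \<in> hom G G" by (auto simp: hom_def)
    from hom_eqI[OF is_group this _ that] show ?thesis using \<alpha>(2) by simp
  qed
  then show ?thesis using \<alpha> by blast
qed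

text \<open>The inversion turns \<chi> into its negative. The value \<open>1\<close> has to be taken
  at a vertex, because the section must be inverted as well, and inversion is only known to invert
  the vertices.\<close>

lemma character_kernel_finitely_generated:
  assumes fp: "finitely_presented G" and \<chi>: "\<chi> \<in> hom G integer_group" and s: "s \<in> S" "\<chi> (\<gamma> s) = 1"
  shows "\<exists>F. finite F \<and> F \<subseteq> carrier G \<and> generate G F = {g \<in> carrier G. \<chi> g = 0}"
proof -
  from finitely_presented_imp_presentation[OF fp]
  obtain X :: "nat set" and R k where X: "finite X" "finite R"
    and p: "presentation_of G X R k"
    by (elim exE conjE) (rule that)
  interpret HNN G \<chi> "\<gamma> s" X R k
    by unfold_locales (use X p \<chi> s in auto)
  obtain \<alpha> where \<alpha>: "\<alpha> \<in> hom G G" "\<And>s. s \<in> S \<Longrightarrow> \<alpha> (\<gamma> s) = inv \<gamma> s" "\<And>g. g \<in> carrier G \<Longrightarrow> \<alpha> (\<alpha> g) = g"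
    using inversion by blast
  interpret \<alpha>: group_hom G G \<alpha> using \<alpha> by (simp add: group_hom_def group_hom_axioms_def)
  have "\<chi> (\<alpha> g) = - \<chi> g" if "g \<in> carrier G" for g
  proof -
    have "(\<lambda>g. \<chi> (\<alpha> g)) \<in> hom G integer_group" "(\<lambda>g. - \<chi> g) \<in> hom G integer_group"
      by (auto simp: hom_def)
    from hom_eqI[OF group_integer_group this _ that] show ?thesis using \<alpha>(2) by simp
  qed
  then show ?thesis using kernel_finitely_generated[OF derived_comm \<alpha>(1,3) \<alpha>(2)[OF s(1)]] by blast
qed

text \<open>Otherwise \<open>G\<close> maps onto the lamplighter group \<open>\<int>/p \<wr> \<int>\<close> in such a way that the kernel of
  the character with value \<open>1\<close> on the one component and \<open>-1\<close> on the other has as its image the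
  infinitely generated base group.\<close>

lemma even_edge_between_components:
  fixes p :: int
  assumes fp: "finitely_presented G" and s: "s \<in> S" and t: "t \<in> S" "t \<notin> component s" and p: "p \<ge> 2"
  shows "\<exists>s'\<in>component s. \<exists>t'\<in>component t. \<exists>m. {s', t'} \<in> E \<and> lam {s', t'} = 2 * m \<and> \<not> p dvd int m"
proof (rule ccontr)
  assume contra: "\<not> ?thesis"
  let ?K = "lamplighter p"
  interpret K: metabelian ?K by (rule metabelian_lamplighter) (use p in simp)
  have disj: "u \<notin> component s" if "u \<in> component t" for u
    using that t(2) component_eq_iff by metis
  define \<delta> :: "int \<Rightarrow> int \<Rightarrow> int" where "\<delta> i j = (if j = i then 1 else 0)" for i j
  \<comment> \<open>\<sigma> moves by \<open>1\<close>, and \<beta> moves by \<open>-1\<close> while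
    switching one lamp. Their products in either order are then single lamps, of order dividing
    \<open>p\<close>, so an even relation between the two components holds in \<open>?K\<close>
    whenever \<open>p\<close> divides half its label.\<close>
  define \<sigma> where "\<sigma> = (1::int, \<lambda>_::int. 0::int)"
  define \<beta> where "\<beta> = (-1::int, \<delta> (-1))"
  define k where "k u = (if u \<in> component s then \<sigma> else if u \<in> component t then \<beta> else \<one>\<^bsub>?K\<^esub>)" for u
  have fin: "finite {j. \<delta> i j \<noteq> 0}" for i
    by (rule finite_subset[of _ "{i}"]) (auto simp: \<delta>_def)
  have \<sigma>K: "\<sigma> \<in> carrier ?K" using p by (simp add: \<sigma>_def lamplighter_simps)
  have \<delta>K: "(n, \<delta> i) \<in> carrier ?K" for n i using p fin by (simp add: lamplighter_simps) (simp add: \<delta>_def)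
  have \<beta>K: "\<beta> \<in> carrier ?K" unfolding \<beta>_def by (rule \<delta>K)
  have kK: "k \<in> S \<rightarrow> carrier ?K" using \<sigma>K \<beta>K by (auto simp: k_def)
  have \<sigma>\<beta>: "\<sigma> \<otimes>\<^bsub>?K\<^esub> \<beta> = (0, \<delta> 0)" "\<beta> \<otimes>\<^bsub>?K\<^esub> \<sigma> = (0, \<delta> (-1))"
    using p by (auto simp: \<sigma>_def \<beta>_def \<delta>_def lamplighter_simps fun_eq_iff)
  have \<delta>_pow: "(0, \<delta> i) [^]\<^bsub>?K\<^esub> m = (0, \<lambda>j. (int m * \<delta> i j) mod p)" for i and m :: nat
    by (induction m) (simp_all add: lamplighter_simps mod_simps algebra_simps)
  have \<delta>_torsion: "(0, \<delta> i) [^]\<^bsub>?K\<^esub> m = \<one>\<^bsub>?K\<^esub>" if "p dvd int m" for i and m :: nat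
    using that by (simp add: \<delta>_pow lamplighter_simps)
  have "artin_map S E lam ?K k"
  proof (rule artin_map_commuteI[OF K.is_group kK])
    fix u v assume e: "{u, v} \<in> E"
    show "k u = k v" if "odd (lam {u, v})"
      using component_odd_label[OF e that] by (simp add: k_def)
    fix m assume m: "lam {u, v} = 2 * m"
    have kc: "k u \<in> carrier ?K" "k v \<in> carrier ?K" using kK edge_vertices[OF e] by auto
    consider "u \<in> component s" "v \<in> component t" | "v \<in> component s" "u \<in> component t" | "k u = k v \<or> k u = \<one>\<^bsub>?K\<^esub> \<or> k v = \<one>\<^bsub>?K\<^esub>"
      by (cases "u \<in> component s"; cases "v \<in> component s"; cases "u \<in> component t"; cases "v \<in> component t")
        (simp_all add: k_def)
    then show "(k u \<otimes>\<^bsub>?K\<^esub> k v) [^]\<^bsub>?K\<^esub> m = (k v \<otimes>\<^bsub>?K\<^esub> k u) [^]\<^bsub>?K\<^esub> m"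
    proof cases
      case 1
      then have "p dvd int m" using contra e m by blast
      then show ?thesis using 1 disj \<sigma>\<beta> \<delta>_torsion by (simp add: k_def)
    next
      case 2
      have "{v, u} \<in> E" "lam {v, u} = 2 * m" using e m by (simp_all add: insert_commute)
      then have "p dvd int m" using contra 2 by blast
      then show ?thesis using 2 disj \<sigma>\<beta> \<delta>_torsion by (simp add: k_def)
    next
      case 3
      then show ?thesis using kc by auto
    qed
  qed
  then obtain h where h: "h \<in> hom G ?K" "\<And>u. u \<in> S \<Longrightarrow> h (\<gamma> u) = k u"
    using ext_lamplighter[of p k] p by auto
  interpret h: group_hom G ?K h using h K.is_group by (simp add: group_hom_def group_hom_axioms_def)
  define \<chi> where "\<chi> g = fst (h g)" for g
  have \<chi>: "\<chi> \<in> hom G integer_group"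
    using Group.hom_compose[OF h(1) fst_lamplighter_hom] unfolding \<chi>_def comp_def .
  have h\<gamma>: "h (\<gamma> s) = \<sigma>" "h (\<gamma> t) = \<beta>" using h(2) s t by (simp_all add: k_def)
  then have "\<chi> (\<gamma> s) = 1" by (simp add: \<chi>_def \<sigma>_def)
  then obtain F where F: "finite F" "F \<subseteq> carrier G" "generate G F = {g \<in> carrier G. \<chi> g = 0}"
    using character_kernel_finitely_generated[OF fp \<chi> s] by blast
  \<comment> \<open>The positions lit by the finitely many generators of the kernel. On the kernel
    the shift is zero and configurations add pointwise, so no kernel element lights a position
    outside \<open>Z\<close>.\<close>
  define Z where "Z = (\<Union>f\<in>F. {j. snd (h f) j \<noteq> 0})"
  have "finite {j. snd (h f) j \<noteq> 0}" if "f \<in> F" for f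
    using h.hom_closed[of f] F(2) that by (cases "h f") (auto simp: lamplighter_simps)
  then have finZ: "finite Z" using F(1) by (simp add: Z_def)
  have supp: "{j. snd (h g) j \<noteq> 0} \<subseteq> Z" if "g \<in> generate G F" for g
    using that
  proof induction
    case one
    then show ?case by (simp add: lamplighter_simps)
  next
    case (incl f)
    then show ?case by (auto simp: Z_def)
  next
    case (inv f)
    have f: "f \<in> carrier G" "\<chi> f = 0" using inv F(2,3) generate.incl[of f F G] by auto
    obtain a where a: "h f = (0, a)" using f(2) by (cases "h f") (simp add: \<chi>_def)
    have "p > 0" "(0, a) \<in> carrier ?K" using p h.hom_closed[OF f(1)] a by auto
    note li = lamplighter_inv[OF this]
    have "inv\<^bsub>?K\<^esub> (0, a) = (- 0, \<lambda>j. (- a (j + 0)) mod p)"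
      by (rule K.inv_equality[OF li(2) \<open>(0, a) \<in> carrier ?K\<close> li(1)])
    then have "h (inv f) = (0, \<lambda>j. (- a j) mod p)" using h.hom_inv[OF f(1)] a by simp
    then have "{j. snd (h (inv f)) j \<noteq> 0} \<subseteq> {j. snd (h f) j \<noteq> 0}" using a by auto
    then show ?case using inv by (auto simp: Z_def)
  next
    case (eng g1 g2)
    have g: "g1 \<in> carrier G" "g2 \<in> carrier G" "\<chi> g1 = 0" "\<chi> g2 = 0" using eng.hyps F(3) by auto
    obtain a b where ab: "h g1 = (0, a)" "h g2 = (0, b)"
      using g(3,4) by (cases "h g1"; cases "h g2") (simp add: \<chi>_def)
    have "h (g1 \<otimes> g2) = (0, \<lambda>j. (a j + b j) mod p)" using g ab by (simp add: lamplighter_simps)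
    moreover have "{j. (a j + b j) mod p \<noteq> 0} \<subseteq> {j. a j \<noteq> 0} \<union> {j. b j \<noteq> 0}" by auto
    ultimately show ?case using eng.IH ab by auto
  qed
  obtain j :: int where j: "j \<ge> 0" "j \<notin> Z"
  proof -
    have "infinite {0::int..}" by (rule infinite_Ici)
    then have "\<not> {0..} \<subseteq> Z" using finZ finite_subset by blast
    then show ?thesis using that by auto
  qed
  have \<sigma>_pow: "\<sigma> [^]\<^bsub>?K\<^esub> n = (int n, \<lambda>_. 0)" for n :: nat
    by (induction n) (simp_all add: \<sigma>_def lamplighter_simps)
  \<comment> \<open>Conjugating \<open>\<sigma> \<beta>\<close>, the lamp at \<open>0\<close>, by
    \<open>\<sigma>^j\<close> gives the lamp at \<open>j\<close> alone, a position chosen outside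
    \<open>Z\<close>.\<close>
  define g where "g = cj G (\<gamma> s [^] nat j) (\<gamma> s \<otimes> \<gamma> t)"
  have gc: "g \<in> carrier G" using s t by (simp add: g_def)
  have inv_\<sigma>: "inv\<^bsub>?K\<^esub> (j, \<lambda>_. 0) = (- j, \<lambda>_. 0)"
    by (rule K.inv_equality) (use p in \<open>auto simp: lamplighter_simps\<close>)
  have "h g = cj ?K (\<sigma> [^]\<^bsub>?K\<^esub> nat j) (\<sigma> \<otimes>\<^bsub>?K\<^esub> \<beta>)"
    using s t h\<gamma> by (simp add: g_def cj_def h.hom_nat_pow)
  also have "\<dots> = (j, \<lambda>_. 0) \<otimes>\<^bsub>?K\<^esub> (0, \<delta> 0) \<otimes>\<^bsub>?K\<^esub> (- j, \<lambda>_. 0)"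
    using j(1) unfolding \<sigma>\<beta> \<sigma>_pow cj_def by (simp add: inv_\<sigma>)
  also have "\<dots> = (0, \<delta> j)"
    using p by (auto simp: lamplighter_simps \<delta>_def fun_eq_iff)
  finally have hg: "h g = (0, \<delta> j)" .
  then have "g \<in> generate G F" using F(3) gc by (simp add: \<chi>_def)
  then have "j \<in> Z" using supp[of g] hg by (auto simp: \<delta>_def)
  then show False using j by blast
qed

section \<open>Quotients of the ends of odd edges and the derived group\<close>

definition odd_quotient :: "'a set" where
  "odd_quotient = (\<lambda>(s, t). \<gamma> t \<otimes> inv \<gamma> s) ` odd_edge"

lemma finite_odd_edge: "finite odd_edge"
  by (rule finite_subset[of _ "S \<times> S"]) (use odd_edge_S finite_vertices in auto)

lemma odd_quotient_finite: "finite odd_quotient"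
  by (simp add: odd_quotient_def finite_odd_edge)

interpretation QA: comm_group "G Mod A"
  by (rule derived_quot_is_comm_group)

lemma qA_hom: "(\<lambda>g. A #> g) \<in> hom G (G Mod A)"
  by (rule normal.r_coset_hom_Mod[OF derived_self_is_normal])

lemma qA_eq_iff: "g \<in> carrier G \<Longrightarrow> h \<in> carrier G \<Longrightarrow> A #> g = A #> h \<longleftrightarrow> g \<otimes> inv h \<in> A"
  by (rule rcos_eq_iff[OF subgroup_derived])

interpretation qA: group_hom G "G Mod A" "\<lambda>g. A #> g"
  by (simp add: group_hom_def group_hom_axioms_def qA_hom QA.is_group)

text \<open>In the abelian quotient the two sides of an odd relation contain the same
  \<open>m\<close> pairs of letters; after cancellation one letter remains on each side.\<close>

lemma qA_odd_edge:
  assumes "(s, t) \<in> odd_edge"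
  shows "A #> \<gamma> s = A #> \<gamma> t"
proof -
  obtain m where e: "{s, t} \<in> E" and m: "lam {s, t} = 2 * m + 1"
    using assms by (auto simp: odd_edge_def elim: oddE)
  have c: "\<gamma> s \<in> carrier G" "\<gamma> t \<in> carrier G" using odd_edge_S[OF assms] by auto
  let ?Q = "G Mod A" and ?a = "A #> \<gamma> s" and ?b = "A #> \<gamma> t"
  have qc: "?a \<in> carrier (G Mod A)" "?b \<in> carrier (G Mod A)" using c qA.hom_closed by auto
  have "A #> (\<gamma> s \<otimes> (\<gamma> t \<otimes> \<gamma> s) [^] m) = A #> (\<gamma> t \<otimes> (\<gamma> s \<otimes> \<gamma> t) [^] m)"
    using \<gamma>_odd[OF e m] by simp
  moreover have "A #> (g \<otimes> (h \<otimes> g) [^] m) = (A #> g) \<otimes>\<^bsub>?Q\<^esub> ((A #> h) \<otimes>\<^bsub>?Q\<^esub> (A #> g)) [^]\<^bsub>?Q\<^esub> m"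
    if "g \<in> carrier G" "h \<in> carrier G" for g h
    using that qA.hom_mult[of g "(h \<otimes> g) [^] m"] qA.hom_nat_pow[of "h \<otimes> g" m] qA.hom_mult[of h g]
    by (simp del: mult_FactGroup)
  ultimately have "?a \<otimes>\<^bsub>?Q\<^esub> (?b \<otimes>\<^bsub>?Q\<^esub> ?a) [^]\<^bsub>?Q\<^esub> m = ?b \<otimes>\<^bsub>?Q\<^esub> (?a \<otimes>\<^bsub>?Q\<^esub> ?b) [^]\<^bsub>?Q\<^esub> m"
    using c by (simp del: mult_FactGroup)
  then have "?a \<otimes>\<^bsub>?Q\<^esub> (?a \<otimes>\<^bsub>?Q\<^esub> ?b) [^]\<^bsub>?Q\<^esub> m = ?b \<otimes>\<^bsub>?Q\<^esub> (?a \<otimes>\<^bsub>?Q\<^esub> ?b) [^]\<^bsub>?Q\<^esub> m"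
    using QA.m_comm[OF qc] by simp
  then show ?thesis using qc QA.right_cancel QA.nat_pow_closed QA.m_closed by metis
qed

lemma qA_component: "t \<in> component s \<Longrightarrow> A #> \<gamma> t = A #> \<gamma> s"
  unfolding component_def mem_Collect_eq
  by (induction rule: rtrancl_induct) (use qA_odd_edge in auto)

lemma component_quotient_A: "s \<in> S \<Longrightarrow> t \<in> component s \<Longrightarrow> \<gamma> t \<otimes> inv \<gamma> s \<in> A"
  using qA_component[of t s] qA_eq_iff[of "\<gamma> t" "\<gamma> s"] component_S by auto

lemma odd_quotient_A: "odd_quotient \<subseteq> A"
proof -
  have "\<gamma> t \<otimes> inv \<gamma> s \<in> A" if "(s, t) \<in> odd_edge" for s t
    using component_quotient_A[of s t] odd_edge_S[OF that] that by (auto simp: component_def)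
  then show ?thesis by (auto simp: odd_quotient_def)
qed

text \<open>Modulo the quotients of the vertices of odd edges, the generators of one component coincide.
  For two components the exponents \<open>n\<close> such that \<open>(st)\<^sup>n\<close> commutes with \<open>s\<close> form an ideal of
  \<open>\<int>\<close>, which is the unit ideal by
  \<open>even_edge_between_components\<close>.\<close>

lemma derived_normal_closure:
  assumes fp: "finitely_presented G"
  shows "A \<subseteq> generate G {cj G g u | g u. g \<in> carrier G \<and> u \<in> odd_quotient}"
proof -
  let ?X = "{cj G g u | g u. g \<in> carrier G \<and> u \<in> odd_quotient}"
  define N where "N = generate G ?X"
  have uc: "u \<in> carrier G" if "u \<in> odd_quotient" for u using odd_quotient_A A_closed that by blast
  have X: "?X \<subseteq> carrier G" using uc by auto
  have "N \<lhd> G"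
    unfolding N_def
  proof (rule normal_generateI[OF X])
    fix b g assume "b \<in> ?X" and g: "g \<in> carrier G"
    then obtain g' u where b: "b = cj G g' u" "g' \<in> carrier G" "u \<in> odd_quotient" by blast
    then have "g \<otimes> b \<otimes> inv g = cj G (g \<otimes> g') u"
      using g uc by (simp add: cj_def group_simps)
    then show "g \<otimes> b \<otimes> inv g \<in> ?X" using b g by blast
  qed
  then interpret N: normal N G .
  let ?Q = "G Mod N"
  interpret Q: group "?Q" by (rule N.factorgroup_is_group)
  interpret q: group_hom G "?Q" "\<lambda>g. N #> g"
    by (simp add: group_hom_def group_hom_axioms_def N.r_coset_hom_Mod Q.is_group)
  have q_edge: "N #> \<gamma> s = N #> \<gamma> t" if st: "(s, t) \<in> odd_edge" for s t
  proof -
    have c: "\<gamma> s \<in> carrier G" "\<gamma> t \<in> carrier G" using odd_edge_S[OF st] by auto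
    have u: "\<gamma> t \<otimes> inv \<gamma> s \<in> odd_quotient" using st by (force simp: odd_quotient_def)
    have "cj G \<one> (\<gamma> t \<otimes> inv \<gamma> s) = \<gamma> t \<otimes> inv \<gamma> s" using c by simp
    then have "\<gamma> t \<otimes> inv \<gamma> s \<in> ?X" using u one_closed by force
    then have "\<gamma> t \<otimes> inv \<gamma> s \<in> N" unfolding N_def by (rule generate.incl)
    then show ?thesis using rcos_eq_iff[OF N.subgroup_axioms c(2,1)] by simp
  qed
  have q_comp: "N #> \<gamma> t = N #> \<gamma> s" if "t \<in> component s" for s t
    using that unfolding component_def mem_Collect_eq
    by (induction rule: rtrancl_induct) (use q_edge in auto)
  have commute: "(N #> \<gamma> s) \<otimes>\<^bsub>?Q\<^esub> (N #> \<gamma> t) = (N #> \<gamma> t) \<otimes>\<^bsub>?Q\<^esub> (N #> \<gamma> s)"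
    if s: "s \<in> S" and t: "t \<in> S" for s t
  proof (cases "t \<in> component s")
    case True
    then show ?thesis using q_comp by simp
  next
    case False
    define a where "a = N #> \<gamma> s"
    define b where "b = N #> \<gamma> t"
    have ab: "a \<in> carrier (?Q)" "b \<in> carrier (?Q)"
      using s t q.hom_closed unfolding a_def b_def by auto
    define P where "P n \<longleftrightarrow> cj (?Q) ((a \<otimes>\<^bsub>?Q\<^esub> b) [^]\<^bsub>?Q\<^esub> n) a = a" for n :: int
    let ?ab = "a \<otimes>\<^bsub>?Q\<^esub> b"
    have abc: "?ab \<in> carrier (?Q)" using ab Q.m_closed by blast
    have abn: "?ab [^]\<^bsub>?Q\<^esub> n \<in> carrier (?Q)" for n :: int using Q.int_pow_closed[OF abc] .
    have "P 0" unfolding P_def using Q.cj_by_one[OF ab(1)] by simp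
    moreover have "P (i - j)" if "P i" "P j" for i j
    proof -
      have "cj (?Q) (?ab [^]\<^bsub>?Q\<^esub> i) a =
          cj (?Q) (?ab [^]\<^bsub>?Q\<^esub> (i - j)) (cj (?Q) (?ab [^]\<^bsub>?Q\<^esub> j) a)"
        using Q.cj_cj[OF abn abn ab(1), of "i - j" j] Q.int_pow_mult[OF abc, of "i - j" j] by simp
      then show ?thesis using that unfolding P_def by simp
    qed
    ultimately obtain m :: nat where m: "\<And>n. P n \<longleftrightarrow> int m dvd n" using int_ideal_generator[of P] by blast
    \<comment> \<open>Since \<open>(a b)^n a = a (b a)^n\<close>, the even relation says that
      \<open>(a b)^n\<close> commutes with \<open>a\<close>.\<close>
    have P_edge: "P (int n)" if e: "{s', t'} \<in> E" "s' \<in> component s" "t' \<in> component t" "lam {s', t'} = 2 * n" for s' t' n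
    proof -
      have c: "\<gamma> s' \<in> carrier G" "\<gamma> t' \<in> carrier G" using edge_vertices[OF e(1)] by auto
      have "N #> ((\<gamma> s' \<otimes> \<gamma> t') [^] n) = N #> ((\<gamma> t' \<otimes> \<gamma> s') [^] n)" using \<gamma>_even[OF e(1,4)] by simp
      moreover have "N #> ((g \<otimes> h) [^] n) = ((N #> g) \<otimes>\<^bsub>?Q\<^esub> (N #> h)) [^]\<^bsub>?Q\<^esub> n"
        if "g \<in> carrier G" "h \<in> carrier G" for g h
        using that q.hom_nat_pow[of "g \<otimes> h" n] q.hom_mult[of g h] by (simp del: mult_FactGroup)
      ultimately have "?ab [^]\<^bsub>?Q\<^esub> n = (b \<otimes>\<^bsub>?Q\<^esub> a) [^]\<^bsub>?Q\<^esub> n"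
        using c q_comp[OF e(2)] q_comp[OF e(3)] unfolding a_def b_def by (simp del: mult_FactGroup)
      then have "?ab [^]\<^bsub>?Q\<^esub> n \<otimes>\<^bsub>?Q\<^esub> a = a \<otimes>\<^bsub>?Q\<^esub> ?ab [^]\<^bsub>?Q\<^esub> n"
        using Q.pow_swap[OF ab, of n] by simp
      then show ?thesis unfolding P_def int_pow_int
        by (subst Q.cj_eq_self_iff[OF Q.nat_pow_closed[OF abc] ab(1)])
    qed
    have "m = 1"
    proof (rule ccontr)
      assume "m \<noteq> 1"
      \<comment> \<open>\<open>p\<close> need not be prime: it is \<open>2\<close> if
        \<open>m = 0\<close>, and \<open>m\<close> itself otherwise.\<close>
      then obtain p :: int where p: "p \<ge> 2" "p dvd int m"
        by (cases "m = 0") (force intro: that[of 2] that[of "int m"])+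
      obtain s' t' n where st: "s' \<in> component s" "t' \<in> component t" "{s', t'} \<in> E" "lam {s', t'} = 2 * n"
        and n: "\<not> p dvd int n"
        using even_edge_between_components[OF fp s t False p(1)] by blast
      have "int m dvd int n" using P_edge[OF st(3,1,2,4)] m by blast
      then show False using p(2) n dvd_trans by blast
    qed
    then have "P 1" using m by simp
    then have "?ab \<otimes>\<^bsub>?Q\<^esub> a = a \<otimes>\<^bsub>?Q\<^esub> ?ab"
      unfolding P_def using Q.cj_eq_self_iff[OF abc ab(1)] Q.int_pow_1[OF abc] by simp
    then have "b \<otimes>\<^bsub>?Q\<^esub> a = ?ab"
      using ab Q.m_assoc[OF ab(1,2,1)] Q.inv_cancel_left(1)[OF ab(1) Q.m_closed[OF ab(2,1)]]
        Q.inv_cancel_left(1)[OF ab(1) abc] by (metis (no_types))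
    then show ?thesis unfolding a_def b_def by simp
  qed
  have gen: "generate (?Q) ((\<lambda>g. N #> g) ` \<gamma> ` S) = carrier (?Q)"
    using q.generate_img[OF \<gamma>_image] \<gamma>_gen by (simp add: carrier_FactGroup)
  have comm: "x \<otimes>\<^bsub>?Q\<^esub> y = y \<otimes>\<^bsub>?Q\<^esub> x" if "x \<in> carrier (?Q)" "y \<in> carrier (?Q)" for x y
    by (rule Q.generate_commute[of "(\<lambda>g. N #> g) ` \<gamma> ` S"])
      (use that commute gen q.hom_closed in \<open>auto simp del: mult_FactGroup\<close>)
  have "derived_set G (carrier G) \<subseteq> N"
  proof
    fix d assume "d \<in> derived_set G (carrier G)"
    then obtain g h where gh: "g \<in> carrier G" "h \<in> carrier G" "d = g \<otimes> h \<otimes> inv g \<otimes> inv h" by blast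
    have "N #> (g \<otimes> h) = N #> (h \<otimes> g)"
      using comm[OF q.hom_closed[OF gh(1)] q.hom_closed[OF gh(2)]] q.hom_mult[OF gh(1,2)] q.hom_mult[OF gh(2,1)]
      by (simp del: mult_FactGroup)
    then show "d \<in> N" using rcos_eq_iff[OF N.subgroup_axioms, of "g \<otimes> h" "h \<otimes> g"] gh
      by (simp add: group_simps)
  qed
  then have "A \<subseteq> N" unfolding derived_def by (rule generate_subgroup_incl[OF _ N.subgroup_axioms])
  then show ?thesis unfolding N_def .
qed

section \<open>Periodicity of the action of a component on its own quotients\<close>

lemma cj_component:
  "s \<in> S \<Longrightarrow> t \<in> component s \<Longrightarrow> v \<in> A \<Longrightarrow> cj G (\<gamma> t) v = cj G (\<gamma> s) v"
  using cj_cong_mod_A[of "\<gamma> t" "\<gamma> s" v] component_quotient_A component_S by blast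

lemma cj_component_pow:
  assumes "s \<in> S" "t \<in> component s" "v \<in> A"
  shows "cj G (\<gamma> t [^] (n::nat)) v = cj G (\<gamma> s [^] n) v"
  using assms(3)
proof (induction n arbitrary: v)
  case (Suc n)
  have c: "\<gamma> s \<in> carrier G" "\<gamma> t \<in> carrier G" "v \<in> carrier G" using assms component_S Suc.prems A_closed by auto
  then have "cj G (\<gamma> t [^] Suc n) v = cj G (\<gamma> t [^] n) (cj G (\<gamma> t) v)" by (simp add: cj_cj)
  also have "\<dots> = cj G (\<gamma> t [^] n) (cj G (\<gamma> s) v)" using cj_component[OF assms(1,2) Suc.prems] by simp
  also have "\<dots> = cj G (\<gamma> s [^] n) (cj G (\<gamma> s) v)" using Suc.IH[OF derived_cj[OF c(1) Suc.prems]] .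
  also have "\<dots> = cj G (\<gamma> s [^] Suc n) v" using c by (simp add: cj_cj)
  finally show ?case .
qed (use A_closed in simp)

text \<open>In the group of one odd edge the square of \<open>u(s,t)\<close> is central, and it acts on \<open>A\<close> like
  \<open>s\<^sup>2\<^sup>n\<close>, where \<open>n\<close> is the label.\<close>

lemma odd_edge_period:
  assumes st: "(s, t) \<in> odd_edge"
  shows "cj G (\<gamma> s [^] (2 * lam {s, t})) (\<gamma> t \<otimes> inv \<gamma> s) = \<gamma> t \<otimes> inv \<gamma> s"
proof -
  define a b where "a = \<gamma> s" and "b = \<gamma> t"
  obtain m where e: "{s, t} \<in> E" and m: "lam {s, t} = 2 * m + 1"
    using st by (auto simp: odd_edge_def elim: oddE)
  have sS: "s \<in> S" and ts: "t \<in> component s" using odd_edge_S[OF st] st by (auto simp: component_def)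
  have c [simp]: "a \<in> carrier G" "b \<in> carrier G" using odd_edge_S[OF st] by (auto simp: a_def b_def)
  have uA: "b \<otimes> inv a \<in> A" unfolding a_def b_def by (rule component_quotient_A[OF sS ts])
  have cj_b: "cj G b v = cj G a v" if "v \<in> A" for v
    unfolding a_def b_def by (rule cj_component[OF sS ts that])
  \<comment> \<open>\<open>d\<close> is the value of \<open>u(s,t)\<close>. Its four expressions
    show that moving \<open>d\<close> past a letter exchanges \<open>a\<close> and \<open>b\<close>;
    therefore the square of \<open>d\<close> commutes with both.\<close>
  define d where "d = a \<otimes> (b \<otimes> a) [^] m"
  have d [simp]: "d \<in> carrier G" by (simp add: d_def)
  have d1: "d = (a \<otimes> b) [^] m \<otimes> a" unfolding d_def by (rule pow_swap) simp_all
  have d2: "d = b \<otimes> (a \<otimes> b) [^] m" using \<gamma>_odd[OF e m] by (simp add: d_def a_def b_def)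
  have d3: "d = (b \<otimes> a) [^] m \<otimes> b" unfolding d2 by (rule pow_swap) simp_all
  have "a \<otimes> d = (a \<otimes> b) \<otimes> (a \<otimes> b) [^] m" unfolding d2 by (simp add: m_assoc)
  also have "\<dots> = (a \<otimes> b) [^] m \<otimes> (a \<otimes> b)" using nat_pow_Suc2[of "a \<otimes> b" m] by simp
  also have "\<dots> = d \<otimes> b" unfolding d1 by (simp add: m_assoc)
  finally have ad: "a \<otimes> d = d \<otimes> b" .
  have "b \<otimes> d = (b \<otimes> a) \<otimes> (b \<otimes> a) [^] m" unfolding d_def by (simp add: m_assoc)
  also have "\<dots> = (b \<otimes> a) [^] m \<otimes> (b \<otimes> a)" using nat_pow_Suc2[of "b \<otimes> a" m] by simp
  also have "\<dots> = d \<otimes> a" unfolding d3 by (simp add: m_assoc)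
  finally have bd: "b \<otimes> d = d \<otimes> a" .
  have "d \<otimes> d \<otimes> a = a \<otimes> (d \<otimes> d)" "d \<otimes> d \<otimes> b = b \<otimes> (d \<otimes> d)"
    using m_assoc[of d b d] m_assoc[of a d d] m_assoc[of d d a] m_assoc[of d a d] m_assoc[of b d d]
      m_assoc[of d d b] by (simp_all add: ad bd)
  then have "cj G (d \<otimes> d) a = a" "cj G (d \<otimes> d) b = b" by (simp_all add: cj_eq_self_iff)
  then have fixed: "cj G (d \<otimes> d) (b \<otimes> inv a) = b \<otimes> inv a" by (simp add: cj_mult cj_inv)
  have ab_pow: "cj G ((a \<otimes> b) [^] k) v = cj G (a [^] (2 * k)) v" if "v \<in> A" for k :: nat and v
    using that
  proof (induction k arbitrary: v)
    case (Suc k)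
    have vc: "v \<in> carrier G" using Suc.prems A_closed by blast
    have "cj G ((a \<otimes> b) [^] Suc k) v = cj G ((a \<otimes> b) [^] k) (cj G a (cj G b v))" using vc by (simp add: cj_cj)
    also have "\<dots> = cj G (a [^] (2 * k)) (cj G a (cj G a v))"
      unfolding cj_b[OF Suc.prems] using Suc.IH derived_cj Suc.prems by simp
    also have "\<dots> = cj G (a [^] (2 * Suc k)) v" using vc by (simp add: cj_cj m_assoc)
    finally show ?case .
  qed simp
  \<comment> \<open>On \<open>A\<close> the element \<open>b\<close> acts like \<open>a\<close>,
    because they agree modulo \<open>A\<close>. As a product of \<open>lam {s, t}\<close> letters,
    \<open>d\<close> acts like that power of \<open>a\<close>.\<close>
  have d_pow: "cj G d v = cj G (a [^] lam {s, t}) v" if "v \<in> A" for v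
  proof -
    have "cj G d v = cj G ((a \<otimes> b) [^] m) (cj G a v)" unfolding d1 using that A_closed by (simp add: cj_cj)
    also have "\<dots> = cj G (a [^] (2 * m)) (cj G a v)" using ab_pow derived_cj that by simp
    also have "\<dots> = cj G (a [^] lam {s, t}) v" unfolding m using that A_closed by (simp add: cj_cj)
    finally show ?thesis .
  qed
  let ?n = "lam {s, t}"
  have "cj G (a [^] (2 * ?n)) (b \<otimes> inv a) = cj G (a [^] ?n) (cj G (a [^] ?n) (b \<otimes> inv a))"
    by (simp add: cj_cj nat_pow_mult mult_2)
  also have "\<dots> = cj G d (cj G d (b \<otimes> inv a))" using d_pow uA derived_cj by simp
  also have "\<dots> = b \<otimes> inv a" using fixed by (simp add: cj_cj)
  finally show ?thesis by (simp add: a_def b_def)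
qed

text \<open>One exponent for all odd edges at once: the factor \<open>2\<close> comes from squaring
  \<open>u(s,t)\<close>, and the product is a common multiple of the labels.\<close>

definition period :: nat where "period = 2 * (\<Prod>e\<in>E. lam e)"

lemma period_pos: "period > 0"
  using labels finite_E by (fastforce simp: period_def intro!: prod_pos)

text \<open>All vertices of a component act alike on \<open>A\<close>, so the period found at an end
  of the edge is valid for every vertex \<open>s0\<close> of its component.\<close>

lemma component_period:
  assumes st: "(s, t) \<in> odd_edge" and s0: "s0 \<in> S" "s \<in> component s0"
  shows "cj G (\<gamma> s0 [^] int period) (\<gamma> t \<otimes> inv \<gamma> s) = \<gamma> t \<otimes> inv \<gamma> s"
proof -
  let ?u = "\<gamma> t \<otimes> inv \<gamma> s" and ?n = "lam {s, t}"
  have c: "\<gamma> s \<in> carrier G" "\<gamma> t \<in> carrier G" "s \<in> S" using odd_edge_S[OF st] by auto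
  have uA: "?u \<in> A" using component_quotient_A[OF c(3)] st by (auto simp: component_def)
  have "?n dvd (\<Prod>e\<in>E. lam e)" using st finite_E by (intro dvd_prodI) (auto simp: odd_edge_def)
  then obtain q where q: "period = 2 * ?n * q" by (auto simp: period_def dvd_def)
  have "cj G ((\<gamma> s [^] (2 * ?n)) [^] q) ?u = ?u" for q :: nat
  proof (induction q)
    case (Suc q)
    have "cj G ((\<gamma> s [^] (2 * ?n)) [^] Suc q) ?u = cj G ((\<gamma> s [^] (2 * ?n)) [^] q) (cj G (\<gamma> s [^] (2 * ?n)) ?u)"
      using c by (simp add: cj_cj)
    then show ?case using Suc odd_edge_period[OF st] by simp
  qed (use c in simp)
  then have "cj G (\<gamma> s [^] period) ?u = ?u" using c by (simp add: q nat_pow_pow)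
  then show ?thesis using cj_component_pow[OF s0 uA, of period] by (simp add: int_pow_int)
qed

section \<open>The retract onto two components\<close>

lemma character_A:
  assumes "\<chi> \<in> hom G integer_group" "a \<in> A"
  shows "\<chi> a = 0"
proof -
  interpret \<chi>: group_hom G integer_group \<chi> by (rule group_hom_integer[OF is_group assms(1)])
  have "\<chi> ` A = derived integer_group (\<chi> ` carrier G)"
    using \<chi>.derived_img by simp
  also have "\<dots> \<subseteq> {\<one>\<^bsub>integer_group\<^esub>}"
    using comm_group.derived_eq_singleton[OF abelian_integer_group] by auto
  finally show ?thesis using assms(2) by auto
qed

text \<open>Killing the generators outside two components defines a retraction \<open>r\<close>, because edges between
  different components have even labels. Hence \<open>r\<close> maps the kernels of the characters of
  the two components into themselves, and \<open>r ` A\<close> is finitely generated over each of \<open>\<gamma> s\<close>, \<open>\<gamma> t\<close>.\<close>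

lemma component_pair:
  assumes fp: "finitely_presented G" and s: "s \<in> S" and t: "t \<in> S" "t \<notin> component s"
  shows "\<exists>D. finite D \<and> D \<subseteq> A \<and> normalized_by G (\<gamma> t) (generate G D) \<and>
    (\<forall>a b. (a, b) \<in> odd_edge \<longrightarrow> a \<in> component s \<longrightarrow> \<gamma> b \<otimes> inv \<gamma> a \<in> generate G D)"
proof -
  define C where "C = component s \<union> component t"
  have disj: "u \<notin> component s" if "u \<in> component t" for u
    using that t(2) component_eq_iff by metis
  have C_edge: "a \<in> C \<longleftrightarrow> b \<in> C" if "(a, b) \<in> odd_edge" for a b
    using component_odd_edge[OF that] by (simp add: C_def)
  define k where "k u = (if u \<in> C then \<gamma> u else \<one>)" for u
  have kG: "k \<in> S \<rightarrow> carrier G" by (auto simp: k_def)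
  have "artin_map S E lam G k"
    unfolding artin_map_iff[OF is_group kG]
  proof (intro allI impI conjI)
    fix u v and m :: nat assume e: "{u, v} \<in> E"
    have c: "\<gamma> u \<in> carrier G" "\<gamma> v \<in> carrier G" using edge_vertices[OF e] by auto
    show "(k u \<otimes> k v) [^] m = (k v \<otimes> k u) [^] m" if "lam {u, v} = 2 * m"
      using \<gamma>_even[OF e that] c by (simp add: k_def)
    show "k u \<otimes> (k v \<otimes> k u) [^] m = k v \<otimes> (k u \<otimes> k v) [^] m" if m: "lam {u, v} = 2 * m + 1"
    proof -
      have "(u, v) \<in> odd_edge" using e m by (simp add: odd_edge_def)
      then show ?thesis using C_edge \<gamma>_odd[OF e m] by (simp add: k_def)
    qed
  qed
  then obtain r where r: "r \<in> hom G G" "\<And>u. u \<in> S \<Longrightarrow> r (\<gamma> u) = k u" using ext_self by blast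
  interpret r: group_hom G G r using r by (simp add: group_hom_def group_hom_axioms_def)
  have r_idem: "r (r g) = r g" if "g \<in> carrier G" for g
  proof -
    have "(\<lambda>g. r (r g)) \<in> hom G G" by (auto simp: hom_def)
    from hom_eqI[OF is_group this r(1) _ that] show ?thesis using r(2) by (simp add: k_def)
  qed
  define x y where "x = \<gamma> s" and "y = \<gamma> t"
  have xc [simp]: "x \<in> carrier G" and yc [simp]: "y \<in> carrier G" using s t by (simp_all add: x_def y_def)
  have rx: "r x = x" and ry: "r y = y" using s t r(2) by (simp_all add: x_def y_def k_def C_def)
  obtain \<chi>1 where \<chi>1: "\<chi>1 \<in> hom G integer_group" "\<And>u. u \<in> S \<Longrightarrow> \<chi>1 (\<gamma> u) = (if u \<in> component s then 1 else 0)"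
    using integer_character[of "\<lambda>u. if u \<in> component s then 1 else 0"] component_odd_edge by auto
  obtain \<chi>2 where \<chi>2: "\<chi>2 \<in> hom G integer_group" "\<And>u. u \<in> S \<Longrightarrow> \<chi>2 (\<gamma> u) = (if u \<in> component t then 1 else 0)"
    using integer_character[of "\<lambda>u. if u \<in> component t then 1 else 0"] component_odd_edge by auto
  interpret \<chi>1: group_hom G integer_group \<chi>1 by (rule group_hom_integer[OF is_group \<chi>1(1)])
  interpret \<chi>2: group_hom G integer_group \<chi>2 by (rule group_hom_integer[OF is_group \<chi>2(1)])
  \<comment> \<open>Both sides give homomorphisms to the abelian group \<open>G / A\<close>, and
    they agree on the vertices, because the vertices of one component have the same image
    there.\<close>
  have mod_A: "r g \<otimes> inv (x [^] \<chi>1 g \<otimes> y [^] \<chi>2 g) \<in> A" if g: "g \<in> carrier G" for g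
  proof -
    let ?Q = "G Mod A"
    let ?h = "\<lambda>g. (A #> x) [^]\<^bsub>?Q\<^esub> \<chi>1 g \<otimes>\<^bsub>?Q\<^esub> (A #> y) [^]\<^bsub>?Q\<^esub> \<chi>2 g"
    have q: "A #> x \<in> carrier (?Q)" "A #> y \<in> carrier (?Q)" using qA.hom_closed by auto
    have h1: "(\<lambda>g. A #> r g) \<in> hom G (?Q)"
      using Group.hom_compose[OF r(1) qA_hom] unfolding comp_def .
    have "(\<lambda>g. (A #> x) [^]\<^bsub>?Q\<^esub> \<chi>1 g) \<in> hom G (?Q)" "(\<lambda>g. (A #> y) [^]\<^bsub>?Q\<^esub> \<chi>2 g) \<in> hom G (?Q)"
      using Group.hom_compose[OF \<chi>1(1) QA.hom_integer_group_pow[OF q(1)]]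
        Group.hom_compose[OF \<chi>2(1) QA.hom_integer_group_pow[OF q(2)]] unfolding comp_def by auto
    then have h2: "?h \<in> hom G (?Q)" by (rule QA.hom_group_mult)
    have "A #> r g = ?h g"
    proof (rule hom_eqI[OF QA.is_group h1 h2 _ g])
      fix u assume u: "u \<in> S"
      consider "u \<in> component s" "u \<notin> component t" | "u \<in> component t" "u \<notin> component s" | "u \<notin> C"
        using disj unfolding C_def by blast
      then show "A #> r (\<gamma> u) = ?h (\<gamma> u)"
      proof cases
        case 1
        then show ?thesis using u \<chi>1(2)[OF u] \<chi>2(2)[OF u] q r(2)[OF u] qA_component[of u s]
          by (simp add: k_def C_def x_def del: mult_FactGroup one_FactGroup)
      next
        case 2
        then show ?thesis using u \<chi>1(2)[OF u] \<chi>2(2)[OF u] q r(2)[OF u] qA_component[of u t]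
          by (simp add: k_def C_def y_def del: mult_FactGroup one_FactGroup)
      next
        case 3
        then show ?thesis using u \<chi>1(2)[OF u] \<chi>2(2)[OF u] q r(2)[OF u] qA.hom_one
          by (simp add: k_def C_def del: mult_FactGroup one_FactGroup coset_mult_one)
      qed
    qed
    also have "\<dots> = A #> (x [^] \<chi>1 g \<otimes> y [^] \<chi>2 g)"
      using qA.hom_mult[of "x [^] \<chi>1 g" "y [^] \<chi>2 g"] qA.hom_int_pow[of x] qA.hom_int_pow[of y]
      by (simp del: mult_FactGroup)
    finally show ?thesis using qA_eq_iff[of "r g" "x [^] \<chi>1 g \<otimes> y [^] \<chi>2 g"] g by simp
  qed
  define V where "V = r ` A"
  have r_cj: "r (cj G g h) = cj G (r g) (r h)" if "g \<in> carrier G" "h \<in> carrier G" for g h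
    using that by (simp add: cj_def)
  have "r ` carrier G \<subseteq> carrier G" by auto
  then have V_A: "V \<subseteq> A"
    unfolding V_def using r.derived_img[of "carrier G"] mono_derived[of "r ` carrier G" "carrier G"] by simp
  have V_I: "v \<in> V" if "v \<in> A" "r v = v" for v using that unfolding V_def by (metis imageI)
  have V_sub: "subgroup V G" unfolding V_def by (rule r.subgroup_img_is_subgroup[OF subgroup_derived])
  have V_norm: "normalized_by G z V" if z: "z \<in> carrier G" "r z = z" for z
    unfolding normalized_by_def
  proof (intro ballI conjI)
    fix v assume "v \<in> V"
    then obtain a where a: "a \<in> A" "v = r a" by (auto simp: V_def)
    have ac: "a \<in> carrier G" using a A_closed by blast
    have "cj G z v = r (cj G z a)" "cj G (inv z) v = r (cj G (inv z) a)"
      using a(2) ac z r_cj by simp_all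
    then show "cj G z v \<in> V" "cj G (inv z) v \<in> V" unfolding V_def using derived_cj a(1) z by auto
  qed
  \<comment> \<open>\<open>z\<close> is paired with the character \<chi>' of the other component. On
    the kernel of \<chi>' the retraction is a power of \<open>z\<close> modulo \<open>A\<close>;
    dividing by that power turns finitely many generators of the kernel into elements of
    \<open>V\<close> that generate it over \<open>z\<close>.\<close>
  have span: "\<exists>F. finite F \<and> F \<subseteq> V \<and> V \<subseteq> generate G {cj G (z [^] (j::int)) f | j f. f \<in> F}"
    if z: "z \<in> carrier G" "r z = z" and \<chi>: "\<chi> \<in> hom G integer_group" "\<chi>' \<in> hom G integer_group"
      and ker: "\<And>g. g \<in> carrier G \<Longrightarrow> \<chi>' g = 0 \<Longrightarrow> r g \<otimes> z [^] (- \<chi> g) \<in> A"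
      and one: "u \<in> S" "\<chi>' (\<gamma> u) = 1" for z \<chi> \<chi>' u
  proof -
    obtain F where F: "finite F" "F \<subseteq> carrier G" "generate G F = {g \<in> carrier G. \<chi>' g = 0}"
      using character_kernel_finitely_generated[OF fp \<chi>(2) one] by blast
    define F' where "F' = (\<lambda>f. r f \<otimes> z [^] (- \<chi> f)) ` F"
    have "F' \<subseteq> V"
    proof
      fix f' assume "f' \<in> F'"
      then obtain f where f: "f \<in> F" "f' = r f \<otimes> z [^] (- \<chi> f)" by (auto simp: F'_def)
      have fc: "f \<in> carrier G" "\<chi>' f = 0" using f(1) F(3) generate.incl[of f F G] by auto
      have "r f' = f'" using fc z r_idem r.hom_int_pow[of z] unfolding f(2) by simp
      then show "f' \<in> V" using V_I ker[OF fc] unfolding f(2) by blast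
    qed
    moreover have "V \<subseteq> generate G {cj G (z [^] (j::int)) f | j f. f \<in> F'}"
    proof
      fix v assume "v \<in> V"
      then obtain a where a: "a \<in> A" "v = r a" by (auto simp: V_def)
      have "a \<in> generate G F" using a A_closed character_A[OF \<chi>(2)] F(3) by auto
      from twisted_generate[OF r(1) \<chi>(1) z(1) F(2) this]
      have "v \<in> generate G {cj G (z [^] (j::int)) (r f \<otimes> z [^] (- \<chi> f)) | j f. f \<in> F}"
        using a A_closed character_A[OF \<chi>(1)] by simp
      moreover have "{cj G (z [^] (j::int)) (r f \<otimes> z [^] (- \<chi> f)) | j f. f \<in> F} \<subseteq>
          {cj G (z [^] (j::int)) f | j f. f \<in> F'}" unfolding F'_def by blast
      ultimately show "v \<in> generate G {cj G (z [^] (j::int)) f | j f. f \<in> F'}" using mono_generate by blast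
    qed
    ultimately show ?thesis using F(1) by (intro exI[of _ F']) (simp add: F'_def)
  qed
  have "r g \<otimes> x [^] (- \<chi>1 g) \<in> A" if "g \<in> carrier G" "\<chi>2 g = 0" for g
    using mod_A[OF that(1)] that(2) by (simp add: int_pow_neg)
  then obtain Fx where Fx: "finite Fx" "Fx \<subseteq> V" "V \<subseteq> generate G {cj G (x [^] (j::int)) f | j f. f \<in> Fx}"
    using span[OF xc rx \<chi>1(1) \<chi>2(1) _ t(1)] \<chi>2(2)[OF t(1)] by auto
  have "r g \<otimes> y [^] (- \<chi>2 g) \<in> A" if "g \<in> carrier G" "\<chi>1 g = 0" for g
    using mod_A[OF that(1)] that(2) by (simp add: int_pow_neg)
  then obtain Fy where Fy: "finite Fy" "Fy \<subseteq> V" "V \<subseteq> generate G {cj G (y [^] (j::int)) f | j f. f \<in> Fy}"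
    using span[OF yc ry \<chi>2(1) \<chi>1(1) _ s] \<chi>1(2)[OF s] by auto
  \<comment> \<open>The two families of module generators: quotients from \<open>component s\<close>
    are fixed by \<open>x^period\<close>, those from \<open>component t\<close> by
    \<open>y^period\<close>. The quotients of all other odd edges are killed by
    \<open>r\<close>.\<close>
  define U where "U z = (\<lambda>(a, b). \<gamma> b \<otimes> inv \<gamma> a) ` {(a, b) \<in> odd_edge. a \<in> component z}" for z
  have U_A: "U s \<union> U t \<subseteq> A" using odd_quotient_A by (auto simp: U_def odd_quotient_def)
  let ?W = "{cj G g u | g u. g \<in> carrier G \<and> u \<in> U s \<union> U t}"
  have r_quot: "r (\<gamma> b \<otimes> inv \<gamma> a) = (if a \<in> C then \<gamma> b \<otimes> inv \<gamma> a else \<one>)" if "(a, b) \<in> odd_edge" for a b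
    using odd_edge_S[OF that] C_edge[OF that] r(2) by (simp add: k_def)
  have "V \<subseteq> generate G ?W"
  proof
    fix v assume "v \<in> V"
    then obtain a where a: "a \<in> A" "v = r a" by (auto simp: V_def)
    let ?X = "{cj G g u | g u. g \<in> carrier G \<and> u \<in> odd_quotient}"
    have X: "?X \<subseteq> carrier G" using odd_quotient_A A_closed by blast
    have W: "?W \<subseteq> carrier G" using U_A A_closed by blast
    have "r ` ?X \<subseteq> generate G ?W"
    proof
      fix w assume "w \<in> r ` ?X"
      then obtain g a b where g: "g \<in> carrier G" and ab: "(a, b) \<in> odd_edge" and w: "w = r (cj G g (\<gamma> b \<otimes> inv \<gamma> a))"
        by (auto simp: odd_quotient_def)
      have w': "w = cj G (r g) (r (\<gamma> b \<otimes> inv \<gamma> a))" using w g odd_edge_S[OF ab] r_cj by simp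
      show "w \<in> generate G ?W"
      proof (cases "a \<in> C")
        case True
        then have "\<gamma> b \<otimes> inv \<gamma> a \<in> U s \<union> U t" using ab by (force simp: U_def C_def)
        moreover have "w = cj G (r g) (\<gamma> b \<otimes> inv \<gamma> a)" using w' r_quot[OF ab] True by simp
        ultimately have "w \<in> ?W" using r.hom_closed[OF g] by blast
        then show ?thesis by (rule generate.incl)
      next
        case False
        then show ?thesis unfolding w' r_quot[OF ab] using g by (simp add: generate.one)
      qed
    qed
    then have "r ` generate G ?X \<subseteq> generate G ?W"
      unfolding r.generate_img[OF X, symmetric] by (rule generate_absorb[OF W])
    then show "v \<in> generate G ?W" using a derived_normal_closure[OF fp] by blast
  qed
  moreover have "cj G (x [^] int period) u = u" if "u \<in> U s" for u
    using that component_period s unfolding U_def x_def by auto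
  moreover have "cj G (y [^] int period) u = u" if "u \<in> U t" for u
    using that component_period t unfolding U_def y_def by auto
  ultimately obtain D where D: "finite D" "D \<subseteq> A" "generate G D = V"
    using bicyclic_finitely_generated[OF xc yc period_pos V_A V_sub V_norm[OF xc rx] V_norm[OF yc ry] Fx Fy _ U_A]
    by blast
  have "\<gamma> b \<otimes> inv \<gamma> a \<in> V" if ab: "(a, b) \<in> odd_edge" "a \<in> component s" for a b
  proof (rule V_I)
    show "\<gamma> b \<otimes> inv \<gamma> a \<in> A" using odd_quotient_A ab(1) by (auto simp: odd_quotient_def)
    show "r (\<gamma> b \<otimes> inv \<gamma> a) = \<gamma> b \<otimes> inv \<gamma> a" using r_quot[OF ab(1)] ab(2) by (simp add: C_def)
  qed
  then show ?thesis using D V_norm[OF yc ry] unfolding y_def by (intro exI[of _ D]) simp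
qed

theorem finitely_presented_imp_polycyclic:
  assumes fp: "finitely_presented G"
  shows "polycyclic G"
proof -
  have local: "\<exists>D. finite D \<and> D \<subseteq> A \<and> f \<in> generate G D \<and> normalized_by G s' (generate G D)"
    if s': "s' \<in> \<gamma> ` S" and f: "f \<in> odd_quotient" for s' f
  proof -
    obtain s where s: "s \<in> S" "s' = \<gamma> s" using s' by blast
    obtain a b where ab: "(a, b) \<in> odd_edge" "f = \<gamma> b \<otimes> inv \<gamma> a" using f by (auto simp: odd_quotient_def)
    have a: "a \<in> S" using odd_edge_S[OF ab(1)] by simp
    have fA: "f \<in> A" using f odd_quotient_A by blast
    then have fc: "f \<in> carrier G" using A_closed by blast
    have sc: "\<gamma> s \<in> carrier G" using s by simp
    show ?thesis
    proof (cases "s \<in> component a")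
      case False
      then show ?thesis using component_pair[OF fp a s(1)] ab unfolding s(2) by (metis component_self)
    next
      case True
      then have "a \<in> component s" using component_eq_iff component_self by metis
      then have per: "cj G (\<gamma> s [^] int period) f = f" using component_period[OF ab(1) s(1)] ab(2) by simp
      \<comment> \<open>Inside its own component the orbit of \<open>f\<close> is periodic, so one
        period of it spans a subgroup normalized by \<open>\<gamma> s\<close>.\<close>
      define D where "D = (\<lambda>j. cj G (\<gamma> s [^] (j::int)) f) ` {0..<int period}"
      have DA: "D \<subseteq> A" using derived_cj fA sc by (auto simp: D_def)
      then have Dc: "D \<subseteq> carrier G" using A_subset by blast
      have orb: "cj G (\<gamma> s [^] (j::int)) f \<in> generate G D" for j
        using cj_int_pow_mod[OF sc fc per, of j] period_pos by (auto simp: D_def intro!: generate.incl)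
      have "normalized_by G (\<gamma> s) (generate G D)"
      proof (rule normalized_by_generateI[OF sc Dc])
        fix d assume "d \<in> D"
        then obtain j where d: "d = cj G (\<gamma> s [^] (j::int)) f" by (auto simp: D_def)
        have "cj G (\<gamma> s) d = cj G (\<gamma> s [^] (1 + j)) f"
          using sc fc int_pow_mult[OF sc, of 1 j] unfolding d by (simp add: cj_cj)
        then show "cj G (\<gamma> s) d \<in> generate G D" using orb by simp
        have "cj G (inv \<gamma> s) d = cj G (\<gamma> s [^] (- 1 + j)) f"
          using sc fc int_pow_mult[OF sc, of "- 1" j] int_pow_neg[OF sc, of 1] unfolding d by (simp add: cj_cj)
        then show "cj G (inv \<gamma> s) d \<in> generate G D" using orb by simp
      qed
      moreover have "f \<in> generate G D" using orb[of 0] fc by simp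
      moreover have "finite D" by (simp add: D_def)
      ultimately show ?thesis using DA unfolding s(2) by blast
    qed
  qed
  obtain F where "finite F" "F \<subseteq> carrier G" "generate G F = A"
    using derived_finitely_generated[OF _ \<gamma>_image \<gamma>_gen odd_quotient_finite odd_quotient_A
        derived_normal_closure[OF fp] local] finite_vertices by blast
  then show ?thesis
    using polycyclic_if_derived_finitely_generated[OF _ _ _ _ \<gamma>_image \<gamma>_gen derived_comm] finite_vertices
    by blast
qed

end

theorem theorem7p2:
  fixes S :: "'s set" and E :: "'s set set" and lam :: "'s set \<Rightarrow> nat"
  assumes "labelled_graph S E lam"
  shows "finitely_presented (metabelian_top (artin_group S E lam)) \<longleftrightarrow>
         polycyclic (metabelian_top (artin_group S E lam))"
proof -
  interpret labelled_graph S E lam by fact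
  interpret A: group "artin_group S E lam" by (rule group_artin_group)
  interpret M: metabelian "metabelian_top (artin_group S E lam)" by (rule A.metabelian_metabelian_top)
  interpret artin_metabelian "metabelian_top (artin_group S E lam)" S E lam top_gen
    by unfold_locales
      (use metabelian_top_artin_generated metabelian_top_artin_ext M.metabelian_axioms
        metabelian_integer_group metabelian_lamplighter in blast)+
  show ?thesis
    using finitely_presented_imp_polycyclic M.polycyclic_imp_finitely_presented by blast
qed

end
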